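(* For $b\in H_q^{\mathbb C}$ let $\psi_b(a)=\exp(-\langle a^2,b\rangle)$, $a\in\Pi_q$. For every $b\in H_q^{\mathbb C}$ there exist spherical functions $\phi_p$ of $(G_p,K_p)$ (integers $p\ge q$), regarded as functions on $\Pi_q$, such that $\phi_p\to\psi_b$ locally uniformly on $\Pi_q$ as $p\to\infty$. Moreover, for every $b\in\Pi_q$ there exist positive definite spherical functions $\phi_p$ of $(G_p,K_p)$, regarded as functions on $\Pi_q$, such that $\phi_p\to\psi_b$ uniformly on $\Pi_q$ as $p\to\infty$.
   Context: Let $\mathbb F\in\{\mathbb R,\mathbb C,\mathbb H\}$ and fix an integer $q\ge 1$. $M_{p,q}$ is the space of $p\times q$-matrices over $\mathbb F$, $U_p$ the group of unitary $p\times p$-matrices over $\mathbb F$, $x^*$ the conjugate transpose. For integers $p\ge q$ let $G_p=M_{p,q}\rtimes U_p$, where $U_p$ acts on $M_{p,q}$ by left multiplication, i.e. $(x,u)(y,v)=(x+uy,uv)$, and $K_p=U_p$ (identified with $\{0\}\times U_p$). $H_q=\{x\in M_{q,q}: x=x^*\}$ is the real vector space of Hermitian $q\times q$-matrices over $\mathbb F$, with scalar product $\langle x,y\rangle=\Re\,\mathrm{tr}(xy)$; $H_q^{\mathbb C}$ is its complexification, and $\langle\cdot,\cdot\rangle$ also denotes the extension to a Hermitian scalar product on $H_q^{\mathbb C}$ (linear in the first, conjugate-linear in the second argument). $\Pi_q\subset H_q$ is the set of positive semidefinite matrices. A spherical function of $(G_p,K_p)$ is a continuous $K_p$-biinvariant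 function $\phi:G_p\to\mathbb C$, not identically zero, with $\phi(g)\phi(h)=\int_{K_p}\phi(gkh)\,dk$ for all $g,h\in G_p$ ($dk$ normalized Haar measure). Positive definite means positive definite on the group $G_p$ in the usual sense. The double coset space $G_p/\!/K_p$ is identified with $\Pi_q$ via $K_p(x,k)K_p\mapsto\sqrt{x^*x}$, so continuous $K_p$-biinvariant functions on $G_p$ are identified with continuous functions on $\Pi_q$: $f\in C(\Pi_q)$ corresponds to $(x,k)\mapsto f(\sqrt{x^*x})$. (The functions $\psi_b$, $b\in H_q^{\mathbb C}$, are the Olshanski spherical functions of the inductive limit pair $(G_\infty,K_\infty)$, regarded as functions on $\Pi_q$.) *)

theory Defs
  imports "HOL-Analysis.Analysis" "HOL-Algebra.Group"
begin

section \<open>The quaternions\<close>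

datatype quat = Quat (qRe: real) (qI: real) (qJ: real) (qK: real)

lemma quat_eq_iff: "x = y \<longleftrightarrow> qRe x = qRe y \<and> qI x = qI y \<and> qJ x = qJ y \<and> qK x = qK y"
  by (auto intro: quat.expand)

instantiation quat :: real_algebra_1
begin

definition zero_quat :: quat where "0 = Quat 0 0 0 0"
definition one_quat :: quat where "1 = Quat 1 0 0 0"
definition plus_quat :: "quat \<Rightarrow> quat \<Rightarrow> quat" where
  "x + y = Quat (qRe x + qRe y) (qI x + qI y) (qJ x + qJ y) (qK x + qK y)"
definition minus_quat :: "quat \<Rightarrow> quat \<Rightarrow> quat" where
  "x - y = Quat (qRe x - qRe y) (qI x - qI y) (qJ x - qJ y) (qK x - qK y)"
definition uminus_quat :: "quat \<Rightarrow> quat" where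
  "- x = Quat (- qRe x) (- qI x) (- qJ x) (- qK x)"
definition scaleR_quat :: "real \<Rightarrow> quat \<Rightarrow> quat" where
  "r *\<^sub>R x = Quat (r * qRe x) (r * qI x) (r * qJ x) (r * qK x)"
definition times_quat :: "quat \<Rightarrow> quat \<Rightarrow> quat" where
  "x * y = Quat
     (qRe x * qRe y - qI x * qI y - qJ x * qJ y - qK x * qK y)
     (qRe x * qI y + qI x * qRe y + qJ x * qK y - qK x * qJ y)
     (qRe x * qJ y - qI x * qK y + qJ x * qRe y + qK x * qI y)
     (qRe x * qK y + qI x * qJ y - qJ x * qI y + qK x * qRe y)"

lemmas quat_defs = zero_quat_def one_quat_def plus_quat_def minus_quat_def uminus_quat_def
  scaleR_quat_def times_quat_def

instance
  by standard (simp_all add: quat_eq_iff quat_defs algebra_simps)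

end

instantiation quat :: real_normed_div_algebra
begin

definition norm_quat :: "quat \<Rightarrow> real" where
  "norm x = sqrt ((qRe x)\<^sup>2 + (qI x)\<^sup>2 + (qJ x)\<^sup>2 + (qK x)\<^sup>2)"
definition inverse_quat :: "quat \<Rightarrow> quat" where
  "inverse x = Quat (qRe x) (- qI x) (- qJ x) (- qK x) /\<^sub>R (norm x)\<^sup>2"
definition divide_quat :: "quat \<Rightarrow> quat \<Rightarrow> quat" where
  "divide_quat x y = x * inverse y"
definition sgn_quat :: "quat \<Rightarrow> quat" where "sgn_quat x = x /\<^sub>R norm x"
definition dist_quat :: "quat \<Rightarrow> quat \<Rightarrow> real" where "dist_quat x y = norm (x - y)"
definition uniformity_quat :: "(quat \<times> quat) filter" where
  "uniformity_quat = (INF e\<in>{0 <..}. principal {(x :: quat, y). dist x y < e})"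
definition open_quat :: "quat set \<Rightarrow> bool" where
  "open_quat U \<longleftrightarrow> (\<forall>x\<in>U. eventually (\<lambda>(x', y). x' = x \<longrightarrow> y \<in> U) uniformity)"

lemma norm_quat_power2: "(norm x)\<^sup>2 = (qRe x)\<^sup>2 + (qI x)\<^sup>2 + (qJ x)\<^sup>2 + (qK x)\<^sup>2" for x :: quat
  by (simp add: norm_quat_def)

lemma norm_quat_L2: "norm x = norm (Complex (qRe x) (qI x), Complex (qJ x) (qK x))"
  by (simp add: norm_quat_def norm_prod_def complex_norm)

instance
proof
  fix x y z :: quat and r s :: real
  show "norm x = 0 \<longleftrightarrow> x = 0"
    by (simp add: norm_quat_L2 norm_eq_zero zero_prod_def quat_eq_iff zero_quat_def complex_eq_iff)
  show "norm (x + y) \<le> norm x + norm y"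
    using norm_triangle_ineq[of "(Complex (qRe x) (qI x), Complex (qJ x) (qK x))"
        "(Complex (qRe y) (qI y), Complex (qJ y) (qK y))"]
    by (simp add: norm_quat_L2 plus_quat_def plus_complex.ctr)
  show "norm (r *\<^sub>R x) = \<bar>r\<bar> * norm x"
    using norm_scaleR[of r "(Complex (qRe x) (qI x), Complex (qJ x) (qK x))"]
    by (simp add: norm_quat_L2 scaleR_quat_def scaleR_complex.ctr)
  show "norm (x * y) = norm x * norm y"
    unfolding norm_quat_def real_sqrt_mult[symmetric] times_quat_def
    by (rule arg_cong[where f = sqrt]) (simp add: power2_eq_square algebra_simps)
  have inv: "Quat (qRe x) (- qI x) (- qJ x) (- qK x) * x = Quat ((norm x)\<^sup>2) 0 0 0"
    "x * Quat (qRe x) (- qI x) (- qJ x) (- qK x) = Quat ((norm x)\<^sup>2) 0 0 0"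
    unfolding norm_quat_power2 by (simp_all add: times_quat_def power2_eq_square)
  {
    assume "x \<noteq> 0"
    then have "(norm x)\<^sup>2 \<noteq> 0"
      by (simp add: norm_quat_L2 norm_eq_zero zero_prod_def quat_eq_iff zero_quat_def complex_eq_iff)
    moreover have "inverse x * x = (Quat (qRe x) (- qI x) (- qJ x) (- qK x) * x) /\<^sub>R (norm x)\<^sup>2"
      "x * inverse x = (x * Quat (qRe x) (- qI x) (- qJ x) (- qK x)) /\<^sub>R (norm x)\<^sup>2"
      by (simp_all add: inverse_quat_def times_quat_def scaleR_quat_def algebra_simps)
    ultimately show "inverse x * x = 1" "x * inverse x = 1"
      by (simp_all only: inv) (simp_all add: scaleR_quat_def one_quat_def)
  }
  show "x div y = x * inverse y" by (rule divide_quat_def)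
  show "inverse (0 :: quat) = 0"
    by (simp add: inverse_quat_def zero_quat_def scaleR_quat_def)
  show "sgn x = x /\<^sub>R norm x" by (rule sgn_quat_def)
  show "dist x y = norm (x - y)" by (rule dist_quat_def)
  show "(uniformity :: (quat \<times> quat) filter) = (INF e\<in>{0 <..}. principal {(x, y). dist x y < e})"
    by (rule uniformity_quat_def)
  show "open U \<longleftrightarrow> (\<forall>x\<in>U. eventually (\<lambda>(x', y). x' = x \<longrightarrow> y \<in> U) uniformity)" for U :: "quat set"
    by (rule open_quat_def)
qed

end

instantiation quat :: euclidean_space
begin

definition inner_quat :: "quat \<Rightarrow> quat \<Rightarrow> real" where
  "x \<bullet> y = qRe x * qRe y + qI x * qI y + qJ x * qJ y + qK x * qK y"
definition Basis_quat :: "quat set" where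
  "Basis = {Quat 1 0 0 0, Quat 0 1 0 0, Quat 0 0 1 0, Quat 0 0 0 1}"

instance
proof
  fix x y z :: quat and r :: real
  show "x \<bullet> x = 0 \<longleftrightarrow> x = 0"
  proof -
    have "x \<bullet> x = (norm x)\<^sup>2"
      by (subst norm_quat_power2) (simp add: inner_quat_def power2_eq_square)
    then show ?thesis by simp
  qed
  show "norm x = sqrt (x \<bullet> x)"
    by (simp add: inner_quat_def norm_quat_def power2_eq_square)
  show "(\<forall>u\<in>Basis. x \<bullet> u = 0) \<longleftrightarrow> x = 0"
    by (auto simp: Basis_quat_def inner_quat_def zero_quat_def intro: quat.expand)
qed (auto simp: inner_quat_def Basis_quat_def quat_defs algebra_simps)

end


section \<open>Scalars with conjugation\<close>

class star_scalar = real_normed_div_algebra + euclidean_space +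
  fixes star :: "'a \<Rightarrow> 'a"
    and re_part :: "'a \<Rightarrow> real"
  assumes star_star [simp]: "star (star x) = x"
    and star_add: "star (x + y) = star x + star y"
    and star_scaleR: "star (r *\<^sub>R x) = r *\<^sub>R star x"
    and star_mult: "star (x * y) = star y * star x"
    and add_star: "x + star x = (2 * re_part x) *\<^sub>R 1"
    and inner_star: "x \<bullet> y = re_part (star x * y)"

instantiation real :: star_scalar
begin
definition star_real :: "real \<Rightarrow> real" where "star_real x = x"
definition re_part_real :: "real \<Rightarrow> real" where "re_part_real x = x"
instance by standard (simp_all add: star_real_def re_part_real_def)
end

instantiation complex :: star_scalar
begin
definition star_complex :: "complex \<Rightarrow> complex" where "star_complex x = cnj x"
definition re_part_complex :: "complex \<Rightarrow> real" where "re_part_complex x = Re x"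
instance
  by standard (simp_all add: star_complex_def re_part_complex_def inner_complex_def complex_eq_iff)
end

instantiation quat :: star_scalar
begin
definition star_quat :: "quat \<Rightarrow> quat" where "star_quat x = Quat (qRe x) (- qI x) (- qJ x) (- qK x)"
definition re_part_quat :: "quat \<Rightarrow> real" where "re_part_quat x = qRe x"
instance
  by standard (simp_all add: star_quat_def re_part_quat_def inner_quat_def quat_defs)
end

lemma star_zero [simp]: "star (0 :: 'a::star_scalar) = 0"
  using star_scaleR[of 0 "0 :: 'a"] by simp

lemma star_one [simp]: "star (1 :: 'a::star_scalar) = 1"
  by (metis mult.right_neutral star_mult star_star mult.left_neutral)

lemma star_sum: "star (sum f A) = (\<Sum>x\<in>A. star (f x :: 'a::star_scalar))"
  by (induction A rule: infinite_finite_induct) (simp_all add: star_add)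


section \<open>Matrices of variable size\<close>

text \<open>
  A \<open>p \<times> q\<close> matrix is a function that vanishes outside \<open>{..<p} \<times> {..<q}\<close>. The product topology on
  functions induces the usual (entrywise) topology on these sets.
\<close>

type_synonym 'f nmat = "nat \<Rightarrow> nat \<Rightarrow> 'f"

definition Mat :: "nat \<Rightarrow> nat \<Rightarrow> 'f::zero nmat set" where
  "Mat p q = {x. \<forall>i j. \<not> (i < p \<and> j < q) \<longrightarrow> x i j = 0}"

definition madd :: "'f::plus nmat \<Rightarrow> 'f nmat \<Rightarrow> 'f nmat" where
  "madd x y = (\<lambda>i j. x i j + y i j)"

definition mzero :: "'f::zero nmat" where
  "mzero = (\<lambda>i j. 0)"

text \<open>The first argument of \<open>mmul\<close> is the common inner dimension.\<close>

definition mmul :: "nat \<Rightarrow> 'f::semiring_0 nmat \<Rightarrow> 'f nmat \<Rightarrow> 'f nmat" where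
  "mmul n x y = (\<lambda>i j. \<Sum>k<n. x i k * y k j)"

definition mone :: "nat \<Rightarrow> 'f::zero_neq_one nmat" where
  "mone n = (\<lambda>i j. if i = j \<and> i < n then 1 else 0)"

definition adj :: "'f::star_scalar nmat \<Rightarrow> 'f nmat" where
  "adj x = (\<lambda>i j. star (x j i))"

definition Umat :: "nat \<Rightarrow> 'f::star_scalar nmat set" where
  "Umat p = {u \<in> Mat p p. mmul p (adj u) u = mone p \<and> mmul p u (adj u) = mone p}"

definition Herm :: "nat \<Rightarrow> 'f::star_scalar nmat set" where
  "Herm q = {x \<in> Mat q q. adj x = x}"

text \<open>For Hermitian \<open>x\<close> the quadratic form below is real, so taking \<open>re_part\<close> loses nothing.\<close>

definition PSD :: "nat \<Rightarrow> 'f::star_scalar nmat set" where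
  "PSD q = {x \<in> Herm q. \<forall>v :: nat \<Rightarrow> 'f. 0 \<le> re_part (\<Sum>i<q. \<Sum>j<q. star (v i) * x i j * v j)}"

definition psd_sqrt :: "nat \<Rightarrow> 'f::star_scalar nmat \<Rightarrow> 'f nmat" where
  "psd_sqrt q x = (THE a. a \<in> PSD q \<and> mmul q a a = x)"

definition herm_inner :: "nat \<Rightarrow> 'f::star_scalar nmat \<Rightarrow> 'f nmat \<Rightarrow> real" where
  "herm_inner q x y = re_part (\<Sum>i<q. mmul q x y i i)"

text \<open>
  The complexification of \<open>Herm q\<close>: the pair \<open>(x, y)\<close> stands for \<open>x + \<i> y\<close>, where \<open>\<i>\<close> is the new
  imaginary unit (not the one of the scalars).
\<close>

definition HermC :: "nat \<Rightarrow> ('f::star_scalar nmat \<times> 'f nmat) set" where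
  "HermC q = Herm q \<times> Herm q"

definition to_HermC :: "'f::zero nmat \<Rightarrow> 'f nmat \<times> 'f nmat" where
  "to_HermC x = (x, mzero)"

text \<open>The extension of \<open>herm_inner\<close>, linear in the first and conjugate-linear in the second argument.\<close>

fun hermC_inner :: "nat \<Rightarrow> 'f::star_scalar nmat \<times> 'f nmat \<Rightarrow> 'f nmat \<times> 'f nmat \<Rightarrow> complex" where
  "hermC_inner q (x, y) (z, w) =
     Complex (herm_inner q x z + herm_inner q y w) (herm_inner q y z - herm_inner q x w)"


section \<open>Spherical functions\<close>

text \<open>
  On a compact group with a countable base, the normalized Haar measure is the unique left-invariant
  Borel probability measure.
\<close>

definition normalized_haar ::
    "('g::topological_space, 'm) monoid_scheme \<Rightarrow> 'g set \<Rightarrow> 'g measure \<Rightarrow> bool" where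
  "normalized_haar G K \<mu> \<longleftrightarrow>
     sets \<mu> = sets (restrict_space borel K) \<and> emeasure \<mu> K = 1 \<and>
     (\<forall>k\<in>K. \<forall>A\<in>sets \<mu>. emeasure \<mu> ((\<lambda>x. k \<otimes>\<^bsub>G\<^esub> x) ` A) = emeasure \<mu> A)"

definition spherical ::
    "('g::topological_space, 'm) monoid_scheme \<Rightarrow> 'g set \<Rightarrow> ('g \<Rightarrow> complex) \<Rightarrow> bool" where
  "spherical G K \<phi> \<longleftrightarrow>
     continuous_on (carrier G) \<phi> \<and>
     (\<forall>k\<in>K. \<forall>l\<in>K. \<forall>g\<in>carrier G. \<phi> (k \<otimes>\<^bsub>G\<^esub> g \<otimes>\<^bsub>G\<^esub> l) = \<phi> g) \<and>
     (\<exists>g\<in>carrier G. \<phi> g \<noteq> 0) \<and>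
     (\<exists>\<mu>. normalized_haar G K \<mu> \<and>
        (\<forall>g\<in>carrier G. \<forall>h\<in>carrier G.
           \<phi> g * \<phi> h = (\<integral>k. \<phi> (g \<otimes>\<^bsub>G\<^esub> k \<otimes>\<^bsub>G\<^esub> h) \<partial>\<mu>)))"

definition positive_definite :: "('g, 'm) monoid_scheme \<Rightarrow> ('g \<Rightarrow> complex) \<Rightarrow> bool" where
  "positive_definite G \<phi> \<longleftrightarrow>
     (\<forall>(n::nat) (g :: nat \<Rightarrow> 'g) (c :: nat \<Rightarrow> complex). (\<forall>i<n. g i \<in> carrier G) \<longrightarrow>
        (\<Sum>i<n. \<Sum>j<n. c i * cnj (c j) * \<phi> (inv\<^bsub>G\<^esub> (g j) \<otimes>\<^bsub>G\<^esub> g i)) \<in> \<real>\<^sub>\<ge>\<^sub>0)"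


section \<open>The pairs \<open>(G\<^sub>p, K\<^sub>p)\<close> and the functions \<open>\<psi>\<^sub>b\<close>\<close>

definition Gp :: "nat \<Rightarrow> nat \<Rightarrow> ('f::star_scalar nmat \<times> 'f nmat) monoid" where
  "Gp p q = \<lparr>carrier = Mat p q \<times> Umat p,
     monoid.mult = (\<lambda>(x, u) (y, v). (madd x (mmul p u y), mmul p u v)),
     one = (mzero, mone p)\<rparr>"

definition Kp :: "nat \<Rightarrow> ('f::star_scalar nmat \<times> 'f nmat) set" where
  "Kp p = {mzero} \<times> Umat p"

text \<open>
  The function on \<open>Gp p q\<close> that corresponds to \<open>f\<close> on \<open>PSD q\<close> under the identification of double
  cosets with \<open>PSD q\<close>.
\<close>

definition lift_PSD :: "nat \<Rightarrow> nat \<Rightarrow> ('f::star_scalar nmat \<Rightarrow> complex) \<Rightarrow> 'f nmat \<times> 'f nmat \<Rightarrow> complex" where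
  "lift_PSD p q f = (\<lambda>(x, k). f (psd_sqrt q (mmul p (adj x) x)))"

definition spherical_fun :: "nat \<Rightarrow> nat \<Rightarrow> ('f::star_scalar nmat \<Rightarrow> complex) \<Rightarrow> bool" where
  "spherical_fun p q f \<longleftrightarrow> spherical (Gp p q) (Kp p) (lift_PSD p q f)"

definition pos_def_fun :: "nat \<Rightarrow> nat \<Rightarrow> ('f::star_scalar nmat \<Rightarrow> complex) \<Rightarrow> bool" where
  "pos_def_fun p q f \<longleftrightarrow> positive_definite (Gp p q) (lift_PSD p q f)"

definition \<psi> :: "nat \<Rightarrow> 'f::star_scalar nmat \<times> 'f nmat \<Rightarrow> 'f nmat \<Rightarrow> complex" where
  "\<psi> q b a = exp (- hermC_inner q (to_HermC (mmul q a a)) b)"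

definition locally_uniform_limit ::
    "'a::topological_space set \<Rightarrow> ('i \<Rightarrow> 'a \<Rightarrow> 'b::metric_space) \<Rightarrow> ('a \<Rightarrow> 'b) \<Rightarrow> 'i filter \<Rightarrow> bool" where
  "locally_uniform_limit S f l F \<longleftrightarrow>
     (\<forall>a\<in>S. \<exists>V. open V \<and> a \<in> V \<and> uniform_limit (S \<inter> V) f l F)"


section \<open>\<open>Gp p q\<close> is a group\<close>

lemma mmul_assoc: "mmul m (mmul n x y) z = mmul n x (mmul m y z)"
  for x y z :: "'f::semiring_0 nmat"
  unfolding mmul_def
  by (intro ext) (simp add: sum_distrib_left sum_distrib_right mult.assoc, rule sum.swap)

lemma mmul_mone_left: "x \<in> Mat p q \<Longrightarrow> mmul p (mone p) x = x" for x :: "'f::star_scalar nmat"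
proof (intro ext)
  fix i j assume "x \<in> Mat p q"
  then show "mmul p (mone p) x i j = x i j"
    by (cases "i < p") (auto simp: mmul_def mone_def Mat_def if_distrib[of "\<lambda>z. z * _"] cong: if_cong)
qed

lemma mmul_mone_right: "x \<in> Mat p q \<Longrightarrow> mmul q x (mone q) = x" for x :: "'f::star_scalar nmat"
proof (intro ext)
  fix i j assume "x \<in> Mat p q"
  then show "mmul q x (mone q) i j = x i j"
    by (cases "j < q") (auto simp: mmul_def mone_def Mat_def if_distrib[of "\<lambda>z. _ * z"] cong: if_cong)
qed

lemma adj_adj [simp]: "adj (adj x) = x"
  by (simp add: adj_def)

lemma adj_mmul: "adj (mmul n x y) = mmul n (adj y) (adj x)"
  by (simp add: adj_def mmul_def star_sum star_mult)

lemma mmul_Mat: "x \<in> Mat p n \<Longrightarrow> y \<in> Mat n q \<Longrightarrow> mmul n x y \<in> Mat p q"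
  for x y :: "'f::star_scalar nmat"
  by (auto simp: Mat_def mmul_def)

lemma adj_Mat: "x \<in> Mat p q \<Longrightarrow> adj x \<in> Mat q p"
  by (auto simp: Mat_def adj_def)

lemma mone_U: "mone p \<in> Umat p"
proof -
  have "mone p \<in> (Mat p p :: 'a nmat set)" "adj (mone p :: 'a nmat) = mone p"
    by (auto simp: Mat_def mone_def adj_def fun_eq_iff)
  then show ?thesis by (simp add: Umat_def mmul_mone_left)
qed

lemma adj_U: "u \<in> Umat p \<Longrightarrow> adj u \<in> Umat p"
  by (auto simp: Umat_def adj_Mat)

lemma mmul_U: assumes "u \<in> Umat p" "v \<in> Umat p" shows "mmul p u v \<in> Umat p"
proof -
  have *: "mmul p (mmul p a b) (mmul p (adj b) (adj a)) = mone p" if "a \<in> Umat p" "b \<in> Umat p" for a b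
  proof -
    have "mmul p (mmul p a b) (mmul p (adj b) (adj a)) = mmul p a (mmul p (mmul p b (adj b)) (adj a))"
      by (simp add: mmul_assoc)
    also have "\<dots> = mone p"
      using that mmul_mone_left[OF adj_Mat, of a p p] by (simp add: Umat_def)
    finally show ?thesis .
  qed
  show ?thesis
    using *[OF assms] *[OF adj_U[OF assms(2)] adj_U[OF assms(1)]] assms
    by (auto simp: Umat_def adj_mmul mmul_Mat)
qed

lemma group_Gp: "group (Gp p q)"
proof (rule groupI)
  fix g h k :: "'a nmat \<times> 'a nmat"
  assume g: "g \<in> carrier (Gp p q)" and h: "h \<in> carrier (Gp p q)" and k: "k \<in> carrier (Gp p q)"
  show "g \<otimes>\<^bsub>Gp p q\<^esub> h \<in> carrier (Gp p q)"
    using g h mmul_Mat[of "snd g" p p "fst h" q]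
    by (auto simp: Gp_def mmul_U) (auto simp: Mat_def madd_def Umat_def)
  have "mmul p u (madd x y) = madd (mmul p u x) (mmul p u y)" for u x y :: "'a nmat"
    by (simp add: mmul_def madd_def distrib_left sum.distrib)
  then show "(g \<otimes>\<^bsub>Gp p q\<^esub> h) \<otimes>\<^bsub>Gp p q\<^esub> k = g \<otimes>\<^bsub>Gp p q\<^esub> (h \<otimes>\<^bsub>Gp p q\<^esub> k)"
    by (auto simp: Gp_def mmul_assoc madd_def add.assoc split: prod.splits)
next
  fix g :: "'a nmat \<times> 'a nmat" assume g: "g \<in> carrier (Gp p q)"
  obtain x u where [simp]: "g = (x, u)" by (cases g)
  have xu: "x \<in> Mat p q" "u \<in> Umat p" using g by (auto simp: Gp_def)
  show "\<one>\<^bsub>Gp p q\<^esub> \<otimes>\<^bsub>Gp p q\<^esub> g = g"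
    using xu by (auto simp: Gp_def mmul_mone_left Umat_def) (simp add: madd_def mzero_def)
  let ?h = "(\<lambda>i j. - mmul p (adj u) x i j, adj u)"
  have "mmul p (adj u) x \<in> Mat p q"
    using xu by (intro mmul_Mat adj_Mat) (auto simp: Umat_def)
  then have "?h \<in> carrier (Gp p q)"
    using adj_U[OF xu(2)] by (auto simp: Gp_def) (auto simp: Mat_def)
  moreover have "?h \<otimes>\<^bsub>Gp p q\<^esub> g = \<one>\<^bsub>Gp p q\<^esub>"
    using xu by (auto simp: Gp_def Umat_def madd_def mzero_def)
  ultimately show "\<exists>h\<in>carrier (Gp p q). h \<otimes>\<^bsub>Gp p q\<^esub> g = \<one>\<^bsub>Gp p q\<^esub>" by blast
next
  show "\<one>\<^bsub>Gp p q\<^esub> \<in> carrier (Gp p q)"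
    by (auto simp: Gp_def mone_U) (simp add: Mat_def mzero_def)
qed

end

theory Submission
  imports Defs
begin

text \<open>
  A real-linear functional \<open>\<Lambda>\<close> on the matrices, with complex values, gives a spherical function
  \<open>x \<mapsto> \<integral> exp (\<Lambda> (k\<^sup>* x)) dk\<close> of \<open>(G\<^sub>p, K\<^sub>p)\<close>, which is positive definite if \<open>\<Lambda>\<close> is purely
  imaginary. If \<open>\<Lambda>\<close> depends only on a fixed number of rows and is scaled by \<open>\<surd>p\<close>, then the entries of \<open>k\<close>
  it sees become Gaussian, so the limit is the exponential of a quadratic form in \<open>x\<close>.
  Quantitatively, invariance of the Haar measure under rotations in the plane of a row \<open>l < q\<close> and a
  row \<open>j \<ge> q\<close> gives a differential equation for \<open>s \<mapsto> \<integral> exp (s \<Lambda> (k\<^sup>* x)) dk\<close>, which is the one of a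
  Gaussian up to a remainder of relative size \<open>1 / p\<close>. For imaginary \<open>\<Lambda>\<close> this bound is uniform in \<open>x\<close>.

  The Haar measure is obtained by orthonormalizing the columns of a random matrix that is uniformly
  distributed in a Euclidean ball. Polar decomposition, which identifies the double cosets, comes from
  maximizing the real trace of \<open>u x\<close> over unitary \<open>u\<close>; this avoids spectral theory over the quaternions.
\<close>

section \<open>Algebra of the scalars\<close>

text \<open>The differential equation closes by orthonormality. Rotating rows \<open>l\<close> and
  \<open>j\<close> with a unit scalar produces the square of a functional of row \<open>j\<close>,
  and these squares, summed over \<open>l < q\<close>, all \<open>j < p\<close> and a real basis of
  the scalars, give a constant. Rows \<open>j < q\<close> are seen by \<Lambda> itself, so their
  share is left over as the remainder. Bounding it takes second moments of single entries under the
  weight |exp \<Lambda>|. The imaginary part of \<Lambda> enters the bound on the remainder only as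
  a factor, not in an exponent, and integrating the equation absorbs this factor.

  The three scalar fields are treated at once, so commutativity and determinants are avoided. Real
  inner products and Re(xy) = Re(yx) take their place, and that unitary matrices preserve Lebesgue
  measure is derived from uniqueness of translation invariant measures, with an invariant ball
  fixing the constant. Haar measure is only known to be left invariant; invariance under inversion
  follows from Fubini.\<close>

lemma re_part_eq_inner: "re_part x = (1::'f::star_scalar) \<bullet> x"
  by (simp add: inner_star)

lemma star_eq: "star x = (2 * re_part x) *\<^sub>R 1 - (x::'f::star_scalar)"
  using add_star[of x] by (simp add: eq_diff_eq add.commute)

lemma re_part_add: "re_part (x + y) = re_part x + re_part (y::'f::star_scalar)"
  and re_part_scaleR: "re_part (r *\<^sub>R x) = r * re_part x"
  and re_part_zero [simp]: "re_part (0::'f) = 0"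
  and re_part_diff: "re_part (x - y) = re_part x - re_part y"
  by (simp_all add: re_part_eq_inner inner_add_right inner_diff_right)

lemma re_part_one [simp]: "re_part (1::'f::star_scalar) = 1"
  by (simp add: re_part_eq_inner dot_square_norm)

lemma re_part_sum: "re_part (sum f A) = (\<Sum>x\<in>A. re_part (f x :: 'f::star_scalar))"
  by (simp add: re_part_eq_inner inner_sum_right)

lemma re_part_star [simp]: "re_part (star x) = re_part (x::'f::star_scalar)"
  by (simp add: star_eq re_part_diff re_part_scaleR)

lemma star_minus: "star (- x) = - star (x::'f::star_scalar)"
  using star_scaleR[of "-1" x] by simp

lemma star_diff: "star (x - y) = star x - star (y::'f::star_scalar)"
  using star_add[of x "- y"] by (simp add: star_minus)

lemma star_of_real: "star (of_real r) = (of_real r :: 'f::star_scalar)"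
  by (simp add: of_real_def star_scaleR)

lemma inner_star_star [simp]: "star x \<bullet> star y = x \<bullet> (y::'f::star_scalar)"
  unfolding star_eq inner_diff_left inner_diff_right inner_scaleR_left inner_scaleR_right re_part_eq_inner
  by (simp add: dot_square_norm inner_commute)

lemma norm_star [simp]: "norm (star x) = norm (x::'f::star_scalar)"
  by (simp add: norm_eq_sqrt_inner)

text \<open>Stands in for commutativity over the quaternions: conjugation is an isometry, so both
  sides are the same real inner product.\<close>

lemma re_part_comm: "re_part (x * y) = re_part (y * (x::'f::star_scalar))"
proof -
  have "re_part (x * y) = star x \<bullet> y" by (simp add: inner_star)
  also have "\<dots> = star (star x) \<bullet> star y" by (rule inner_star_star[symmetric])
  also have "\<dots> = star y \<bullet> x" by (simp add: inner_commute)
  also have "\<dots> = re_part (y * x)" by (simp add: inner_star)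
  finally show ?thesis .
qed

text \<open>Makes the diagonal entries of Hermitian matrices real, hence central, also over the
  quaternions.\<close>

lemma self_star_iff: "star x = x \<longleftrightarrow> x = of_real (re_part (x::'f::star_scalar))"
proof
  assume "star x = x"
  then have "(1/2) *\<^sub>R (x + x) = (1/2) *\<^sub>R ((2 * re_part x) *\<^sub>R 1)"
    using add_star[of x] by simp
  then show "x = of_real (re_part x)" unfolding scaleR_half_double by (simp add: of_real_def)
qed (metis star_of_real)

lemma star_mult_self: "star x * x = of_real ((norm (x::'f::star_scalar))\<^sup>2)"
proof -
  have "star (star x * x) = star x * x" by (simp add: star_mult)
  then show ?thesis
    by (subst (asm) self_star_iff) (simp add: inner_star[symmetric] dot_square_norm)
qed

lemma mult_star_self: "x * star x = of_real ((norm (x::'f::star_scalar))\<^sup>2)"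
  using star_mult_self[of "star x"] by simp

lemma inner_mult_left_star: "(b * x) \<bullet> y = x \<bullet> (star b * (y::'f::star_scalar))"
  by (simp add: inner_star star_mult mult.assoc)

lemma inner_mult_right_star: "(x * b) \<bullet> y = x \<bullet> (y * star (b::'f::star_scalar))"
  by (simp add: inner_star star_mult mult.assoc re_part_comm[of "star b"])

text \<open>Test with \<open>b = star x / norm x\<close>. First-order conditions at a maximum arrive
  in this form, one for each unit scalar \<open>b\<close>.\<close>

lemma eq_zero_if_re_part_mult:
  assumes "\<And>b::'f::star_scalar. norm b = 1 \<Longrightarrow> re_part (b * x) \<le> 0" shows "x = 0"
proof (rule ccontr)
  assume "x \<noteq> 0"
  then have "re_part ((star x /\<^sub>R norm x) * x) = norm x"
    by (simp add: star_mult_self re_part_scaleR power2_eq_square)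
       (simp add: of_real_def re_part_scaleR)
  with \<open>x \<noteq> 0\<close> show False using assms[of "star x /\<^sub>R norm x"] by simp
qed

section \<open>Matrix algebra\<close>

text \<open>This is Re tr(x^* y) for n by m matrices, written entrywise.\<close>

definition frob :: "nat \<Rightarrow> nat \<Rightarrow> 'f::star_scalar nmat \<Rightarrow> 'f nmat \<Rightarrow> real" where
  "frob n m x y = (\<Sum>l<n. \<Sum>i<m. x l i \<bullet> y l i)"

lemma frob_adj: "frob n m (adj x) (adj y) = frob m n x y"
  unfolding frob_def adj_def by simp (rule sum.swap)

lemma frob_commute: "frob n m x y = frob n m y x"
  by (simp add: frob_def inner_commute)

lemma frob_mmul_left: "frob n m (mmul k u x) y = frob k m x (mmul n (adj u) y)"
proof -
  have "frob n m (mmul k u x) y = (\<Sum>l<n. \<Sum>i<m. \<Sum>j<k. (u l j * x j i) \<bullet> y l i)"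
    by (simp add: frob_def mmul_def inner_sum_left)
  also have "\<dots> = (\<Sum>l<n. \<Sum>i<m. \<Sum>j<k. x j i \<bullet> (star (u l j) * y l i))"
    by (simp add: inner_mult_left_star)
  also have "\<dots> = (\<Sum>j<k. \<Sum>i<m. \<Sum>l<n. x j i \<bullet> (star (u l j) * y l i))"
    by (subst sum.swap[of _ "{..<k}" "{..<m}"], subst (2) sum.swap, subst sum.swap, subst (2) sum.swap) (rule sum.swap)
  also have "\<dots> = frob k m x (mmul n (adj u) y)"
    by (simp add: frob_def mmul_def inner_sum_right adj_def)
  finally show ?thesis .
qed

lemma frob_mmul_right: "frob n m (mmul k x u) y = frob n k x (mmul m y (adj u))"
proof -
  have "frob n m (mmul k x u) y = frob m n (mmul k (adj u) (adj x)) (adj y)"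
    by (metis frob_adj adj_mmul)
  also have "\<dots> = frob k n (adj x) (mmul m u (adj y))"
    by (simp add: frob_mmul_left)
  also have "\<dots> = frob n k x (mmul m y (adj u))"
    by (metis frob_adj adj_mmul adj_adj)
  finally show ?thesis .
qed

lemma herm_inner_eq_frob: "herm_inner q x y = frob q q (adj x) y"
  unfolding herm_inner_def frob_def mmul_def adj_def
  by (simp add: re_part_sum inner_star) (rule sum.swap)

lemma frob_self: "frob n m x x = (\<Sum>l<n. \<Sum>i<m. (norm (x l i))\<^sup>2)"
  by (simp add: frob_def dot_square_norm)

lemma frob_self_nonneg: "0 \<le> frob n m x x"
  unfolding frob_self by (intro sum_nonneg) auto

lemma frob_self_eq_0D:
  assumes "frob n m x x = 0" "x \<in> Mat n m" shows "x = mzero"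
proof (intro ext)
  fix l i
  have "\<forall>l<n. \<forall>i<m. (norm (x l i))\<^sup>2 = 0"
    using assms(1) unfolding frob_self by (simp add: sum_nonneg_eq_0_iff sum_nonneg)
  then show "x l i = mzero l i" using assms(2) by (cases "l < n \<and> i < m") (auto simp: Mat_def mzero_def)
qed

lemma frob_add_left: "frob n m (\<lambda>i j. x i j + y i j) z = frob n m x z + frob n m y z"
  by (simp add: frob_def inner_add_left sum.distrib)

lemma frob_diff_left: "frob n m (\<lambda>i j. x i j - y i j) z = frob n m x z - frob n m y z"
  by (simp add: frob_def inner_diff_left sum_subtractf)

lemma frob_scaleR_left: "frob n m (\<lambda>i j. r *\<^sub>R x i j) z = r * frob n m x z"
  by (simp add: frob_def sum_distrib_left)

lemma frob_add_right: "frob n m z (\<lambda>i j. x i j + y i j) = frob n m z x + frob n m z y"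
  by (simp add: frob_def inner_add_right sum.distrib)

lemma frob_diff_right: "frob n m z (\<lambda>i j. x i j - y i j) = frob n m z x - frob n m z y"
  by (simp add: frob_def inner_diff_right sum_subtractf)

lemma frob_scaleR_right: "frob n m z (\<lambda>i j. r *\<^sub>R x i j) = r * frob n m z x"
  by (simp add: frob_def sum_distrib_left)

lemma mmul_diff_left: "mmul n (\<lambda>i j. x i j - y i j) z = (\<lambda>i j. mmul n x z i j - mmul n y z i j)"
  for x y z :: "'f::ring nmat"
  by (simp add: mmul_def left_diff_distrib sum_subtractf)

lemma mmul_diff_right: "mmul n z (\<lambda>i j. x i j - y i j) = (\<lambda>i j. mmul n z x i j - mmul n z y i j)"
  for x y z :: "'f::ring nmat"
  by (simp add: mmul_def right_diff_distrib sum_subtractf)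

lemma mmul_add_left: "mmul n (\<lambda>i j. x i j + y i j) z = (\<lambda>i j. mmul n x z i j + mmul n y z i j)"
  for x y z :: "'f::semiring_0 nmat"
  by (simp add: mmul_def distrib_right sum.distrib)

lemma mmul_add_right: "mmul n z (\<lambda>i j. x i j + y i j) = (\<lambda>i j. mmul n z x i j + mmul n z y i j)"
  for x y z :: "'f::semiring_0 nmat"
  by (simp add: mmul_def distrib_left sum.distrib)

text \<open>The Hermitian idempotent \<open>1 - k k\<^sup>*\<close> has squared norm equal to its trace, which is \<open>0\<close>.\<close>

lemma left_inverse_adj_imp_Umat:
  assumes k: "k \<in> Mat p p" and kk: "mmul p (adj k) k = mone p"
  shows "k \<in> Umat p"
proof -
  define P where "P = mmul p k (adj k)"
  define Q where "Q = (\<lambda>i j. mone p i j - P i j)"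
  have one: "(mone p :: 'a nmat) \<in> Mat p p" "adj (mone p) = (mone p :: 'a nmat)"
    by (auto simp: Mat_def mone_def adj_def fun_eq_iff)
  have P: "P \<in> Mat p p" "adj P = P"
    using k adj_Mat[OF k] by (auto simp: P_def mmul_Mat adj_mmul)
  have Q: "Q \<in> Mat p p" "adj Q = Q"
    using P one by (auto simp: Q_def Mat_def adj_def star_diff fun_eq_iff)
  have "mmul p P P = mmul p k (mmul p (mmul p (adj k) k) (adj k))"
    by (simp add: P_def mmul_assoc)
  also have "\<dots> = P" by (simp add: kk P_def mmul_mone_left[OF adj_Mat[OF k]])
  finally have PP: "mmul p P P = P" .
  have "mmul p Q Q = Q"
    unfolding Q_def mmul_diff_left mmul_diff_right
    by (simp add: PP mmul_mone_left[OF P(1)] mmul_mone_right[OF P(1)] mmul_mone_left[OF one(1)])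
  then have "frob p p Q Q = frob p p Q (mone p)"
    using frob_mmul_left[of p p p Q "mone p" Q] Q by (simp add: mmul_mone_right[OF Q(1)] frob_commute)
  also have "\<dots> = frob p p (mone p) (mone p :: 'a nmat) - frob p p (mmul p k (adj k)) (mone p)"
    by (simp add: Q_def frob_diff_left P_def)
  also have "frob p p (mmul p k (adj k)) (mone p) = frob p p (mmul p (adj k) k) (mone p)"
    using frob_mmul_left[of p p p k "adj k" "mone p"] frob_mmul_right[of p p p "adj k" "k" "mone p"]
    by (simp add: mmul_mone_left[OF adj_Mat[OF k]] mmul_mone_right[OF adj_Mat[OF k]])
  finally have "frob p p Q Q = 0" by (simp add: kk)
  then have "Q = mzero" using Q(1) by (rule frob_self_eq_0D)
  then have "mone p i j - P i j = 0" for i j unfolding Q_def mzero_def by meson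
  then have "P = mone p" by (intro ext) simp
  then show ?thesis using k kk by (simp add: Umat_def P_def)
qed

section \<open>Positive semidefinite matrices\<close>

text \<open>Taking the real part gives a real bilinear form over all three scalar fields, so the
  usual arguments for real quadratic forms apply.\<close>

definition form :: "nat \<Rightarrow> 'f::star_scalar nmat \<Rightarrow> (nat \<Rightarrow> 'f) \<Rightarrow> (nat \<Rightarrow> 'f) \<Rightarrow> real" where
  "form q a v w = re_part (\<Sum>i<q. \<Sum>j<q. star (v i) * a i j * w j)"

lemma PSD_iff_form: "a \<in> PSD q \<longleftrightarrow> a \<in> Herm q \<and> (\<forall>v. 0 \<le> form q a v v)"
  by (simp add: PSD_def form_def)

lemma Herm_iff: "a \<in> Herm q \<longleftrightarrow> a \<in> Mat q q \<and> (\<forall>i j. star (a i j) = a j i)"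
  by (auto simp: Herm_def adj_def fun_eq_iff)

lemma form_add_left: "form q a (\<lambda>i. u i + v i) w = form q a u w + form q a v w"
  and form_add_right: "form q a w (\<lambda>i. u i + v i) = form q a w u + form q a w v"
  by (simp_all add: form_def star_add algebra_simps sum.distrib re_part_add)

lemma form_scaleR_left: "form q a (\<lambda>i. r *\<^sub>R v i) w = r * form q a v w"
  and form_scaleR_right: "form q a w (\<lambda>i. r *\<^sub>R v i) = r * form q a w v"
  by (simp_all add: form_def star_scaleR scaleR_sum_right[symmetric] re_part_scaleR)

lemma form_commute:
  assumes "a \<in> Herm q" shows "form q a v w = form q a w v"
proof -
  have "form q a v w = re_part (star (\<Sum>i<q. \<Sum>j<q. star (v i) * a i j * w j))"
    by (simp add: form_def)
  also have "\<dots> = re_part (\<Sum>i<q. \<Sum>j<q. star (w j) * (a j i * v i))"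
    using assms by (simp add: star_sum star_mult Herm_iff)
  also have "\<dots> = form q a w v"
    unfolding form_def by (subst sum.swap) (simp add: mult.assoc)
  finally show ?thesis .
qed

lemma form_eq_inner: "form q a v w = (\<Sum>i<q. v i \<bullet> (\<Sum>j<q. a i j * w j))"
  by (simp add: form_def re_part_sum inner_star sum_distrib_left mult.assoc)

lemma quadratic_nonneg_imp_linear_0:
  fixes B C :: real
  assumes "\<And>t. 0 \<le> 2 * t * B + t\<^sup>2 * C" shows "B = 0"
proof (rule ccontr)
  assume B: "B \<noteq> 0"
  \<comment> \<open>Has the sign opposite to \<open>B\<close>; the denominator dominates
    \<open>C\<close> whatever its sign and is never zero.\<close>
  define t where "t = - B / (\<bar>C\<bar> + 1)"
  have "2 * t * B + t\<^sup>2 * C \<le> 2 * t * B + t\<^sup>2 * (\<bar>C\<bar> + 1)"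
    by (intro add_left_mono mult_left_mono) auto
  also have "\<dots> = - B\<^sup>2 / (\<bar>C\<bar> + 1)"
    by (simp add: t_def power2_eq_square divide_simps add_nonneg_eq_0_iff)
  also have "\<dots> < 0" using B by (simp add: add_nonneg_pos)
  finally show False using assms[of t] by simp
qed

text \<open>A vector on which a semidefinite form vanishes lies in its radical: perturbing
  \<open>v\<close> by \<open>t w\<close> leaves a nonnegative quadratic in \<open>t\<close> without
  constant term, so the linear term is zero.\<close>

lemma PSD_null:
  assumes a: "a \<in> PSD q" and v: "form q a v v = 0" and i: "i < q"
  shows "(\<Sum>j<q. a i j * v j) = 0"
proof -
  have "form q a w v = 0" for w
  proof (rule quadratic_nonneg_imp_linear_0)
    fix t
    have "0 \<le> form q a (\<lambda>i. v i + t *\<^sub>R w i) (\<lambda>i. v i + t *\<^sub>R w i)"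
      using a by (simp add: PSD_iff_form)
    also have "\<dots> = 2 * t * form q a w v + t\<^sup>2 * form q a w w"
      using a form_commute[of a q v w] v
      by (simp add: PSD_iff_form form_add_left form_add_right form_scaleR_left form_scaleR_right power2_eq_square)
    finally show "0 \<le> 2 * t * form q a w v + t\<^sup>2 * form q a w w" .
  qed
  \<comment> \<open>Only coordinate \<open>i\<close> of this \<open>w\<close> is nonzero, and it
    equals component \<open>i\<close> of \<open>a v\<close>, so the form is the squared norm of that
    component.\<close>
  from this[of "\<lambda>k. if k = i then \<Sum>j<q. a i j * v j else 0"] show ?thesis
    using i by (simp add: form_eq_inner if_distrib[of "\<lambda>z. z \<bullet> _"] cong: if_cong)
qed

lemma frob_mmul_eq_form: "frob q q x (mmul q a x) = (\<Sum>c<q. form q a (\<lambda>i. x i c) (\<lambda>i. x i c))"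
  unfolding form_eq_inner frob_def mmul_def by (rule sum.swap)

text \<open>With \<open>d = a - b\<close>, equality of squares gives
  \<open>d (a + b) + (a + b) d = 0\<close>. Pairing with \<open>d\<close> yields tr(d a d) + tr(d b
  d) = 0 with both terms nonnegative, so \<open>a d = b d = 0\<close> and hence
  \<open>d d = 0\<close>. No diagonalization is involved.\<close>

lemma PSD_sqrt_unique:
  assumes a: "a \<in> PSD q" and b: "b \<in> PSD q" and eq: "mmul q a a = mmul q b b"
  shows "a = (b :: 'f::star_scalar nmat)"
proof -
  define d where "d = (\<lambda>i j. a i j - b i j)"
  have Mat: "a \<in> Mat q q" "b \<in> Mat q q" and adj: "adj a = a" "adj b = b"
    using a b by (auto simp: PSD_def Herm_def)
  have d: "d \<in> Mat q q" "adj d = d"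
    using Mat adj by (auto simp: d_def Mat_def adj_def star_diff fun_eq_iff)
  have zero: "(\<lambda>i j. mmul q d (\<lambda>i j. a i j + b i j) i j + mmul q (\<lambda>i j. a i j + b i j) d i j) = (\<lambda>i j. 0)"
    unfolding d_def mmul_diff_left mmul_diff_right mmul_add_left mmul_add_right eq by (intro ext) simp
  have "frob q q d (mmul q d (\<lambda>i j. a i j + b i j)) = frob q q d (mmul q (\<lambda>i j. a i j + b i j) d)"
  proof -
    have "adj (\<lambda>i j. a i j + b i j) = (\<lambda>i j. a i j + b i j)"
      using adj by (simp add: adj_def star_add fun_eq_iff)
    then show ?thesis
      using frob_adj[of q q d "mmul q d (\<lambda>i j. a i j + b i j)"] d by (simp add: adj_mmul)
  qed
  moreover have "frob q q d (mmul q d (\<lambda>i j. a i j + b i j)) + frob q q d (mmul q (\<lambda>i j. a i j + b i j) d) = 0"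
    by (subst frob_add_right[symmetric], subst zero) (simp add: frob_def)
  ultimately have "frob q q d (mmul q a d) + frob q q d (mmul q b d) = 0"
    by (simp add: mmul_add_left frob_add_right)
  moreover have nn: "0 \<le> form q a v v" "0 \<le> form q b v v" for v
    using a b by (auto simp: PSD_iff_form)
  ultimately have "(\<Sum>c<q. form q a (\<lambda>i. d i c) (\<lambda>i. d i c)) = 0" "(\<Sum>c<q. form q b (\<lambda>i. d i c) (\<lambda>i. d i c)) = 0"
    using sum_nonneg[of "{..<q}" "\<lambda>c. form q a (\<lambda>i. d i c) (\<lambda>i. d i c)"]
      sum_nonneg[of "{..<q}" "\<lambda>c. form q b (\<lambda>i. d i c) (\<lambda>i. d i c)"]
    unfolding frob_mmul_eq_form by (simp_all add: add_nonneg_eq_0_iff)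
  then have "form q a (\<lambda>i. d i c) (\<lambda>i. d i c) = 0" "form q b (\<lambda>i. d i c) (\<lambda>i. d i c) = 0" if "c < q" for c
    using nn that by (simp_all add: sum_nonneg_eq_0_iff)
  then have "mmul q a d i c = 0" "mmul q b d i c = 0" if "i < q" "c < q" for i c
    using that PSD_null[OF a] PSD_null[OF b] unfolding mmul_def by blast+
  then have "mmul q d d i c = 0" if "i < q" "c < q" for i c
    using that by (subst d_def) (simp add: mmul_diff_left)
  \<comment> \<open>The trace of \<open>d d\<close> is the squared norm of \<open>d\<close>, because
    \<open>d\<close> is Hermitian.\<close>
  then have "frob q q (mmul q d d) (mone q) = 0"
    by (simp add: frob_def)
  then have "frob q q d d = 0"
    using frob_mmul_left[of q q q d d "mone q"] mmul_mone_right[OF d(1)] d(2) by simp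
  then have "d = mzero" using d(1) by (rule frob_self_eq_0D)
  then have "a i j - b i j = 0" for i j unfolding d_def mzero_def by meson
  then show ?thesis by (intro ext) simp
qed

lemma psd_sqrt_eq: "a \<in> PSD q \<Longrightarrow> mmul q a a = x \<Longrightarrow> psd_sqrt q x = a"
  unfolding psd_sqrt_def by (rule the_equality) (auto intro: PSD_sqrt_unique)

section \<open>Rotations and reflections\<close>

text \<open>For a unit scalar \<open>b\<close>, the derivative at \<open>t = 0\<close> sends row
  \<open>j\<close> times \<open>b\<close> into row \<open>i\<close>, and row \<open>i\<close> times
  \<open>- star b\<close> into row \<open>j\<close>. Varying \<open>b\<close> yields every scalar
  direction.\<close>

definition rot :: "nat \<Rightarrow> nat \<Rightarrow> nat \<Rightarrow> 'f::star_scalar \<Rightarrow> real \<Rightarrow> 'f nmat" where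
  "rot p i j b t = (\<lambda>k l.
     if k = i \<and> l = i \<or> k = j \<and> l = j then of_real (cos t)
     else if k = i \<and> l = j then sin t *\<^sub>R b
     else if k = j \<and> l = i then - (sin t *\<^sub>R star b)
     else mone p k l)"

lemma mmul_rot:
  assumes "i < p" "j < p" "i \<noteq> j"
  shows "mmul p (rot p i j b t) x k l =
    (if k = i then cos t *\<^sub>R x i l + sin t *\<^sub>R (b * x j l)
     else if k = j then cos t *\<^sub>R x j l - sin t *\<^sub>R (star b * x i l)
     else if k < p then x k l else 0)"
proof -
  have "mmul p (rot p i j b t) x k l = (\<Sum>m<p. (if m = i then rot p i j b t k i * x i l else 0)
      + (if m = j then rot p i j b t k j * x j l else 0)
      + (if m = k then (if k = i \<or> k = j \<or> \<not> k < p then 0 else x k l) else 0))"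
    unfolding mmul_def using assms by (intro sum.cong refl) (auto simp: rot_def mone_def)
  also have "\<dots> = rot p i j b t k i * x i l + rot p i j b t k j * x j l
      + (if k = i \<or> k = j \<or> \<not> k < p then 0 else x k l)"
    using assms by (simp add: sum.distrib)
  finally show ?thesis using assms by (auto simp: rot_def mone_def scaleR_conv_of_real mult.assoc)
qed

lemma rot_Umat:
  assumes ij: "i < p" "j < p" "i \<noteq> j" and b: "norm (b :: 'f::star_scalar) = 1"
  shows "rot p i j b t \<in> Umat p"
proof (rule left_inverse_adj_imp_Umat)
  show M: "rot p i j b t \<in> Mat p p" using ij by (auto simp: Mat_def rot_def mone_def)
  have "adj (rot p i j b t) = rot p i j b (- t)"
  proof (intro ext)
    fix k l show "adj (rot p i j b t) k l = rot p i j b (- t) k l"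
      using ij by (cases "k = i"; cases "l = i"; cases "k = j"; cases "l = j")
        (simp_all add: adj_def rot_def mone_def star_of_real star_scaleR star_minus)
  qed
  moreover have "mmul p (rot p i j b (-t)) (mmul p (rot p i j b t) (mone p)) = mone p"
  proof (intro ext)
    fix k l
    have *: "b * (star b * y) = y" "star b * (b * y) = y" for y
      using mult_star_self[of b] star_mult_self[of b] b by (simp_all add: mult.assoc[symmetric])
    have cs: "(cos t * cos t) *\<^sub>R y + (sin t * sin t) *\<^sub>R y = y" for y :: 'f
      by (metis scaleR_add_left scaleR_one sin_cos_squared_add3)
    have "cos t *\<^sub>R (cos t *\<^sub>R y + sin t *\<^sub>R z) - sin t *\<^sub>R (cos t *\<^sub>R z - sin t *\<^sub>R y) = y"
      "cos t *\<^sub>R (cos t *\<^sub>R y - sin t *\<^sub>R z) + sin t *\<^sub>R (cos t *\<^sub>R z + sin t *\<^sub>R y) = y" for y z :: 'f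
      using cs[of y] by (simp_all add: scaleR_add_right scaleR_diff_right mult.commute[of "cos t" "sin t"])
    then show "mmul p (rot p i j b (-t)) (mmul p (rot p i j b t) (mone p)) k l = (mone p k l :: 'f)"
      using ij by (simp add: mmul_rot distrib_left right_diff_distrib *) (simp add: mone_def)
  qed
  ultimately show "mmul p (adj (rot p i j b t)) (rot p i j b t) = mone p"
    using mmul_mone_right[OF M] by simp
qed

text \<open>Householder reflection along a vector \<open>w\<close> that need not be normalized.
  Comparing a trace maximizer with its reflection tests the sign of the quadratic form at
  \<open>w\<close>.\<close>

definition reflection :: "nat \<Rightarrow> (nat \<Rightarrow> 'f::star_scalar) \<Rightarrow> 'f nmat" where
  "reflection p w = (\<lambda>k l. mone p k l - (2 / (\<Sum>i<p. (norm (w i))\<^sup>2)) *\<^sub>R (w k * star (w l)))"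

lemma mmul_reflection:
  assumes "x \<in> Mat p m"
  shows "mmul p (reflection p w) x k l =
    x k l - (2 / (\<Sum>i<p. (norm (w i))\<^sup>2)) *\<^sub>R (w k * (\<Sum>j<p. star (w j) * x j l))"
proof -
  define N where "N = (\<Sum>i<p. (norm (w i))\<^sup>2)"
  have "mmul p (reflection p w) x k l = (\<Sum>j<p. mone p k j * x j l - (2 / N) *\<^sub>R (w k * (star (w j) * x j l)))"
    by (simp add: reflection_def mmul_def left_diff_distrib mult.assoc N_def)
  also have "\<dots> = mmul p (mone p) x k l - (2 / N) *\<^sub>R (w k * (\<Sum>j<p. star (w j) * x j l))"
    by (simp add: sum_subtractf mmul_def scaleR_sum_right sum_distrib_left)
  finally show ?thesis by (simp add: N_def mmul_mone_left[OF assms])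
qed

lemma reflection_Umat:
  fixes w :: "nat \<Rightarrow> 'f::star_scalar"
  assumes w: "\<And>k. \<not> k < p \<Longrightarrow> w k = 0" and N: "(\<Sum>i<p. (norm (w i))\<^sup>2) \<noteq> 0"
  shows "reflection p w \<in> Umat p"
proof (rule left_inverse_adj_imp_Umat)
  define n where "n = (\<Sum>i<p. (norm (w i))\<^sup>2)"
  have M: "reflection p w \<in> Mat p p" using w by (auto simp: Mat_def reflection_def mone_def)
  then show "reflection p w \<in> Mat p p" .
  have "adj (reflection p w) = reflection p w"
    by (auto simp: adj_def reflection_def mone_def fun_eq_iff star_diff star_scaleR star_mult)
  moreover have "mmul p (reflection p w) (reflection p w) k l = mone p k l" for k l
  proof -
    have one: "mone p \<in> (Mat p p :: 'f nmat set)" by (auto simp: Mat_def mone_def)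
    define y where "y = (\<Sum>j<p. star (w j) * (mone p j l :: 'f))"
    have r: "reflection p w j l = mone p j l - (2 / n) *\<^sub>R (w j * y)" for j
      using mmul_reflection[OF one, of w j l] mmul_mone_right[OF M] by (simp add: y_def n_def)
    have "(\<Sum>j<p. star (w j) * reflection p w j l) = y - (2 / n) *\<^sub>R (\<Sum>j<p. star (w j) * w j) * y"
      unfolding r
      by (simp add: right_diff_distrib sum_subtractf y_def[symmetric] sum_distrib_right scaleR_sum_right mult.assoc)
    also have "(\<Sum>j<p. star (w j) * w j) = of_real n"
      by (simp add: star_mult_self n_def)
    also have "y - (2 / n) *\<^sub>R of_real n * y = - y"
    proof -
      have "(2 / n) *\<^sub>R of_real n = (of_real 2 :: 'f)"
        unfolding scaleR_conv_of_real of_real_mult[symmetric] using N by (simp add: n_def[symmetric] del: of_real_mult of_real_numeral of_real_divide)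
      then show ?thesis by (simp add: mult_2)
    qed
    finally show ?thesis
      by (simp add: mmul_reflection[OF M] n_def[symmetric] r[of k])
  qed
  ultimately show "mmul p (adj (reflection p w)) (reflection p w) = mone p" by (intro ext) simp
qed

definition phase :: "nat \<Rightarrow> nat \<Rightarrow> 'f::star_scalar \<Rightarrow> 'f nmat" where
  "phase p i b = (\<lambda>k l. if k = i \<and> l = i then b else mone p k l)"

lemma mmul_phase:
  assumes "i < p"
  shows "mmul p (phase p i b) x k l = (if k = i then b * x i l else if k < p then x k l else 0)"
proof -
  have "mmul p (phase p i b) x k l = (\<Sum>m<p. if m = k then (if k = i then b * x i l else x k l) else 0)"
    unfolding mmul_def using assms by (intro sum.cong refl) (auto simp: phase_def mone_def)
  then show ?thesis using assms by auto
qed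

lemma phase_Umat:
  assumes "i < p" and b: "norm (b :: 'f::star_scalar) = 1"
  shows "phase p i b \<in> Umat p"
proof (rule left_inverse_adj_imp_Umat)
  show M: "phase p i b \<in> Mat p p" using assms by (auto simp: Mat_def phase_def mone_def)
  have "adj (phase p i b) = phase p i (star b)"
    by (auto simp: adj_def phase_def mone_def fun_eq_iff)
  moreover have "mmul p (phase p i (star b)) (phase p i b) = mone p"
    using star_mult_self[of b] assms by (auto simp: fun_eq_iff mmul_phase) (auto simp: phase_def mone_def)
  ultimately show "mmul p (adj (phase p i b)) (phase p i b) = mone p" by simp
qed

section \<open>Polar decomposition\<close>

lemma continuous_on_star [continuous_intros]:
  "continuous_on S f \<Longrightarrow> continuous_on S (\<lambda>x. star (f x :: 'f::star_scalar))"
  unfolding star_eq re_part_eq_inner by (intro continuous_intros)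

lemma continuous_on_re_part [continuous_intros]:
  "continuous_on S f \<Longrightarrow> continuous_on S (\<lambda>x. re_part (f x :: 'f::star_scalar))"
  unfolding re_part_eq_inner by (intro continuous_intros)

lemma continuous_on_entry [continuous_intros]:
  "continuous_on S (\<lambda>x :: 'a::topological_space nmat. x i j)"
  by (rule continuous_on_product_then_coordinatewise[OF continuous_on_product_then_coordinatewise[OF continuous_on_id]])

lemma Umat_norm_col:
  assumes "k \<in> Umat p"
  shows "j < p \<Longrightarrow> (\<Sum>i<p. (norm (k i j))\<^sup>2) = 1"
proof -
  assume j: "j < p"
  have "mmul p (adj k) k j j = mone p j j" using assms by (simp add: Umat_def)
  then have "of_real (\<Sum>i<p. (norm (k i j))\<^sup>2) = (of_real 1 :: 'a)"
    using j by (simp add: mmul_def adj_def star_mult_self mone_def)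
  then show ?thesis by (simp only: of_real_eq_iff)
qed

lemma Umat_norm_entry:
  assumes "k \<in> Umat p" shows "norm (k i j) \<le> 1"
proof (cases "i < p \<and> j < p")
  case True
  have "(norm (k i j))\<^sup>2 \<le> (\<Sum>i<p. (norm (k i j))\<^sup>2)"
    using True by (intro member_le_sum) auto
  then show ?thesis using Umat_norm_col[OF assms] True power2_le_imp_le[of "norm (k i j)" 1] by simp
next
  case False
  then have "k i j = 0" using assms unfolding Umat_def Mat_def by blast
  then show ?thesis by simp
qed

lemma closed_Umat: "closed (Umat p :: 'f::star_scalar nmat set)"
proof -
  have *: "closed {k :: 'f nmat. F k = G k}" if "continuous_on UNIV F" "continuous_on UNIV G"
    for F G :: "'f nmat \<Rightarrow> 'f"
    using closed_Collect_eq[OF that] .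
  have eq: "Umat p = (\<Inter>i. \<Inter>j. {k. (if i < p \<and> j < p then 0 else k i j) = 0})
    \<inter> (\<Inter>i. \<Inter>j. {k. mmul p (adj k) k i j = mone p i j}) \<inter> (\<Inter>i. \<Inter>j. {k. mmul p k (adj k) i j = (mone p i j :: 'f)})"
    by (auto simp: Umat_def Mat_def fun_eq_iff)
  have "closed {k :: 'f nmat. (if i < p \<and> j < p then 0 else k i j) = 0}"
    "closed {k :: 'f nmat. mmul p (adj k) k i j = mone p i j}"
    "closed {k :: 'f nmat. mmul p k (adj k) i j = mone p i j}" for i j
    subgoal by (cases "i < p \<and> j < p"; auto intro!: * continuous_intros)
    subgoal unfolding mmul_def adj_def by (rule *; intro continuous_intros)
    subgoal unfolding mmul_def adj_def by (rule *; intro continuous_intros)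
    done
  then show ?thesis unfolding eq by (intro closed_Int closed_INT ballI)
qed

text \<open>Matrices are functions on all pairs of natural numbers, so Tychonoff is applied to an
  infinite product of unit balls, of which \<open>Umat p\<close> is a closed subset.\<close>

lemma compact_Umat: "compact (Umat p :: 'f::star_scalar nmat set)"
proof -
  define S where "S = PiE UNIV (\<lambda>i::nat. PiE UNIV (\<lambda>j::nat. cball (0::'f) 1))"
  have PiE: "compact (PiE UNIV A)" if "\<And>i. compact (A i)" for A :: "nat \<Rightarrow> 'b::topological_space set"
    using that compactin_PiE[of "\<lambda>_. euclidean" UNIV A] by (simp add: euclidean_product_topology)
  have "compact S" unfolding S_def by (intro PiE compact_cball)
  moreover have "Umat p = S \<inter> Umat p"
    by (auto simp: S_def Umat_norm_entry)
  ultimately show ?thesis using closed_Umat by (metis compact_Int_closed)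
qed

text \<open>\<open>B\<close> is the derivative at 0 of \<open>cos t * A + sin t * B\<close>, which
  is maximal there.\<close>

lemma rotation_max:
  fixes A B :: real
  assumes "\<And>t. (cos t - 1) * A + sin t * B \<le> 0" shows "B = 0"
proof (rule DERIV_local_max)
  show "((\<lambda>t. cos t * A + sin t * B) has_real_derivative B) (at 0)"
    by (auto intro!: derivative_eq_intros)
  show "\<forall>y. \<bar>0 - y\<bar> < 1 \<longrightarrow> cos y * A + sin y * B \<le> cos 0 * A + sin 0 * B"
    using assms by (auto simp: algebra_simps)
qed simp

text \<open>The squared distance from \<open>x\<close> to its real part is the difference of the
  squares of \<open>norm x\<close> and \<open>re_part x\<close>.\<close>

lemma re_part_eq_norm_imp:
  assumes "norm x \<le> re_part x" shows "x = of_real (re_part (x::'f::star_scalar))"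
proof -
  have "(norm (x - re_part x *\<^sub>R 1))\<^sup>2 = (norm x)\<^sup>2 - (re_part x)\<^sup>2"
    unfolding power2_norm_eq_inner re_part_eq_inner using dot_square_norm[of "1 :: 'f"]
    by (simp add: inner_diff_left inner_diff_right inner_commute[of x 1] power2_eq_square del: power2_norm_eq_inner dot_square_norm)
  also have "\<dots> \<le> 0"
    using assms by (simp add: power_mono)
  finally show ?thesis by (simp add: of_real_def)
qed

text \<open>Among all \<open>u x\<close> with \<open>u\<close> unitary, one with maximal real trace is positive semidefinite.\<close>

theorem polar:
  fixes x :: "'f::star_scalar nmat"
  assumes x: "x \<in> Mat p q" and qp: "q \<le> p"
  obtains u where "u \<in> Umat p" "mmul p u x \<in> PSD q"
proof -
  define T where "T = (\<lambda>h :: 'f nmat. \<Sum>l<q. re_part (h l l))"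
  have cont: "continuous_on (Umat p) (\<lambda>u. T (mmul p u x))"
    unfolding T_def mmul_def by (intro continuous_intros)
  have "Umat p \<noteq> ({} :: 'f nmat set)" using mone_U by blast
  from continuous_attains_sup[OF compact_Umat this cont]
  obtain u where u: "u \<in> Umat p" and max: "\<And>v. v \<in> Umat p \<Longrightarrow> T (mmul p v x) \<le> T (mmul p u x)"
    by blast
  define h where "h = mmul p u x"
  have h: "h \<in> Mat p q" using u x by (auto simp: h_def Umat_def intro: mmul_Mat)
  \<comment> \<open>Since \<open>v u\<close> is again unitary, \<open>h\<close> maximizes the trace
    on its whole orbit. The comparisons below with \<open>v\<close> a phase, a rotation or a
    reflection yield all properties of \<open>h\<close>.\<close>
  have max: "T (mmul p v h) \<le> T h" if "v \<in> Umat p" for v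
    using max[OF mmul_U[OF that u]] by (simp add: h_def mmul_assoc)
  have diag: "h i i = of_real (re_part (h i i))" if i: "i < q" for i
  proof (rule re_part_eq_norm_imp, cases "h i i = 0")
    case False
    define b where "b = star (h i i) /\<^sub>R norm (h i i)"
    have "norm b = 1" using False by (simp add: b_def)
    then have "T (mmul p (phase p i b) h) \<le> T h" using i qp by (intro max phase_Umat) auto
    moreover have "T (mmul p (phase p i b) h) = T h + (re_part (b * h i i) - re_part (h i i))"
    proof -
      have "T (mmul p (phase p i b) h) = (\<Sum>l<q. re_part (h l l) + (if l = i then re_part (b * h i i) - re_part (h i i) else 0))"
        unfolding T_def using i qp by (intro sum.cong refl) (simp add: mmul_phase)
      then show ?thesis using i by (simp add: sum.distrib T_def)
    qed
    moreover have "re_part (b * h i i) = norm (h i i)"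
      using False by (simp add: b_def star_mult_self re_part_scaleR power2_eq_square)
        (simp add: of_real_def re_part_scaleR)
    ultimately show "norm (h i i) \<le> re_part (h i i)" by simp
  qed simp
  \<comment> \<open>Row \<open>j\<close> lies outside the range of \<open>T\<close>, so the rotation
    changes the trace only through row \<open>i\<close>, and the first-order condition isolates
    \<open>h j i\<close>.\<close>
  have low: "h j i = 0" if i: "i < q" and j: "\<not> j < q" for i j
  proof (cases "j < p")
    case True
    have "re_part (b * h j i) = 0" if b: "norm b = 1" for b
    proof (rule rotation_max)
      fix t
      have "T (mmul p (rot p i j b t) h) \<le> T h" using i j True qp b by (intro max rot_Umat) auto
      moreover have "T (mmul p (rot p i j b t) h)
          = (\<Sum>l<q. re_part (h l l) + (if l = i then (cos t - 1) * re_part (h i i) + sin t * re_part (b * h j i) else 0))"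
        unfolding T_def using i j True qp
        by (intro sum.cong refl) (auto simp: mmul_rot re_part_add re_part_scaleR algebra_simps)
      ultimately show "(cos t - 1) * re_part (h i i) + sin t * re_part (b * h j i) \<le> 0"
        using i by (simp add: sum.distrib T_def)
    qed
    then show ?thesis by (intro eq_zero_if_re_part_mult) auto
  qed (use h in \<open>auto simp: Mat_def\<close>)
  \<comment> \<open>Both rows now contribute to the trace, and the first-order condition sees only
    the anti-Hermitian combination of the two entries.\<close>
  have off: "h j i = star (h i j)" if i: "i < q" and j: "j < q" and ij: "i \<noteq> j" for i j
  proof -
    have "re_part (b * (h j i - star (h i j))) = 0" if b: "norm b = 1" for b
    proof (rule rotation_max)
      fix t
      have "T (mmul p (rot p i j b t) h) \<le> T h" using i j ij qp b by (intro max rot_Umat) auto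
      moreover have "T (mmul p (rot p i j b t) h) = (\<Sum>l<q. re_part (h l l) +
          (if l = i then (cos t - 1) * re_part (h i i) + sin t * re_part (b * h j i) else 0) +
          (if l = j then (cos t - 1) * re_part (h j j) - sin t * re_part (star b * h i j) else 0))"
        unfolding T_def using i j ij qp
        by (intro sum.cong refl) (auto simp: mmul_rot re_part_add re_part_diff re_part_scaleR algebra_simps)
      moreover have "re_part (star b * h i j) = re_part (b * star (h i j))"
        by (metis re_part_star star_mult star_star re_part_comm)
      ultimately show "(cos t - 1) * (re_part (h i i) + re_part (h j j)) + sin t * re_part (b * (h j i - star (h i j))) \<le> 0"
        using i j by (simp add: sum.distrib T_def right_diff_distrib re_part_diff distrib_left)
    qed
    then have "h j i - star (h i j) = 0" by (intro eq_zero_if_re_part_mult) auto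
    then show ?thesis by simp
  qed
  have hq: "h \<in> Mat q q" using h low by (auto simp: Mat_def)
  have Herm: "h \<in> Herm q"
    unfolding Herm_iff
  proof (intro conjI allI hq)
    fix i j show "star (h i j) = h j i"
      using off[of i j] diag[of i] hq by (cases "i = j"; cases "i < q"; cases "j < q") (auto simp: Mat_def, metis star_of_real)
  qed
  have "0 \<le> form q h v v" for v
  proof -
    \<comment> \<open>The form sees only the first \<open>q\<close> coordinates. Cutting
      \<open>v\<close> off there makes it a vector of length \<open>p\<close> along which rows can
      be reflected.\<close>
    define w where "w = (\<lambda>k. if k < q then v k else 0)"
    define N where "N = (\<Sum>k<p. (norm (w k))\<^sup>2)"
    have fw: "form q h v v = form q h w w" by (simp add: form_def w_def)
    show ?thesis
    proof (cases "N = 0")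
      case True
      then have "w k = 0" if "k < p" for k
        using that by (simp add: N_def sum_nonneg_eq_0_iff)
      then show ?thesis unfolding fw using qp by (simp add: form_def)
    next
      case False
      then have "0 < N" by (simp add: N_def sum_nonneg less_le)
      \<comment> \<open>The reflection lowers the trace by \<open>2 / N\<close> times the form at
        \<open>w\<close>, and by maximality this amount is nonnegative.\<close>
      have "T (mmul p (reflection p w) h) \<le> T h"
        using False qp by (intro max reflection_Umat) (auto simp: w_def N_def)
      moreover have "T (mmul p (reflection p w) h)
          = T h - (2 / N) * (\<Sum>l<q. re_part (w l * (\<Sum>j<p. star (w j) * h j l)))"
        unfolding T_def mmul_reflection[OF h] N_def[symmetric]
        by (simp add: re_part_diff re_part_scaleR sum_subtractf sum_distrib_left)
      ultimately have "0 \<le> (2 / N) * (\<Sum>l<q. re_part (w l * (\<Sum>j<p. star (w j) * h j l)))" by simp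
      then have "0 \<le> (\<Sum>l<q. re_part (w l * (\<Sum>j<p. star (w j) * h j l)))"
        using \<open>0 < N\<close> by (simp add: zero_le_mult_iff zero_le_divide_iff)
      also have "\<dots> = (\<Sum>l<q. re_part (w l * (\<Sum>j<q. star (w j) * h j l)))"
        using qp by (intro sum.cong refl arg_cong[where f=re_part] arg_cong2[where f=times] sum.mono_neutral_right)
          (auto simp: w_def)
      also have "\<dots> = form q h w w"
        unfolding form_def re_part_comm[of "w _"]
        by (subst sum.swap) (simp add: re_part_sum sum_distrib_right)
      finally show ?thesis by (simp add: fw)
    qed
  qed
  then show ?thesis using that[OF u] Herm by (simp add: PSD_iff_form h_def)
qed

lemma Mat_mono: "x \<in> Mat q r \<Longrightarrow> q \<le> p \<Longrightarrow> x \<in> Mat p r"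
  by (auto simp: Mat_def)

lemma mmul_mono_inner: "x \<in> Mat n q \<or> y \<in> Mat q m \<Longrightarrow> q \<le> p \<Longrightarrow> mmul p x y = mmul q x y"
  for x y :: "'f::star_scalar nmat"
  unfolding mmul_def by (intro ext sum.mono_neutral_right) (auto simp: Mat_def)

text \<open>Left multiplication by a unitary matrix does not change \<open>x^* x\<close>, so the
  positive semidefinite matrix on the orbit of \<open>x\<close> is its square root. Functions
  invariant under left multiplication are thereby functions of the square root.\<close>

corollary psd_sqrt_polar:
  fixes x :: "'f::star_scalar nmat"
  assumes x: "x \<in> Mat p q" and qp: "q \<le> p"
  obtains u where "u \<in> Umat p" "psd_sqrt q (mmul p (adj x) x) = mmul p u x"
proof -
  obtain u where u: "u \<in> Umat p" and h: "mmul p u x \<in> PSD q" using polar[OF x qp] .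
  let ?h = "mmul p u x"
  have "mmul q ?h ?h = mmul p (adj ?h) ?h"
    using h mmul_mono_inner[of ?h q q ?h q p] qp by (auto simp: PSD_def Herm_def)
  also have "\<dots> = mmul p (adj x) (mmul p (mmul p (adj u) u) x)"
    by (simp add: adj_mmul mmul_assoc)
  also have "\<dots> = mmul p (adj x) x"
    using u mmul_mone_left[OF x] by (simp add: Umat_def)
  finally show ?thesis using that[OF u] psd_sqrt_eq[OF h] by metis
qed

section \<open>Haar measure on the unitary group\<close>

context
  fixes I :: "'i set" and P :: "('i \<Rightarrow> 'f::euclidean_space) measure" and add :: "('i \<Rightarrow> 'f) \<Rightarrow> ('i \<Rightarrow> 'f) \<Rightarrow> 'i \<Rightarrow> 'f"
  assumes I: "finite I"
  defines "P \<equiv> PiM I (\<lambda>_. lborel)" and "add \<equiv> (\<lambda>x y. \<lambda>i\<in>I. x i + y i)"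
begin

lemma sigma_finite_PiM_lborel: "sigma_finite_measure P"
proof -
  interpret product_sigma_finite "\<lambda>_::'i. lborel :: 'f measure" ..
  show ?thesis unfolding P_def by (rule sigma_finite[OF I])
qed

lemma space_PiM_lborel: "space P = extensional I"
  by (simp add: P_def space_PiM PiE_def)

lemma component_measurable: "i \<in> I \<Longrightarrow> (\<lambda>x. x i) \<in> borel_measurable P"
  using measurable_component_singleton[of i I "\<lambda>_. lborel :: 'f measure"] by (simp add: P_def)

lemma translate_measurable: "(\<lambda>x. add x a) \<in> measurable P P"
proof -
  have "(\<lambda>x. \<lambda>i\<in>I. x i + a i) \<in> measurable P (PiM I (\<lambda>_. lborel))"
    by (intro measurable_restrict) (auto intro!: borel_measurable_add component_measurable)
  then show ?thesis by (simp add: add_def P_def)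
qed

lemma distr_translate: "distr P P (\<lambda>x. add x a) = P"
proof -
  interpret product_sigma_finite "\<lambda>_::'i. lborel :: 'f measure" ..
  have "distr P P (\<lambda>x. add x a) = PiM I (\<lambda>_. lborel)"
  proof (rule PiM_eqI[OF I])
    show "sets (distr P P (\<lambda>x. add x a)) = sets (PiM I (\<lambda>_. lborel))" by (simp add: P_def)
    fix A assume A: "\<And>i. i \<in> I \<Longrightarrow> A i \<in> sets (lborel :: 'f measure)"
    have "PiE I A \<in> sets P" unfolding P_def by (intro sets_PiM_I_finite I A)
    then have "emeasure (distr P P (\<lambda>x. add x a)) (PiE I A) = emeasure P ((\<lambda>x. add x a) -` PiE I A \<inter> space P)"
      by (rule emeasure_distr[OF translate_measurable])
    also have "(\<lambda>x. add x a) -` PiE I A \<inter> space P = PiE I (\<lambda>i. (+) (a i) -` A i)"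
      by (auto simp: space_PiM_lborel add_def PiE_def Pi_def add.commute)
    also have "emeasure P \<dots> = (\<Prod>i\<in>I. emeasure lborel ((+) (a i) -` A i))"
      unfolding P_def using A I measurable_sets[OF _ A]
      by (intro emeasure_PiM) (auto intro!: measurable_sets_borel[of "(+) _" lborel])
    also have "\<dots> = (\<Prod>i\<in>I. emeasure lborel (A i))"
    proof (rule prod.cong[OF refl])
      fix i assume i: "i \<in> I"
      show "emeasure lborel ((+) (a i) -` A i) = emeasure lborel (A i)"
        using A[OF i] by (subst (2) lborel_distr_plus[of "a i", symmetric], subst emeasure_distr) auto
    qed
    finally show "emeasure (distr P P (\<lambda>x. add x a)) (PiE I A) = (\<Prod>i\<in>I. emeasure lborel (A i))" .
  qed
  then show ?thesis by (simp add: P_def)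
qed

lemma nn_integral_translate:
  "g \<in> borel_measurable P \<Longrightarrow> (\<integral>\<^sup>+x. g (add x a) \<partial>P) = (\<integral>\<^sup>+x. g x \<partial>P)"
  using nn_integral_distr[OF translate_measurable, of g a] by (simp add: distr_translate)

text \<open>
  Uniqueness of translation invariant measures: evaluate the double integral of
  \<open>1\<^sub>A (T x - y) 1\<^sub>B (T x)\<close> over \<open>x\<close> and \<open>y\<close> in both orders.
\<close>

lemma emeasure_additive_vimage_neg:
  assumes T: "T \<in> measurable P P"
    and T_add: "\<And>x y. x \<in> space P \<Longrightarrow> y \<in> space P \<Longrightarrow> T (add x y) = add (T x) (T y)"
    and T': "\<And>y. y \<in> space P \<Longrightarrow> T' y \<in> space P \<and> T (T' y) = y"
    and B: "B \<in> sets P" "emeasure P B \<noteq> 0" "emeasure P B \<noteq> \<infinity>" "T -` B \<inter> space P = B"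
    and A: "A \<in> sets P"
  shows "emeasure P (T -` A \<inter> space P) = emeasure P ((\<lambda>x. \<lambda>i\<in>I. - x i) -` A \<inter> space P)"
proof -
  interpret sigma_finite_measure P by (rule sigma_finite_PiM_lborel)
  interpret pair_sigma_finite P P ..
  define sub where "sub = (\<lambda>x y :: 'i \<Rightarrow> 'f. \<lambda>i\<in>I. x i - y i)"
  define neg where "neg = (\<lambda>x :: 'i \<Rightarrow> 'f. \<lambda>i\<in>I. - x i)"
  have pair: "(\<lambda>(x, y). h (x i) (y i)) \<in> borel_measurable (P \<Otimes>\<^sub>M P)"
    if "i \<in> I" "(\<lambda>(a, b). h a b) \<in> borel_measurable (borel \<Otimes>\<^sub>M borel)" for h :: "'f \<Rightarrow> 'f \<Rightarrow> 'f" and i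
  proof -
    have "(\<lambda>z. (fst z i, snd z i)) \<in> measurable (P \<Otimes>\<^sub>M P) (borel \<Otimes>\<^sub>M borel)"
      using component_measurable[OF that(1)] by measurable
    from measurable_compose[OF this that(2)] show ?thesis by (simp add: case_prod_beta)
  qed
  have add_m: "(\<lambda>(x, y). add x y) \<in> measurable (P \<Otimes>\<^sub>M P) P"
    unfolding add_def P_def case_prod_beta
    apply (rule measurable_restrict)
    using pair[of _ "(+)"] by (simp add: P_def[symmetric] case_prod_beta)
  have sub_m: "(\<lambda>(x, y). sub x y) \<in> measurable (P \<Otimes>\<^sub>M P) P"
    unfolding sub_def P_def case_prod_beta
    apply (rule measurable_restrict)
    using pair[of _ "(-)"] by (simp add: P_def[symmetric] case_prod_beta)
  have neg_m: "neg \<in> measurable P P"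
    unfolding neg_def P_def
    apply (rule measurable_restrict)
    using component_measurable by (simp add: P_def[symmetric])
  have Tsp: "T x \<in> space P" if "x \<in> space P" for x using measurable_space[OF T that] .
  have Tm: "(\<lambda>(x, y). (T x, y)) \<in> measurable (P \<Otimes>\<^sub>M P) (P \<Otimes>\<^sub>M P)"
    using T by measurable
  have AB: "(indicator A :: _ \<Rightarrow> ennreal) \<in> borel_measurable P" "(indicator B :: _ \<Rightarrow> ennreal) \<in> borel_measurable P"
    using A B by auto
  \<comment> \<open>The invariance of \<open>B\<close> enters here; it forces the scaling constant
    of \<open>T\<close> to be 1.\<close>
  have TB: "indicator B (T x) = (indicator B x :: ennreal)" if "x \<in> space P" for x
    using B(4) that by (auto simp: indicator_def)
  define \<alpha> where "\<alpha> = emeasure P (neg -` A \<inter> space P)"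
  have negA: "neg -` A \<inter> space P \<in> sets P" using neg_m A by (rule measurable_sets)
  have TA: "T -` A \<inter> space P \<in> sets P" using T A by (rule measurable_sets)
  have sub1: "(\<lambda>y. sub z y) \<in> measurable P P" if "z \<in> space P" for z
    using measurable_compose[OF measurable_Pair1'[OF that] sub_m] by simp
  have add1: "(\<lambda>y. add z y) \<in> measurable P P" if "z \<in> space P" for z
    using measurable_compose[OF measurable_Pair1'[OF that] add_m] by simp
  have m1: "(\<lambda>(x, y). indicator A (sub (T x) y) * indicator B (T x) :: ennreal) \<in> borel_measurable (P \<Otimes>\<^sub>M P)"
  proof -
    have "(\<lambda>z. sub (T (fst z)) (snd z)) \<in> measurable (P \<Otimes>\<^sub>M P) P"
      using measurable_compose[OF Tm sub_m] by (simp add: case_prod_beta)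
    from measurable_compose[OF this AB(1)] measurable_compose[OF measurable_compose[OF measurable_fst T] AB(2)]
    show ?thesis unfolding case_prod_beta by (rule borel_measurable_times_ennreal)
  qed
  have m2: "(\<lambda>(x, y). indicator A (T x) * indicator B (add (T x) y) :: ennreal) \<in> borel_measurable (P \<Otimes>\<^sub>M P)"
  proof -
    have "(\<lambda>z. add (T (fst z)) (snd z)) \<in> measurable (P \<Otimes>\<^sub>M P) P"
      using measurable_compose[OF Tm add_m] by (simp add: case_prod_beta)
    from measurable_compose[OF measurable_compose[OF measurable_fst T] AB(1)] measurable_compose[OF this AB(2)]
    show ?thesis unfolding case_prod_beta by (rule borel_measurable_times_ennreal)
  qed
  \<comment> \<open>Shifting \<open>y\<close> by \<open>z\<close> turns \<open>z - y\<close> into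
    \<open>- y\<close>, so the value does not depend on \<open>z\<close>.\<close>
  have inner1: "(\<integral>\<^sup>+y. indicator A (sub z y) \<partial>P) = \<alpha>" if z: "z \<in> space P" for z
  proof -
    have "(\<integral>\<^sup>+y. indicator A (sub z y) \<partial>P) = (\<integral>\<^sup>+y. indicator A (sub z (add y z)) \<partial>P)"
      by (rule nn_integral_translate[symmetric]) (rule measurable_compose[OF sub1[OF z] AB(1)])
    also have "\<dots> = (\<integral>\<^sup>+y. indicator (neg -` A \<inter> space P) y \<partial>P)"
      by (intro nn_integral_cong) (auto simp: indicator_def sub_def add_def neg_def cong: restrict_cong)
    finally show ?thesis using negA by (simp add: \<alpha>_def)
  qed
  have inner2: "(\<integral>\<^sup>+y. indicator B (add z y) \<partial>P) = emeasure P B" if z: "z \<in> space P" for z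
  proof -
    have "(\<integral>\<^sup>+y. indicator B (add z y) \<partial>P) = (\<integral>\<^sup>+y. indicator B (add y z) \<partial>P)"
      by (simp add: add_def add.commute)
    also have "\<dots> = (\<integral>\<^sup>+y. indicator B y \<partial>P)"
      by (rule nn_integral_translate) (rule AB(2))
    finally show ?thesis using B by simp
  qed
  have "(\<integral>\<^sup>+x. \<integral>\<^sup>+y. indicator A (sub (T x) y) * indicator B (T x) \<partial>P \<partial>P)
      = (\<integral>\<^sup>+x. \<alpha> * indicator B x \<partial>P)"
    by (intro nn_integral_cong, subst nn_integral_multc)
      (auto intro!: measurable_compose[OF sub1 AB(1)] Tsp simp: inner1[OF Tsp] TB)
  also have "\<dots> = \<alpha> * emeasure P B"
    using B by (simp add: nn_integral_cmult_indicator)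
  finally have J1: "(\<integral>\<^sup>+x. \<integral>\<^sup>+y. indicator A (sub (T x) y) * indicator B (T x) \<partial>P \<partial>P) = \<alpha> * emeasure P B" .
  have "(\<integral>\<^sup>+x. \<integral>\<^sup>+y. indicator A (sub (T x) y) * indicator B (T x) \<partial>P \<partial>P)
      = (\<integral>\<^sup>+y. \<integral>\<^sup>+x. indicator A (sub (T x) y) * indicator B (T x) \<partial>P \<partial>P)"
    using Fubini'[OF m1] by simp
  \<comment> \<open>Shifting \<open>x\<close> by a preimage of \<open>y\<close> under
    \<open>T\<close> replaces \<open>T x\<close> by \<open>T x + y\<close>.\<close>
  also have "\<dots> = (\<integral>\<^sup>+y. \<integral>\<^sup>+x. indicator A (T x) * indicator B (add (T x) y) \<partial>P \<partial>P)"
  proof (rule nn_integral_cong)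
    fix y assume y: "y \<in> space P"
    have "(\<integral>\<^sup>+x. indicator A (sub (T x) y) * indicator B (T x) \<partial>P)
        = (\<integral>\<^sup>+x. indicator A (sub (T (add x (T' y))) y) * indicator B (T (add x (T' y))) \<partial>P :: ennreal)"
      using measurable_compose[OF measurable_Pair2'[OF y] m1]
      by (intro nn_integral_translate[symmetric]) simp
    also have "\<dots> = (\<integral>\<^sup>+x. indicator A (T x) * indicator B (add (T x) y) \<partial>P)"
    proof (rule nn_integral_cong)
      fix x assume x: "x \<in> space P"
      have "sub (add (T x) y) y = T x"
        using Tsp[OF x] y by (auto simp: sub_def add_def space_PiM_lborel extensional_def)
      then show "indicator A (sub (T (add x (T' y))) y) * indicator B (T (add x (T' y)))
          = (indicator A (T x) * indicator B (add (T x) y) :: ennreal)"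
        using x y T'[OF y] by (simp add: T_add)
    qed
    finally show "(\<integral>\<^sup>+x. indicator A (sub (T x) y) * indicator B (T x) \<partial>P)
        = (\<integral>\<^sup>+x. indicator A (T x) * indicator B (add (T x) y) \<partial>P :: ennreal)" .
  qed
  also have "\<dots> = (\<integral>\<^sup>+x. \<integral>\<^sup>+y. indicator A (T x) * indicator B (add (T x) y) \<partial>P \<partial>P)"
    using Fubini'[OF m2] by simp
  also have "\<dots> = (\<integral>\<^sup>+x. indicator (T -` A \<inter> space P) x * emeasure P B \<partial>P)"
  proof (rule nn_integral_cong)
    fix x assume x: "x \<in> space P"
    then have "indicator A (T x) = (indicator (T -` A \<inter> space P) x :: ennreal)"
      by (auto simp: indicator_def)
    then show "(\<integral>\<^sup>+y. indicator A (T x) * indicator B (add (T x) y) \<partial>P)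
        = indicator (T -` A \<inter> space P) x * emeasure P B"
      by (simp add: nn_integral_cmult measurable_compose[OF add1[OF Tsp[OF x]] AB(2)] inner2[OF Tsp[OF x]])
  qed
  also have "\<dots> = emeasure P (T -` A \<inter> space P) * emeasure P B"
    using TA by (simp add: nn_integral_multc)
  finally have "emeasure P (T -` A \<inter> space P) * emeasure P B = \<alpha> * emeasure P B"
    using J1 by simp
  then have "emeasure P (T -` A \<inter> space P) = \<alpha>"
    using B(2,3) by (simp add: mult.commute[of _ "emeasure P B"] ennreal_mult_cancel_left)
  then show ?thesis by (simp add: \<alpha>_def neg_def)
qed

lemma emeasure_additive_vimage:
  assumes T: "T \<in> measurable P P"
    and T_add: "\<And>x y. x \<in> space P \<Longrightarrow> y \<in> space P \<Longrightarrow> T (add x y) = add (T x) (T y)"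
    and T': "\<And>y. y \<in> space P \<Longrightarrow> T' y \<in> space P \<and> T (T' y) = y"
    and B: "B \<in> sets P" "emeasure P B \<noteq> 0" "emeasure P B \<noteq> \<infinity>" "T -` B \<inter> space P = B"
    and A: "A \<in> sets P"
  shows "emeasure P (T -` A \<inter> space P) = emeasure P A"
proof -
  have "emeasure P ((\<lambda>x. x) -` A \<inter> space P) = emeasure P ((\<lambda>x. \<lambda>i\<in>I. - x i) -` A \<inter> space P)"
    using sets.sets_into_space[OF B(1)]
    by (intro emeasure_additive_vimage_neg[where T' = "\<lambda>x. x" and B = B] A B) auto
  then show ?thesis
    using emeasure_additive_vimage_neg[OF T T_add T' B A] sets.sets_into_space[OF A]
    by (simp add: Int_absorb2)
qed

end

section \<open>Gram-Schmidt orthonormalization of the columns of a matrix\<close>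

fun gram_schmidt :: "nat \<Rightarrow> 'f::star_scalar nmat \<Rightarrow> nat \<Rightarrow> nat \<Rightarrow> 'f" where
  "gram_schmidt p x j = (let w = (\<lambda>a. x a j -
      (\<Sum>i<j. gram_schmidt p x i a * (\<Sum>b<p. star (gram_schmidt p x i b) * x b j)))
    in (\<lambda>a. w a /\<^sub>R sqrt (\<Sum>b<p. (norm (w b))\<^sup>2)))"

declare gram_schmidt.simps [simp del]

definition gs_residual :: "nat \<Rightarrow> 'f::star_scalar nmat \<Rightarrow> nat \<Rightarrow> nat \<Rightarrow> 'f" where
  "gs_residual p x j a = x a j -
      (\<Sum>i<j. gram_schmidt p x i a * (\<Sum>b<p. star (gram_schmidt p x i b) * x b j))"

text \<open>Column \<open>j\<close> can be normalized exactly if this is nonzero. At zero the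
  division by \<open>sqrt 0\<close> returns a zero column.\<close>

definition gs_norm2 :: "nat \<Rightarrow> 'f::star_scalar nmat \<Rightarrow> nat \<Rightarrow> real" where
  "gs_norm2 p x j = (\<Sum>b<p. (norm (gs_residual p x j b))\<^sup>2)"

lemma gram_schmidt_eq: "gram_schmidt p x j a = gs_residual p x j a /\<^sub>R sqrt (gs_norm2 p x j)"
  by (subst gram_schmidt.simps) (simp add: Let_def gs_residual_def gs_norm2_def)

lemma gs_orthonormal:
  assumes nz: "\<And>i. i < p \<Longrightarrow> gs_norm2 p x i \<noteq> 0" and "j < p" "i \<le> j"
  shows "(\<Sum>b<p. star (gram_schmidt p x i b) * gram_schmidt p x j b) = (if i = j then 1 else 0)"
  using assms(2,3)
proof (induction j arbitrary: i rule: less_induct)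
  case (less j)
  let ?g = "gram_schmidt p x"
  define ip where "ip = (\<lambda>v w :: nat \<Rightarrow> 'a. \<Sum>b<p. star (v b) * w b)"
  have sym: "ip v w = star (ip w v)" for v w
    by (simp add: ip_def star_sum star_mult)
  have ip_le: "ip (?g i) (?g i') = (if i = i' then 1 else 0)" if "i \<le> i'" "i' < j" for i i'
    using less.IH[of i' i] that less.prems by (simp add: ip_def)
  then have ip: "ip (?g i) (?g i') = (if i = i' then 1 else 0)" if "i < j" "i' < j" for i i'
    using that sym[of "?g i" "?g i'"] by (cases "i \<le> i'") auto
  show ?case
  proof (cases "i = j")
    case True
    define N where "N = gs_norm2 p x j"
    have N: "N \<noteq> 0" "0 \<le> N"
      using nz less.prems by (auto simp: N_def gs_norm2_def sum_nonneg)
    have "(\<Sum>b<p. (norm (?g j b))\<^sup>2) = (inverse (sqrt N))\<^sup>2 * (\<Sum>b<p. (norm (gs_residual p x j b))\<^sup>2)"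
      unfolding gram_schmidt_eq N_def[symmetric] norm_scaleR power_mult_distrib power2_abs sum_distrib_left ..
    also have "(\<Sum>b<p. (norm (gs_residual p x j b))\<^sup>2) = N"
      by (simp add: N_def gs_norm2_def)
    also have "(inverse (sqrt N))\<^sup>2 * N = 1"
      using N by (simp add: power_inverse)
    finally have "(\<Sum>b<p. (norm (?g j b))\<^sup>2) = 1" .
    moreover have "ip (?g j) (?g j) = of_real (\<Sum>b<p. (norm (?g j b))\<^sup>2)"
      by (simp add: ip_def star_mult_self)
    ultimately show ?thesis using True by (simp add: ip_def)
  next
    case False
    then have i: "i < j" using less.prems by simp
    have "ip (?g i) (gs_residual p x j) = ip (?g i) (\<lambda>a. x a j)
        - (\<Sum>i'<j. ip (?g i) (?g i') * ip (?g i') (\<lambda>a. x a j))"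
      unfolding ip_def gs_residual_def
      by (simp add: right_diff_distrib sum_subtractf sum_distrib_left sum_distrib_right mult.assoc)
        (subst sum.swap, rule sum.cong[OF refl], rule sum.swap)
    also have "(\<Sum>i'<j. ip (?g i) (?g i') * ip (?g i') (\<lambda>a. x a j))
        = (\<Sum>i'<j. if i = i' then ip (?g i') (\<lambda>a. x a j) else 0)"
      using i by (intro sum.cong refl) (simp add: ip)
    finally have "ip (?g i) (gs_residual p x j) = 0" using i by simp
    moreover have "ip (?g i) (?g j) = ip (?g i) (gs_residual p x j) /\<^sub>R sqrt (gs_norm2 p x j)"
      by (simp add: ip_def gram_schmidt_eq[of p x j] scaleR_sum_right)
    ultimately show ?thesis using False by (simp add: ip_def)
  qed
qed

definition gs_mat :: "nat \<Rightarrow> 'f::star_scalar nmat \<Rightarrow> 'f nmat" where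
  "gs_mat p x = (\<lambda>i j. if i < p \<and> j < p then gram_schmidt p x j i else 0)"

lemma gs_mat_Umat:
  assumes nz: "\<And>i. i < p \<Longrightarrow> gs_norm2 p x i \<noteq> 0" shows "gs_mat p x \<in> Umat p"
proof (rule left_inverse_adj_imp_Umat)
  show "gs_mat p x \<in> Mat p p" by (auto simp: gs_mat_def Mat_def)
  show "mmul p (adj (gs_mat p x)) (gs_mat p x) = mone p"
  proof (intro ext)
    fix i j
    have ip: "(\<Sum>b<p. star (gram_schmidt p x i b) * gram_schmidt p x j b) = (if i = j then 1 else 0)"
      if "i < p" "j < p"
    proof (cases "i \<le> j")
      case True
      then show ?thesis using gs_orthonormal[OF nz that(2)] by blast
    next
      case False
      then have "star (\<Sum>b<p. star (gram_schmidt p x j b) * gram_schmidt p x i b) = 0"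
        using gs_orthonormal[OF nz that(1), of j] by simp
      then show ?thesis using False by (simp add: star_sum star_mult)
    qed
    show "mmul p (adj (gs_mat p x)) (gs_mat p x) i j = mone p i j"
      using ip by (cases "i < p"; cases "j < p") (auto simp: mmul_def adj_def gs_mat_def mone_def)
  qed
qed

lemma Umat_inner:
  assumes "u \<in> Umat p"
  shows "(\<Sum>b<p. star (\<Sum>c<p. u b c * v c) * (\<Sum>c<p. u b c * w c)) = (\<Sum>b<p. star (v b) * w b)"
proof -
  \<comment> \<open>A vector is viewed as a matrix with all columns equal to it, so that the matrix
    identities apply; entry (0, 0) is then read off.\<close>
  let ?V = "\<lambda>i j::nat. v i" and ?W = "\<lambda>i j::nat. w i"
  have "(\<Sum>b<p. star (\<Sum>c<p. u b c * v c) * (\<Sum>c<p. u b c * w c))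
      = mmul p (adj (mmul p u ?V)) (mmul p u ?W) 0 0"
    by (simp add: mmul_def adj_def)
  also have "mmul p (adj (mmul p u ?V)) (mmul p u ?W) = mmul p (adj ?V) (mmul p (mmul p (adj u) u) ?W)"
    by (simp add: adj_mmul mmul_assoc)
  also have "mmul p (adj u) u = mone p"
    using assms by (simp add: Umat_def)
  also have "mmul p (adj ?V) (mmul p (mone p) ?W) 0 0 = (\<Sum>b<p. star (v b) * w b)"
    by (simp add: mmul_def adj_def mone_def if_distrib[of "\<lambda>z. z * _"] cong: if_cong)
  finally show ?thesis .
qed

lemma Umat_norm_vec:
  assumes "u \<in> Umat p"
  shows "(\<Sum>b<p. (norm (\<Sum>c<p. u b c * v c))\<^sup>2) = (\<Sum>b<p. (norm (v b))\<^sup>2)"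
proof -
  have "of_real (\<Sum>b<p. (norm (\<Sum>c<p. u b c * v c))\<^sup>2) = (of_real (\<Sum>b<p. (norm (v b))\<^sup>2) :: 'a)"
    using Umat_inner[OF assms, of v v] by (simp add: star_mult_self)
  then show ?thesis by (simp only: of_real_eq_iff)
qed

text \<open>The projection coefficients multiply the columns from the right, and a unitary
  \<open>u\<close> preserves them, so every stage of the process commutes with left multiplication
  by \<open>u\<close>.\<close>

lemma gs_residual_Umat:
  assumes u: "u \<in> Umat p"
  shows "gs_residual p (mmul p u x) j a = (\<Sum>c<p. u a c * gs_residual p x j c)"
    and "gs_norm2 p (mmul p u x) j = gs_norm2 p x j"
    and "gram_schmidt p (mmul p u x) j a = (\<Sum>c<p. u a c * gram_schmidt p x j c)"
proof -
  have "(\<forall>a. gs_residual p (mmul p u x) j a = (\<Sum>c<p. u a c * gs_residual p x j c)) \<and>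
     gs_norm2 p (mmul p u x) j = gs_norm2 p x j \<and>
     (\<forall>a. gram_schmidt p (mmul p u x) j a = (\<Sum>c<p. u a c * gram_schmidt p x j c))"
  proof (induction j rule: less_induct)
    case (less j)
    have r: "gs_residual p (mmul p u x) j a = (\<Sum>c<p. u a c * gs_residual p x j c)" for a
    proof -
      define S where "S = (\<lambda>i. \<Sum>b<p. star (gram_schmidt p x i b) * x b j)"
      have res: "gs_residual p x j c = x c j - (\<Sum>i<j. gram_schmidt p x i c * S i)" for c
        by (simp add: gs_residual_def S_def)
      have "gs_residual p (mmul p u x) j a = (\<Sum>c<p. u a c * x c j) -
        (\<Sum>i<j. (\<Sum>c<p. u a c * gram_schmidt p x i c) *
          (\<Sum>b<p. star (\<Sum>c<p. u b c * gram_schmidt p x i c) * (\<Sum>c<p. u b c * x c j)))"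
        unfolding gs_residual_def using less.IH by (simp add: mmul_def)
      also have "\<dots> = (\<Sum>c<p. u a c * x c j) - (\<Sum>i<j. (\<Sum>c<p. u a c * gram_schmidt p x i c) * S i)"
        unfolding Umat_inner[OF u] S_def ..
      also have "\<dots> = (\<Sum>c<p. u a c * gs_residual p x j c)"
        unfolding res right_diff_distrib sum_subtractf sum_distrib_left sum_distrib_right mult.assoc
        by (rule arg_cong[OF sum.swap])
      finally show ?thesis .
    qed
    moreover have n: "gs_norm2 p (mmul p u x) j = gs_norm2 p x j"
      by (simp add: gs_norm2_def r Umat_norm_vec[OF u])
    ultimately show ?case
      by (simp add: gram_schmidt_eq scaleR_sum_right)
  qed
  then show "gs_residual p (mmul p u x) j a = (\<Sum>c<p. u a c * gs_residual p x j c)"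
    "gs_norm2 p (mmul p u x) j = gs_norm2 p x j"
    "gram_schmidt p (mmul p u x) j a = (\<Sum>c<p. u a c * gram_schmidt p x j c)" by blast+
qed

lemma gs_mat_mmul: "u \<in> Umat p \<Longrightarrow> gs_mat p (mmul p u x) = mmul p u (gs_mat p x)"
proof (intro ext)
  fix i j assume u: "u \<in> Umat p"
  have "u i k = 0" if "\<not> i < p" for k
    using u that unfolding Umat_def Mat_def by blast
  then have "mmul p u (gs_mat p x) i j = (if i < p \<and> j < p then \<Sum>k<p. u i k * gram_schmidt p x j k else 0)"
    by (auto simp: mmul_def gs_mat_def)
  then show "gs_mat p (mmul p u x) i j = mmul p u (gs_mat p x) i j"
    using u by (simp add: gs_mat_def gs_residual_Umat(3))
qed

lemma tendsto_star [tendsto_intros]: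
  "(f \<longlongrightarrow> l) F \<Longrightarrow> ((\<lambda>x. star (f x :: 'f::star_scalar)) \<longlongrightarrow> star l) F"
  unfolding star_eq re_part_eq_inner by (intro tendsto_intros)

text \<open>Continuity of the process at the identity matrix is enough: it keeps the residual norms
  away from zero on a small box, so that the matrices with independent columns have positive
  measure.\<close>

lemma gs_tendsto_mone:
  assumes x: "\<And>a b. a < p \<Longrightarrow> b < p \<Longrightarrow> ((\<lambda>n. x n a b) \<longlongrightarrow> (mone p a b :: 'f::star_scalar)) F"
  shows "j < p \<Longrightarrow> ((\<lambda>n. gs_norm2 p (x n) j) \<longlongrightarrow> 1) F"
    and "j < p \<Longrightarrow> a < p \<Longrightarrow> ((\<lambda>n. gram_schmidt p (x n) j a) \<longlongrightarrow> mone p a j) F"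
proof -
  have "j < p \<longrightarrow> ((\<lambda>n. gs_norm2 p (x n) j) \<longlongrightarrow> 1) F \<and>
    (\<forall>a<p. ((\<lambda>n. gram_schmidt p (x n) j a) \<longlongrightarrow> mone p a j) F)"
  proof (induction j rule: less_induct)
    case (less j)
    show ?case
    proof
      assume j: "j < p"
      have g: "((\<lambda>n. gram_schmidt p (x n) i a) \<longlongrightarrow> mone p a i) F" if "i < j" "a < p" for i a
        using less.IH that j by auto
      have r: "((\<lambda>n. gs_residual p (x n) j a) \<longlongrightarrow> mone p a j) F" if a: "a < p" for a
      proof -
        have "((\<lambda>n. gs_residual p (x n) j a) \<longlongrightarrow> mone p a j -
            (\<Sum>i<j. mone p a i * (\<Sum>b<p. star (mone p b i) * mone p b j))) F"
          unfolding gs_residual_def using a j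
          by (intro tendsto_diff tendsto_sum tendsto_mult tendsto_star x g) auto
        moreover have "(\<Sum>i<j. mone p a i * (\<Sum>b<p. star (mone p b i) * mone p b j)) = (0::'f)"
        proof (intro sum.neutral ballI)
          fix i assume "i \<in> {..<j}"
          then have "(\<Sum>b<p. star (mone p b i) * mone p b j) = (0::'f)"
            by (intro sum.neutral) (auto simp: mone_def)
          then show "mone p a i * (\<Sum>b<p. star (mone p b i) * mone p b j) = (0::'f)" by simp
        qed
        ultimately show ?thesis by simp
      qed
      have "((\<lambda>n. gs_norm2 p (x n) j) \<longlongrightarrow> (\<Sum>a<p. (norm (mone p a j :: 'f))\<^sup>2)) F"
        unfolding gs_norm2_def by (intro tendsto_intros r) auto
      moreover have "(\<Sum>a<p. (norm (mone p a j :: 'f))\<^sup>2) = (\<Sum>a<p. if a = j then 1 else 0)"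
        using j by (intro sum.cong) (auto simp: mone_def)
      ultimately have n: "((\<lambda>n. gs_norm2 p (x n) j) \<longlongrightarrow> 1) F" using j by simp
      have "((\<lambda>n. gram_schmidt p (x n) j a) \<longlongrightarrow> mone p a j /\<^sub>R sqrt 1) F" if "a < p" for a
        unfolding gram_schmidt_eq using that by (intro tendsto_intros r n) auto
      with n show "((\<lambda>n. gs_norm2 p (x n) j) \<longlongrightarrow> 1) F \<and>
          (\<forall>a<p. ((\<lambda>n. gram_schmidt p (x n) j a) \<longlongrightarrow> mone p a j) F)" by simp
    qed
  qed
  then show "j < p \<Longrightarrow> ((\<lambda>n. gs_norm2 p (x n) j) \<longlongrightarrow> 1) F"
    "j < p \<Longrightarrow> a < p \<Longrightarrow> ((\<lambda>n. gram_schmidt p (x n) j a) \<longlongrightarrow> mone p a j) F" by blast+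
qed

lemma borel_measurable_star [measurable (raw)]:
  "f \<in> borel_measurable M \<Longrightarrow> (\<lambda>x. star (f x :: 'f::star_scalar)) \<in> borel_measurable M"
  unfolding star_eq re_part_eq_inner
  by (intro borel_measurable_diff borel_measurable_scaleR borel_measurable_times borel_measurable_const borel_measurable_inner)

lemma gs_measurable:
  assumes x: "\<And>a b. (\<lambda>z. x z a b) \<in> borel_measurable M"
  shows "(\<lambda>z. gs_norm2 p (x z) j) \<in> borel_measurable M"
    and "(\<lambda>z. gram_schmidt p (x z) j a :: 'f::star_scalar) \<in> borel_measurable M"
proof -
  have "(\<lambda>z. gs_norm2 p (x z) j) \<in> borel_measurable M \<and>
    (\<forall>a. (\<lambda>z. gram_schmidt p (x z) j a) \<in> borel_measurable M)"
  proof (induction j rule: less_induct)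
    case (less j)
    then have r: "(\<lambda>z. gs_residual p (x z) j a) \<in> borel_measurable M" for a
      unfolding gs_residual_def
      by (intro borel_measurable_diff borel_measurable_sum borel_measurable_times borel_measurable_star x) auto
    then have n: "(\<lambda>z. gs_norm2 p (x z) j) \<in> borel_measurable M"
      unfolding gs_norm2_def
      by (intro borel_measurable_sum borel_measurable_power measurable_compose[OF r borel_measurable_norm])
    have "(\<lambda>z. inverse (sqrt (gs_norm2 p (x z) j))) \<in> borel_measurable M"
      using n by measurable
    with r n show ?case unfolding gram_schmidt_eq
      by (intro conjI allI borel_measurable_scaleR)
  qed
  then show "(\<lambda>z. gs_norm2 p (x z) j) \<in> borel_measurable M"
    "(\<lambda>z. gram_schmidt p (x z) j a) \<in> borel_measurable M" by blast+
qed

section \<open>Existence of a left invariant probability measure\<close>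

definition haar_Umat :: "nat \<Rightarrow> 'f::star_scalar nmat measure \<Rightarrow> bool" where
  "haar_Umat p \<nu> \<longleftrightarrow> sets \<nu> = sets (restrict_space borel (Umat p)) \<and> emeasure \<nu> (Umat p) = 1 \<and>
     (\<forall>u\<in>Umat p. distr \<nu> \<nu> (mmul p u) = \<nu>)"

lemma borel_measurable_entry: "(\<lambda>k. k i j) \<in> borel_measurable (borel :: 'a::second_countable_topology nmat measure)"
proof (rule borel_measurable_continuous_onI)
  show "continuous_on UNIV (\<lambda>k :: 'a nmat. k i j)" by (rule continuous_on_entry)
qed

lemma borel_measurable_nmatI:
  "(\<And>i j. (\<lambda>x. f x i j) \<in> borel_measurable M) \<Longrightarrow> f \<in> borel_measurable M"
  for f :: "'b \<Rightarrow> 'a::second_countable_topology nmat"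
  by (intro measurable_coordinatewise_then_product)

lemma borel_measurable_mmul:
  fixes u :: "'f::star_scalar nmat"
  shows "mmul p u \<in> borel_measurable borel"
proof (rule borel_measurable_nmatI)
  fix i j
  show "(\<lambda>x. mmul p u x i j) \<in> borel_measurable borel"
    unfolding mmul_def
    by (intro borel_measurable_sum borel_measurable_times borel_measurable_const borel_measurable_entry)
qed

text \<open>Left multiplication by a unitary matrix preserves Lebesgue measure, the ball
  \<open>B\<close> and the domain \<open>D\<close>, and it commutes with Gram-Schmidt. Hence the law
  of the orthonormalized matrix is left invariant.\<close>

theorem haar_Umat_exists: "\<exists>\<nu> :: 'f::star_scalar nmat measure. haar_Umat p \<nu>"
proof -
  define I where "I = {..<p} \<times> {..<p}"
  define P :: "(nat \<times> nat \<Rightarrow> 'f) measure" where "P = PiM I (\<lambda>_. lborel)"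
  define emb :: "(nat \<times> nat \<Rightarrow> 'f) \<Rightarrow> 'f nmat" where
    "emb = (\<lambda>f i j. if i < p \<and> j < p then f (i, j) else 0)"
  define act where "act = (\<lambda>u f. \<lambda>(i, j)\<in>I. mmul p u (emb f) i j)"
  define D where "D = {f \<in> space P. \<forall>j<p. gs_norm2 p (emb f) j \<noteq> 0}"
  \<comment> \<open>A Euclidean ball, hence invariant under unitary matrices. The bound allows each
    of the \<open>p * p\<close> entries norm 2, so the ball contains every box around the identity
    defined below.\<close>
  define B where "B = {f \<in> space P. frob p p (emb f) (emb f) \<le> 4 * (real p)\<^sup>2}"
  define S where "S = D \<inter> B"
  define box where "box = (\<lambda>n. PiE I (\<lambda>(i, j). ball (mone p i j :: 'f) (1 / Suc n)))"
  define R where "R = restrict_space borel (Umat p :: 'f nmat set)"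
  have finI: "finite I" by (simp add: I_def)
  have comp: "(\<lambda>f. f ij) \<in> borel_measurable P" if "ij \<in> I" for ij
    using component_measurable[OF finI that] by (simp add: P_def)
  have sp: "space P = extensional I" using space_PiM_lborel[OF finI] by (simp add: P_def)
  have emb_meas: "(\<lambda>f. emb f a b) \<in> borel_measurable P" for a b
    using comp[of "(a, b)"] by (cases "a < p \<and> b < p") (auto simp: emb_def I_def)
  have emb_Mat: "emb f \<in> Mat p p" for f by (auto simp: emb_def Mat_def)
  have emb_act: "emb (act u f) = mmul p u (emb f)" if "u \<in> Umat p" for u f
  proof -
    have "mmul p u (emb f) \<in> Mat p p" using that emb_Mat by (auto simp: Umat_def intro: mmul_Mat)
    then have "mmul p u (emb f) i j = 0" if "\<not> (i < p \<and> j < p)" for i j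
      using that unfolding Mat_def by blast
    moreover have "emb (act u f) i j = (if i < p \<and> j < p then mmul p u (emb f) i j else 0)" for i j
      by (subst emb_def) (simp add: act_def I_def)
    ultimately show ?thesis by (intro ext) auto
  qed
  have act_app: "act u f ij = (if ij \<in> I then mmul p u (emb f) (fst ij) (snd ij) else undefined)" for u f ij
    by (simp add: act_def case_prod_unfold)
  have act_sp: "act u f \<in> space P" for u f by (simp add: sp act_def)
  have act_meas: "act u \<in> measurable P P" for u
  proof -
    have "(\<lambda>f. \<lambda>ij\<in>I. mmul p u (emb f) (fst ij) (snd ij)) \<in> measurable P (PiM I (\<lambda>_. lborel))"
      unfolding mmul_def
      by (rule measurable_restrict)
        (auto intro!: borel_measurable_sum borel_measurable_times borel_measurable_const emb_meas)
    then show ?thesis by (simp add: act_def P_def case_prod_unfold)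
  qed
  have D: "D \<in> sets P"
  proof -
    have "{f \<in> space P. gs_norm2 p (emb f) j \<noteq> 0} \<in> sets P" for j
    proof -
      have "(\<lambda>f. gs_norm2 p (emb f) j) -` (- {0}) \<inter> space P \<in> sets P"
        by (rule measurable_sets[OF gs_measurable(1)[where x = emb, OF emb_meas]]) simp
      then show ?thesis by (simp add: vimage_def Int_def conj_commute)
    qed
    then have "{f \<in> space P. \<forall>j\<in>{..<p}. gs_norm2 p (emb f) j \<noteq> 0} \<in> sets P"
      by (intro sets.sets_Collect_finite_All) auto
    then show ?thesis unfolding D_def Ball_def lessThan_iff .
  qed
  have B: "B \<in> sets P"
  proof -
    have "(\<lambda>f. frob p p (emb f) (emb f)) \<in> borel_measurable P"
      unfolding frob_def by (intro borel_measurable_sum borel_measurable_inner emb_meas)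
    then show ?thesis unfolding B_def by measurable
  qed
  have box: "box n \<in> sets P" for n
    unfolding box_def P_def by (intro sets_PiM_I_finite finI) (auto split: prod.splits)
  have box_pos: "0 < emeasure P (box n)" for n
  proof -
    interpret product_sigma_finite "\<lambda>_::nat \<times> nat. lborel :: 'f measure" ..
    have "emeasure P (box n) = (\<Prod>ij\<in>I. emeasure lborel (ball (mone p (fst ij) (snd ij) :: 'f) (1 / Suc n)))"
      unfolding P_def box_def by (subst emeasure_PiM) (auto simp: finI case_prod_beta)
    also have "\<dots> \<noteq> 0"
      using finI less_imp_neq[OF unit_ball_vol_pos[of "real DIM('f)"], symmetric] by (auto simp: emeasure_lborel_ball_finite prod_zero_iff emeasure_ball content_ball_eq_0_iff)
    finally show ?thesis by (simp add: zero_less_iff_neq_zero)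
  qed
  have boxB: "box n \<subseteq> B" for n
  proof
    fix f assume f: "f \<in> box n"
    have "norm (emb f i j) \<le> 2" if "i < p" "j < p" for i j
    proof -
      have "f (i, j) \<in> ball (mone p i j) (1 / Suc n)" 
        using PiE_mem[OF f[unfolded box_def], of "(i, j)"] that by (simp add: I_def)
      then have "dist (mone p i j) (f (i, j)) < 1 / real (Suc n)" by simp
      also have "\<dots> \<le> 1" by simp
      finally have "dist (mone p i j) (f (i, j)) < 1" .
      moreover have "norm (mone p i j :: 'f) \<le> 1" by (simp add: mone_def)
      ultimately have "norm (f (i, j)) \<le> 2"
        using norm_triangle_ineq2[of "f (i, j)" "mone p i j"] by (simp add: dist_norm norm_minus_commute)
      then show ?thesis using that by (simp add: emb_def)
    qed
    then have "frob p p (emb f) (emb f) \<le> (\<Sum>l<p. \<Sum>i<p. 2\<^sup>2)"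
      unfolding frob_self by (intro sum_mono power_mono) auto
    then show "f \<in> B"
      using f by (auto simp: B_def sp box_def PiE_def power2_eq_square)
  qed
  \<comment> \<open>Otherwise matrices outside \<open>D\<close>, one from each box, would converge
    to the identity, where all residual norms tend to 1.\<close>
  have "\<exists>n. box n \<subseteq> D"
  proof (rule ccontr)
    assume "\<not> ?thesis"
    then have "\<forall>n. \<exists>f. f \<in> box n \<and> f \<notin> D" by blast
    from choice[OF this] obtain f where f: "\<And>n. f n \<in> box n" "\<And>n. f n \<notin> D" by blast
    have "(\<lambda>n. emb (f n) a b) \<longlonglongrightarrow> mone p a b" if "a < p" "b < p" for a b
    proof (rule metric_tendsto_imp_tendsto)
      show "(\<lambda>n. 1 / real (Suc n)) \<longlonglongrightarrow> 0" by (rule LIMSEQ_Suc[OF lim_1_over_n])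
      have "f n (a, b) \<in> ball (mone p a b) (1 / Suc n)" for n
        using PiE_mem[OF f(1)[of n, unfolded box_def], of "(a, b)"] that by (simp add: I_def)
      then show "\<forall>\<^sub>F n in sequentially. dist (emb (f n) a b) (mone p a b) \<le> dist (1 / real (Suc n)) 0"
        using that by (intro always_eventually allI) (auto simp: emb_def dist_commute less_imp_le)
    qed
    then have "\<forall>\<^sub>F n in sequentially. gs_norm2 p (emb (f n)) j \<noteq> 0" if "j < p" for j
      using tendsto_imp_eventually_ne[OF gs_tendsto_mone(1)[of p "\<lambda>n. emb (f n)", OF _ that]] by simp
    then have "\<forall>\<^sub>F n in sequentially. \<forall>j\<in>{..<p}. gs_norm2 p (emb (f n)) j \<noteq> 0"
      by (intro eventually_ball_finite) auto
    from eventually_happens[OF this] obtain n where "\<forall>j<p. gs_norm2 p (emb (f n)) j \<noteq> 0"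
      by auto
    moreover have "f n \<in> space P" using f(1)[of n] by (auto simp: sp box_def PiE_def)
    ultimately show False using f(2)[of n] by (simp add: D_def)
  qed
  then obtain n where n: "box n \<subseteq> D" ..
  have S: "S \<in> sets P" using D B by (simp add: S_def)
  have S_pos: "emeasure P S \<noteq> 0"
    using emeasure_mono[of "box n" S P] n boxB[of n] S box_pos[of n] by (auto simp: S_def)
  have B_pos: "emeasure P B \<noteq> 0"
    using emeasure_mono[of S B P] S_pos B by (auto simp: S_def)
  have B_fin: "emeasure P B \<noteq> \<infinity>"
  proof -
    interpret product_sigma_finite "\<lambda>_::nat \<times> nat. lborel :: 'f measure" ..
    have "B \<subseteq> PiE I (\<lambda>_. cball 0 (2 * real p))"
    proof
      fix f assume f: "f \<in> B"
      have "f (i, j) \<in> cball 0 (2 * real p)" if "i < p" "j < p" for i j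
      proof -
        have "(norm (emb f i j))\<^sup>2 \<le> (\<Sum>j<p. (norm (emb f i j))\<^sup>2)"
          using that by (intro member_le_sum) auto
        also have "\<dots> \<le> frob p p (emb f) (emb f)"
          unfolding frob_self using that by (intro member_le_sum) (auto intro: sum_nonneg)
        also have "\<dots> \<le> (2 * real p)\<^sup>2" using f by (simp add: B_def power_mult_distrib)
        finally have "norm (emb f i j) \<le> 2 * real p" by (rule power2_le_imp_le) simp
        then show ?thesis using that by (simp add: emb_def)
      qed
      then show "f \<in> PiE I (\<lambda>_. cball 0 (2 * real p))" using f by (auto simp: B_def sp I_def PiE_def)
    qed
    then have "emeasure P B \<le> emeasure P (PiE I (\<lambda>_. cball 0 (2 * real p)))"
      by (intro emeasure_mono) (auto simp: P_def intro!: sets_PiM_I_finite finI)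
    also have "\<dots> = (\<Prod>ij\<in>I. emeasure lborel (cball (0::'f) (2 * real p)))"
      unfolding P_def by (subst emeasure_PiM) (auto simp: finI)
    also have "\<dots> < \<infinity>"
      using emeasure_lborel_cball_finite[of "0 :: 'f" "2 * real p"] by (simp add: power_less_top_ennreal)
    finally show ?thesis by simp
  qed
  have S_fin: "emeasure P S \<noteq> \<infinity>"
    using emeasure_mono[of S B P] B_fin B by (auto simp: S_def top_unique)
  have act_B: "act u f \<in> B \<longleftrightarrow> f \<in> B" if u: "u \<in> Umat p" and f: "f \<in> space P" for u f
  proof -
    have "frob p p (mmul p u (emb f)) (mmul p u (emb f)) = frob p p (emb f) (emb f)"
      unfolding frob_mmul_left mmul_assoc[symmetric]
      using u emb_Mat[of f] by (simp add: Umat_def mmul_mone_left[OF emb_Mat])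
    then show ?thesis using u f act_sp by (simp add: B_def emb_act)
  qed
  have act_S: "act u f \<in> S \<longleftrightarrow> f \<in> S" if u: "u \<in> Umat p" and f: "f \<in> space P" for u f
    using act_B[OF that] act_sp f by (simp add: S_def D_def emb_act[OF u] gs_residual_Umat(2)[OF u])
  have emeasure_act: "emeasure P (act u -` A \<inter> space P) = emeasure P A" if u: "u \<in> Umat p" and A: "A \<in> sets P" for u A
  proof (rule emeasure_additive_vimage[OF finI, where T' = "act (adj u)" and B = B and A = A and T = "act u", folded P_def])
    show "act u \<in> measurable P P" by (rule act_meas)
    show "act u -` B \<inter> space P = B"
      using act_B[OF u] by (auto simp: B_def)
    fix x y assume y: "y \<in> space P"
    have "emb (\<lambda>i\<in>I. x i + y i) = (\<lambda>i j. emb x i j + emb y i j)"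
      by (auto simp: emb_def I_def fun_eq_iff)
    then have "mmul p u (emb (\<lambda>i\<in>I. x i + y i)) i j = mmul p u (emb x) i j + mmul p u (emb y) i j" for i j
      by (simp only: mmul_add_right)
    then show "act u (\<lambda>i\<in>I. x i + y i) = (\<lambda>i\<in>I. act u x i + act u y i)"
      by (auto simp: act_def fun_eq_iff)
    have "act u (act (adj u) y) = y"
    proof
      fix ij
      have "mmul p u (mmul p (adj u) (emb y)) = emb y"
        using u by (simp add: mmul_assoc[symmetric] Umat_def mmul_mone_left[OF emb_Mat])
      then show "act u (act (adj u) y) ij = y ij"
        using y unfolding act_app[of u] emb_act[OF adj_U[OF u]]
        by (cases ij) (auto simp: emb_def I_def sp extensional_def)
    qed
    then show "act (adj u) y \<in> space P \<and> act u (act (adj u) y) = y"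
      using act_sp by simp
  qed (use A B B_pos B_fin in simp_all)
  \<comment> \<open>The default value keeps \<open>g\<close> in \<open>Umat p\<close> everywhere;
    the uniform measure on \<open>S\<close> charges only \<open>S\<close>.\<close>
  define g where "g = (\<lambda>f. if f \<in> S then gs_mat p (emb f) else mone p)"
  have gs_U: "gs_mat p (emb f) \<in> Umat p" if "f \<in> S" for f
    using that by (intro gs_mat_Umat) (auto simp: S_def D_def)
  then have g_U: "g f \<in> Umat p" for f
    by (simp add: g_def mone_U)
  have g: "g \<in> measurable P R"
    unfolding R_def
  proof (rule measurable_restrict_space2)
    show "g \<in> space P \<rightarrow> Umat p" using g_U by auto
    show "g \<in> borel_measurable P"
    proof (rule borel_measurable_nmatI)
      fix i j
      have "(\<lambda>f. gs_mat p (emb f) i j) \<in> borel_measurable P"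
        unfolding gs_mat_def using gs_measurable(2)[where x = emb, OF emb_meas] by (cases "i < p \<and> j < p") auto
      then have "(\<lambda>f. if f \<in> S then gs_mat p (emb f) i j else mone p i j) \<in> borel_measurable P"
        using S by measurable
      then show "(\<lambda>f. g f i j) \<in> borel_measurable P" by (simp add: g_def if_distrib[of "\<lambda>x. x i j"])
    qed
  qed
  define \<nu> where "\<nu> = distr (uniform_measure P S) R g"
  have g': "g \<in> measurable (uniform_measure P S) R" using g by simp
  have sets_\<nu>: "sets \<nu> = sets R" and space_\<nu>: "space \<nu> = Umat p"
    by (simp_all add: \<nu>_def R_def space_restrict_space)
  have em: "emeasure \<nu> A = emeasure P (S \<inter> (g -` A \<inter> space P)) / emeasure P S" if "A \<in> sets R" for A
    unfolding \<nu>_def using that measurable_sets[OF g that] S by (simp add: emeasure_distr[OF g'])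
  have mm: "mmul p u \<in> measurable \<nu> \<nu>" if "u \<in> Umat p" for u
    unfolding measurable_cong_sets[OF sets_\<nu> sets_\<nu>] R_def
    using that borel_measurable_mmul
    by (intro measurable_restrict_space3) (auto simp: mmul_U)
  show ?thesis
  proof (intro exI, unfold haar_Umat_def, intro conjI ballI)
    show "sets \<nu> = sets (restrict_space borel (Umat p))" using sets_\<nu> by (simp add: R_def)
    have "Umat p \<in> sets R" by (metis sets.top sets_\<nu> space_\<nu>)
    moreover have "S \<inter> (g -` Umat p \<inter> space P) = S"
      using g_U sets.sets_into_space[OF S] by auto
    ultimately show "emeasure \<nu> (Umat p) = 1"
      using S_pos S_fin by (simp add: em ennreal_divide_self less_top)
    fix u :: "'f nmat" assume u: "u \<in> Umat p"
    show "distr \<nu> \<nu> (mmul p u) = \<nu>"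
    proof (rule measure_eqI)
      fix A assume "A \<in> sets (distr \<nu> \<nu> (mmul p u))"
      then have A: "A \<in> sets \<nu>" "A \<in> sets R" by (simp_all add: sets_\<nu>)
      have uA: "mmul p u -` A \<inter> space \<nu> \<in> sets R" using measurable_sets[OF mm[OF u] A(1)] by (simp add: sets_\<nu>)
      have SA: "S \<inter> (g -` A \<inter> space P) \<in> sets P" using S measurable_sets[OF g A(2)] by auto
      \<comment> \<open>Equivariance of Gram-Schmidt in terms of preimages; it reduces the claim to
        the invariance of Lebesgue measure under \<open>act u\<close>.\<close>
      have "S \<inter> (g -` (mmul p u -` A \<inter> space \<nu>) \<inter> space P) = act u -` (S \<inter> (g -` A \<inter> space P)) \<inter> space P"
        using act_S[OF u] act_sp gs_U by (auto simp: g_def emb_act[OF u] gs_mat_mmul[OF u] space_\<nu>)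
      then show "emeasure (distr \<nu> \<nu> (mmul p u)) A = emeasure \<nu> A"
        using emeasure_act[OF u SA] A uA by (simp add: emeasure_distr[OF mm[OF u]] em)
    qed simp
  qed
qed

section \<open>Differentiation under the integral sign\<close>

text \<open>Dominated convergence for the normalized first-order error \<open>G\<close>: by the mean
  value inequality on the convex set \<open>S\<close>, it is at most \<open>2 * C\<close>.\<close>

lemma has_vector_derivative_integral:
  fixes f :: "real \<Rightarrow> 'a \<Rightarrow> 'b::{banach, second_countable_topology}"
  assumes "finite_measure M" and S: "convex S" "t0 \<in> S"
    and deriv: "\<And>t k. t \<in> S \<Longrightarrow> k \<in> space M \<Longrightarrow> ((\<lambda>t. f t k) has_vector_derivative f' t k) (at t within S)"
    and bound: "\<And>t k. t \<in> S \<Longrightarrow> k \<in> space M \<Longrightarrow> norm (f' t k) \<le> C"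
    and f: "\<And>t. t \<in> S \<Longrightarrow> integrable M (f t)" and f': "f' t0 \<in> borel_measurable M"
  shows "((\<lambda>t. \<integral>k. f t k \<partial>M) has_vector_derivative (\<integral>k. f' t0 k \<partial>M)) (at t0 within S)"
proof -
  interpret finite_measure M by fact
  have int': "integrable M (f' t0)"
    using bound[OF S(2)] f' by (intro integrable_const_bound[where B = C]) auto
  define G where "G = (\<lambda>t k. (f t k - f t0 k - (t - t0) *\<^sub>R f' t0 k) /\<^sub>R norm (t - t0))"
  have G_lim: "((\<lambda>t. G t k) \<longlongrightarrow> 0) (at t0 within S)" if "k \<in> space M" for k
    using deriv[OF S(2) that] unfolding has_vector_derivative_def has_derivative_at_within G_def by simp
  have G_bound: "norm (G t k) \<le> 2 * C" if t: "t \<in> S" "t \<noteq> t0" and k: "k \<in> space M" for t k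
  proof -
    have C: "norm (f' s k) \<le> C" if "s \<in> S" for s using bound[OF that k] .
    have "norm (f t k - f t0 k) \<le> C * norm (t - t0)"
    proof (rule differentiable_bound[OF S(1)])
      show "((\<lambda>t. f t k) has_derivative (\<lambda>h. h *\<^sub>R f' s k)) (at s within S)" if "s \<in> S" for s
        using deriv[OF that k] by (simp add: has_vector_derivative_def)
      show "onorm (\<lambda>h. h *\<^sub>R f' s k) \<le> C" if "s \<in> S" for s
      proof (rule onorm_bound)
        show "0 \<le> C" using C[OF that] norm_ge_zero order_trans by blast
        show "norm (h *\<^sub>R f' s k) \<le> C * norm h" for h
          using mult_right_mono[OF C[OF that] abs_ge_zero[of h]] by (simp add: mult.commute)
      qed
    qed (use t S in auto)
    moreover have "norm ((t - t0) *\<^sub>R f' t0 k) \<le> C * norm (t - t0)"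
      using mult_right_mono[OF C[OF S(2)] abs_ge_zero[of "t - t0"]] by (simp add: mult.commute)
    ultimately have "norm (f t k - f t0 k - (t - t0) *\<^sub>R f' t0 k) \<le> 2 * C * norm (t - t0)"
      using norm_triangle_ineq4[of "f t k - f t0 k" "(t - t0) *\<^sub>R f' t0 k"] by linarith
    then show ?thesis using t by (simp add: G_def divide_inverse_commute[symmetric] pos_divide_le_eq)
  qed
  have G_int: "(\<integral>k. G t k \<partial>M) = ((\<integral>k. f t k \<partial>M) - (\<integral>k. f t0 k \<partial>M) - (t - t0) *\<^sub>R (\<integral>k. f' t0 k \<partial>M)) /\<^sub>R norm (t - t0)"
    if "t \<in> S" for t
    unfolding G_def using f[OF that] f[OF S(2)] int' by simp
  have "((\<lambda>t. \<integral>k. G t k \<partial>M) \<longlongrightarrow> 0) (at t0 within S)"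
    unfolding tendsto_at_iff_sequentially
  proof (intro allI impI)
    fix X :: "nat \<Rightarrow> real" assume X: "\<forall>i. X i \<in> S - {t0}" "X \<longlonglongrightarrow> t0"
    have "(\<lambda>n. \<integral>k. G (X n) k \<partial>M) \<longlonglongrightarrow> (\<integral>k. 0 \<partial>M)"
    proof (rule integral_dominated_convergence[where w = "\<lambda>_. 2 * C"])
      show "G (X n) \<in> borel_measurable M" for n
      proof -
        have "X n \<in> S" using X(1) by simp
        then show ?thesis unfolding G_def
          by (intro borel_measurable_scaleR borel_measurable_diff borel_measurable_const f'
              borel_measurable_integrable[OF f] S)
      qed
      show "AE k in M. (\<lambda>n. G (X n) k) \<longlonglongrightarrow> 0"
        using G_lim X unfolding tendsto_at_iff_sequentially by (auto simp: comp_def)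
      show "AE k in M. norm (G (X n) k) \<le> 2 * C" for n
        using G_bound[of "X n"] X(1) by auto
    qed auto
    then show "((\<lambda>t. \<integral>k. G t k \<partial>M) \<circ> X) \<longlonglongrightarrow> 0" by (simp add: comp_def)
  qed
  then have "((\<lambda>t. ((\<integral>k. f t k \<partial>M) - (\<integral>k. f t0 k \<partial>M) - (t - t0) *\<^sub>R (\<integral>k. f' t0 k \<partial>M)) /\<^sub>R norm (t - t0)) \<longlongrightarrow> 0) (at t0 within S)"
    by (rule Lim_transform_eventually) (auto simp: G_int eventually_at_filter)
  then show ?thesis
    unfolding has_vector_derivative_def has_derivative_at_within
    by (simp add: bounded_linear_scaleR_left)
qed

section \<open>Integration by parts on the unitary group\<close>

definition row_fun :: "nat \<Rightarrow> 'f::star_scalar nmat \<Rightarrow> 'f nmat \<Rightarrow> nat \<Rightarrow> (nat \<Rightarrow> 'f) \<Rightarrow> complex" where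
  "row_fun r c d l y = Complex (\<Sum>i<r. c l i \<bullet> y i) (\<Sum>i<r. d l i \<bullet> y i)"

text \<open>The matrices \<open>c\<close> and \<open>d\<close> represent the real and imaginary
  parts separately, which avoids complexifying the scalar field.\<close>

definition mat_fun :: "nat \<Rightarrow> nat \<Rightarrow> 'f::star_scalar nmat \<Rightarrow> 'f nmat \<Rightarrow> 'f nmat \<Rightarrow> complex" where
  "mat_fun q r c d k = Complex (frob q r c k) (frob q r d k)"

text \<open>The complex bilinear extension of \<open>frob\<close>, evaluated at
  \<open>c + i d\<close> in both arguments. It is the unnormalized variance of the limiting
  Gaussian.\<close>

definition csquare :: "nat \<Rightarrow> nat \<Rightarrow> 'f::star_scalar nmat \<Rightarrow> 'f nmat \<Rightarrow> complex" where
  "csquare q r c d = Complex (frob q r c c - frob q r d d) (2 * frob q r c d)"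

lemma mat_fun_eq_row_fun: "mat_fun q r c d k = (\<Sum>l<q. row_fun r c d l (k l))"
  by (simp add: complex_eq_iff mat_fun_def row_fun_def frob_def)

lemma row_fun_lin: "row_fun r c d l (\<lambda>i. t *\<^sub>R y i + s *\<^sub>R z i) = of_real t * row_fun r c d l y + of_real s * row_fun r c d l z"
  by (simp add: complex_eq_iff row_fun_def inner_add_right sum.distrib sum_distrib_left)

text \<open>As a function of \<open>\<beta>\<close> the functional is the inner product with
  \<open>a\<close> in its real part and with \<open>b\<close> in its imaginary part, so this is
  Parseval in the real basis of the scalars.\<close>

lemma sum_Basis_row_fun_square:
  fixes c d :: "'f::star_scalar nmat" and r l :: nat and k :: "nat \<Rightarrow> 'f"
  defines "a \<equiv> \<Sum>i<r. c l i * star (k i)" and "b \<equiv> \<Sum>i<r. d l i * star (k i)"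
  shows "(\<Sum>\<beta>\<in>Basis. (row_fun r c d l (\<lambda>i. \<beta> * k i))\<^sup>2) = Complex (a \<bullet> a - b \<bullet> b) (2 * (a \<bullet> b))"
proof -
  have "c l i \<bullet> (\<beta> * k i) = (c l i * star (k i)) \<bullet> \<beta>" for c :: "'f nmat" and i \<beta>
    by (metis inner_commute inner_mult_right_star)
  then have "row_fun r c d l (\<lambda>i. \<beta> * k i) = Complex (a \<bullet> \<beta>) (b \<bullet> \<beta>)" for \<beta>
    by (simp add: row_fun_def a_def b_def inner_sum_left)
  then show ?thesis
    by (simp add: complex_eq_iff euclidean_inner[of a a] euclidean_inner[of b b] euclidean_inner[of a b]
        sum_subtractf sum_distrib_left power2_eq_square mult.assoc)
qed

lemma sum_inner_Umat:
  fixes k :: "'f::star_scalar nmat"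
  assumes k: "k \<in> Umat p" and r: "r \<le> p"
  shows "(\<Sum>j<p. (\<Sum>i<r. c i * star (k j i)) \<bullet> (\<Sum>i<r. d i * star (k j i))) = (\<Sum>i<r. c i \<bullet> d i)"
proof -
  \<comment> \<open>The row vectors become matrices with all rows equal; \<open>frob 1\<close> picks
    row 0, and \<open>k^* k = 1\<close> does the rest.\<close>
  define C D where "C = (\<lambda>_::nat. c)" and "D = (\<lambda>_::nat. d)"
  have "(\<Sum>j<p. (\<Sum>i<r. c i * star (k j i)) \<bullet> (\<Sum>i<r. d i * star (k j i)))
      = frob 1 p (mmul r C (adj k)) (mmul r D (adj k))"
    by (simp add: frob_def mmul_def adj_def C_def D_def)
  also have "\<dots> = frob 1 r C (mmul r D (mmul p (adj k) k))"
    by (simp add: frob_mmul_right mmul_assoc)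
  also have "mmul p (adj k) k = mone p" using k by (simp add: Umat_def)
  also have "frob 1 r C (mmul r D (mone p)) = (\<Sum>i<r. c i \<bullet> d i)"
    using r by (simp add: frob_def mmul_def C_def D_def mone_def if_distrib[of "\<lambda>z. _ * z"] cong: if_cong)
  finally show ?thesis .
qed

text \<open>Orthonormality of the columns of \<open>k\<close> makes the full sum independent of
  \<open>k\<close>. This is what produces a constant variance in the differential equation.\<close>

lemma sum_row_fun_square:
  fixes k :: "'f::star_scalar nmat"
  assumes "k \<in> Umat p" "r \<le> p"
  shows "(\<Sum>l<q. \<Sum>j<p. \<Sum>\<beta>\<in>Basis. (row_fun r c d l (\<lambda>i. \<beta> * k j i))\<^sup>2) = csquare q r c d"
  unfolding sum_Basis_row_fun_square csquare_def
  by (simp add: complex_eq_iff sum_subtractf sum_distrib_left[symmetric] sum_inner_Umat[OF assms] frob_def)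

lemma sum_inner_square_le:
  fixes c k :: "nat \<Rightarrow> 'f::star_scalar"
  shows "(\<Sum>i<r. c i \<bullet> k i)\<^sup>2 \<le> (\<Sum>i<r. (norm (c i))\<^sup>2) * (\<Sum>i<r. (norm (k i))\<^sup>2)"
proof -
  have "\<bar>\<Sum>i<r. c i \<bullet> k i\<bar> \<le> (\<Sum>i<r. norm (c i) * norm (k i))"
    by (intro order_trans[OF sum_abs] sum_mono Cauchy_Schwarz_ineq2)
  then have "(\<Sum>i<r. c i \<bullet> k i)\<^sup>2 \<le> (\<Sum>i<r. norm (c i) * norm (k i))\<^sup>2"
    by (metis abs_ge_zero power2_abs power_mono)
  also have "\<dots> \<le> (\<Sum>i<r. (norm (c i))\<^sup>2) * (\<Sum>i<r. (norm (k i))\<^sup>2)"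
    by (rule Cauchy_Schwarz_ineq_sum)
  finally show ?thesis .
qed

lemma norm_row_fun_le:
  assumes "norm \<beta> = 1"
  shows "(norm (row_fun r c d l (\<lambda>i. \<beta> * k i)))\<^sup>2
    \<le> ((\<Sum>i<r. (norm (c l i))\<^sup>2) + (\<Sum>i<r. (norm (d l i))\<^sup>2)) * (\<Sum>i<r. (norm (k i))\<^sup>2)"
  using sum_inner_square_le[where c = "c l" and k = "\<lambda>i. \<beta> * k i" and r = r]
    sum_inner_square_le[where c = "d l" and k = "\<lambda>i. \<beta> * k i" and r = r] assms
  by (simp add: row_fun_def cmod_power2 norm_mult distrib_right)

section \<open>Measurability, integrability and invariance of integrals\<close>

locale haar_matrix =
  fixes p :: nat and \<nu> :: "'f::star_scalar nmat measure"
  assumes haar: "haar_Umat p \<nu>"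
begin

lemma space_eq: "space \<nu> = Umat p"
  using haar sets_eq_imp_space_eq[of \<nu> "restrict_space borel (Umat p)"]
  by (simp add: haar_Umat_def space_restrict_space)

sublocale finite_measure \<nu>
  by (rule finite_measureI) (use haar in \<open>simp add: haar_Umat_def space_eq\<close>)

lemma measure_space_1: "measure \<nu> (space \<nu>) = 1"
  using haar by (simp add: haar_Umat_def space_eq measure_def)

lemma entry_measurable: "(\<lambda>k. k i j) \<in> borel_measurable \<nu>"
proof -
  have "sets \<nu> = sets (restrict_space borel (Umat p))" using haar by (simp add: haar_Umat_def)
  from measurable_cong_sets[OF this refl] show ?thesis
    using measurable_restrict_space1[OF borel_measurable_entry] by blast
qed

lemma mmul_measurable:
  assumes "u \<in> Umat p" shows "mmul p u \<in> measurable \<nu> \<nu>"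
proof -
  have s: "sets \<nu> = sets (restrict_space borel (Umat p))" using haar by (simp add: haar_Umat_def)
  have "mmul p u \<in> measurable (restrict_space borel (Umat p)) (restrict_space borel (Umat p))"
    using assms borel_measurable_mmul by (intro measurable_restrict_space3) (auto simp: mmul_U)
  then show ?thesis using measurable_cong_sets[OF s s] by blast
qed

lemma integral_invariant:
  fixes f :: "'f nmat \<Rightarrow> 'b::{banach, second_countable_topology}"
  assumes "u \<in> Umat p" "f \<in> borel_measurable \<nu>"
  shows "(\<integral>k. f (mmul p u k) \<partial>\<nu>) = (\<integral>k. f k \<partial>\<nu>)"
proof -
  have "distr \<nu> \<nu> (mmul p u) = \<nu>" using haar assms(1) by (simp add: haar_Umat_def)
  then show ?thesis using integral_distr[OF mmul_measurable[OF assms(1)] assms(2)] by simp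
qed

lemma integrableI_bounded_Umat:
  fixes f :: "'f nmat \<Rightarrow> 'b::{banach, second_countable_topology}"
  assumes "f \<in> borel_measurable \<nu>" "\<And>k. k \<in> Umat p \<Longrightarrow> norm (f k) \<le> B"
  shows "integrable \<nu> f"
  using assms by (intro integrable_const_bound[where B = B]) (auto simp: space_eq)

lemma integrable_mult_bounded_Umat:
  fixes f g :: "'f nmat \<Rightarrow> 'b::{real_normed_algebra, banach, second_countable_topology}"
  assumes "f \<in> borel_measurable \<nu>" "\<And>k. k \<in> Umat p \<Longrightarrow> norm (f k) \<le> F"
    and "g \<in> borel_measurable \<nu>" "\<And>k. k \<in> Umat p \<Longrightarrow> norm (g k) \<le> G"
  shows "integrable \<nu> (\<lambda>k. f k * g k)"
proof (rule integrableI_bounded_Umat)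
  show "(\<lambda>k. f k * g k) \<in> borel_measurable \<nu>" using assms by (intro borel_measurable_times)
  show "norm (f k * g k) \<le> F * G" if "k \<in> Umat p" for k
    using assms(2,4)[OF that]
    by (intro order_trans[OF norm_mult_ineq] mult_mono) (auto intro: order_trans[OF norm_ge_zero])
qed

lemma row_fun_measurable: "(\<lambda>k. row_fun r c d l (\<lambda>i. \<beta> * k j i)) \<in> borel_measurable \<nu>"
proof -
  have "(\<lambda>k. \<Sum>i<r. c l i \<bullet> (\<beta> * k j i)) \<in> borel_measurable \<nu>" for c
    by (intro borel_measurable_sum borel_measurable_inner borel_measurable_times borel_measurable_const entry_measurable)
  then show ?thesis unfolding row_fun_def Complex_eq by measurable
qed

lemma frob_measurable: "frob q r c \<in> borel_measurable \<nu>"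
  unfolding frob_def
  by (intro borel_measurable_sum borel_measurable_inner borel_measurable_const entry_measurable)

lemma mat_fun_measurable: "mat_fun q r c d \<in> borel_measurable \<nu>"
  unfolding mat_fun_def Complex_eq using frob_measurable by measurable

end

text \<open>A crude bound for the functional on unitary matrices. It serves integrability and
  domination; the estimates that are sharp in \<open>p\<close> use \<open>frob\<close>
  instead.\<close>

definition entry_sum :: "nat \<Rightarrow> nat \<Rightarrow> 'f::star_scalar nmat \<Rightarrow> real" where
  "entry_sum q r c = (\<Sum>l<q. \<Sum>i<r. norm (c l i))"

lemma frob_le_entry_sum:
  assumes "k \<in> Umat p" shows "\<bar>frob q r c k\<bar> \<le> entry_sum q r c"
proof -
  have "\<bar>c l i \<bullet> k l i\<bar> \<le> norm (c l i)" for l i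
    using Umat_norm_entry[OF assms, of l i] Cauchy_Schwarz_ineq2[of "c l i" "k l i"]
    by (metis mult.commute mult_left_le norm_ge_zero order_trans)
  then show ?thesis
    unfolding frob_def entry_sum_def by (intro order_trans[OF sum_abs] sum_mono)
qed

lemma norm_mat_fun_le:
  assumes "k \<in> Umat p" shows "norm (mat_fun q r c d k) \<le> entry_sum q r c + entry_sum q r d"
proof -
  have "norm (mat_fun q r c d k) \<le> \<bar>frob q r c k\<bar> + \<bar>frob q r d k\<bar>"
    using cmod_le[of "mat_fun q r c d k"] by (simp add: mat_fun_def)
  then show ?thesis
    using frob_le_entry_sum[OF assms, of q r c] frob_le_entry_sum[OF assms, of q r d] by linarith
qed

lemma norm_row_fun_le_entry_sum:
  assumes k: "k \<in> Umat p" and b: "norm \<beta> = 1" and l: "l < q"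
  shows "norm (row_fun r c d l (\<lambda>i. \<beta> * k j i)) \<le> entry_sum q r c + entry_sum q r d"
proof -
  have *: "\<bar>\<Sum>i<r. c l i \<bullet> (\<beta> * k j i)\<bar> \<le> entry_sum q r c" for c
  proof -
    have "\<bar>c l i \<bullet> (\<beta> * k j i)\<bar> \<le> norm (c l i)" for i
      using Umat_norm_entry[OF k, of j i] Cauchy_Schwarz_ineq2[of "c l i" "\<beta> * k j i"] b
      by (metis mult.commute mult_left_le norm_ge_zero order_trans norm_mult mult_1)
    then have "\<bar>\<Sum>i<r. c l i \<bullet> (\<beta> * k j i)\<bar> \<le> (\<Sum>i<r. norm (c l i))"
      by (intro order_trans[OF sum_abs] sum_mono)
    also have "\<dots> \<le> entry_sum q r c"
      unfolding entry_sum_def using l by (intro member_le_sum) (auto intro: sum_nonneg)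
    finally show ?thesis .
  qed
  have "norm (row_fun r c d l (\<lambda>i. \<beta> * k j i)) \<le> \<bar>\<Sum>i<r. c l i \<bullet> (\<beta> * k j i)\<bar> + \<bar>\<Sum>i<r. d l i \<bullet> (\<beta> * k j i)\<bar>"
    unfolding row_fun_def by (rule order_trans[OF cmod_le]) simp
  then show ?thesis using *[of c] *[of d] by linarith
qed

section \<open>Differential equation from plane rotations\<close>

context haar_matrix
begin

text \<open>The integral in \<open>const\<close> does not depend on \<open>t\<close>, so its
  derivative at \<open>t = 0\<close> vanishes; there the integrand has derivative
  \<open>(s * B^2 - A) * exp (s * M)\<close>. Up to a factor \<open>s\<close>, the integrand is
  itself the \<open>t\<close>-derivative of the exponential, whence the second derivative.\<close>

lemma second_derivative_zero:
  fixes A B M :: "'f nmat \<Rightarrow> complex" and s :: real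
  assumes meas: "A \<in> borel_measurable \<nu>" "B \<in> borel_measurable \<nu>" "M \<in> borel_measurable \<nu>"
    and bd: "\<And>k. k \<in> Umat p \<Longrightarrow> norm (A k) \<le> K" "\<And>k. k \<in> Umat p \<Longrightarrow> norm (B k) \<le> K"
      "\<And>k. k \<in> Umat p \<Longrightarrow> norm (M k) \<le> K"
    and const: "\<And>t::real. (\<integral>k. (of_real (cos t) * B k - of_real (sin t) * A k) *
        exp (of_real s * (M k + (of_real (cos t) - 1) * A k + of_real (sin t) * B k)) \<partial>\<nu>) = X"
  shows "(\<integral>k. A k * exp (of_real s * M k) \<partial>\<nu>) = of_real s * (\<integral>k. (B k)\<^sup>2 * exp (of_real s * M k) \<partial>\<nu>)"
proof -
  \<comment> \<open>The angle is complex here, so that the field derivative rules apply before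
    restricting to real \<open>t\<close>.\<close>
  define h where "h = (\<lambda>z k. M k + (cos z - 1) * A k + sin z * B k)"
  define f where "f = (\<lambda>t k. (of_real (cos t) * B k - of_real (sin t) * A k) * exp (of_real s * h (of_real t) k))"
  define b where "b = (\<lambda>t k. of_real (cos t) * B k - of_real (sin t) * A k)"
  define a where "a = (\<lambda>t k. - of_real (sin t) * B k - of_real (cos t) * A k)"
  define f' where "f' = (\<lambda>t k. (a t k + of_real s * (b t k)\<^sup>2) * exp (of_real s * h (of_real t) k))"
  have h_m: "h z \<in> borel_measurable \<nu>" for z unfolding h_def using meas by measurable
  have a_m: "a t \<in> borel_measurable \<nu>" "b t \<in> borel_measurable \<nu>" for t
    unfolding a_def b_def using meas by measurable
  have K: "0 \<le> K" if "k \<in> Umat p" for k :: "'f nmat" using bd(1)[OF that] norm_ge_zero order_trans by blast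
  have mul: "norm (of_real x * z) \<le> K" if "\<bar>x\<bar> \<le> 1" "norm z \<le> K" for x and z :: complex
    using that mult_mono[of "\<bar>x\<bar>" 1 "norm z" K] by (simp add: norm_mult)
  have a_bd: "norm (a t k) \<le> 2 * K" "norm (b t k) \<le> 2 * K" if "k \<in> Umat p" for t k
    using norm_triangle_ineq4[of "- of_real (sin t) * B k" "of_real (cos t) * A k"]
      norm_triangle_ineq4[of "of_real (cos t) * B k" "of_real (sin t) * A k"]
      mul[of "sin t" "B k"] mul[of "cos t" "A k"] mul[of "cos t" "B k"] mul[of "sin t" "A k"] bd[OF that]
    by (simp_all add: a_def b_def)
  have h_bd: "norm (h (of_real t) k) \<le> 4 * K" if k: "k \<in> Umat p" for t k
  proof -
    have "h (of_real t) k = M k - A k + of_real (cos t) * A k + of_real (sin t) * B k"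
      by (simp add: h_def cos_of_real sin_of_real algebra_simps)
    then show ?thesis
      using norm_triangle_ineq[of "M k - A k + of_real (cos t) * A k" "of_real (sin t) * B k"]
        norm_triangle_ineq[of "M k - A k" "of_real (cos t) * A k"] norm_triangle_ineq4[of "M k" "A k"]
        mul[of "cos t" "A k"] mul[of "sin t" "B k"] bd[OF k] by simp
  qed
  have e_bd: "norm (exp (of_real s * h (of_real t) k)) \<le> exp (\<bar>s\<bar> * (4 * K))" if k: "k \<in> Umat p" for t k
    using norm_exp[of "of_real s * h (of_real t) k"] mult_left_mono[OF h_bd[OF k, of t], of "\<bar>s\<bar>"]
    by (auto simp: norm_mult intro: order_trans)
  have ab_bd: "norm (a t k + of_real s * (b t k)\<^sup>2) \<le> 2 * K + \<bar>s\<bar> * (2 * K)\<^sup>2" if k: "k \<in> Umat p" for t k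
  proof -
    have "norm (of_real s * (b t k)\<^sup>2) \<le> \<bar>s\<bar> * (2 * K)\<^sup>2"
      using power_mono[OF a_bd(2)[OF k, of t], of 2] unfolding norm_mult norm_power
      by (simp add: mult_left_mono)
    then show ?thesis using a_bd(1)[OF k, of t] norm_triangle_ineq[of "a t k" "of_real s * (b t k)\<^sup>2"] by linarith
  qed
  have "((\<lambda>t. \<integral>k. f t k \<partial>\<nu>) has_vector_derivative (\<integral>k. f' 0 k \<partial>\<nu>)) (at 0 within UNIV)"
  proof (rule has_vector_derivative_integral[where C = "(2 * K + \<bar>s\<bar> * (2 * K)\<^sup>2) * exp (\<bar>s\<bar> * (4 * K))"])
    show "finite_measure \<nu>" by (rule finite_measure_axioms)
    show "((\<lambda>t. f t k) has_vector_derivative f' t k) (at t within UNIV)" for t k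
    proof -
      have "((\<lambda>z. (cos z * B k - sin z * A k) * exp (of_real s * h z k)) has_field_derivative f' t k) (at (of_real t))"
        unfolding h_def f'_def a_def b_def
        by (auto intro!: derivative_eq_intros simp: cos_of_real[symmetric] sin_of_real[symmetric] power2_eq_square algebra_simps
            simp del: cos_of_real sin_of_real)
      from has_vector_derivative_real_field[OF this] show ?thesis
        by (simp add: f_def cos_of_real sin_of_real)
    qed
    show "norm (f' t k) \<le> (2 * K + \<bar>s\<bar> * (2 * K)\<^sup>2) * exp (\<bar>s\<bar> * (4 * K))" if "k \<in> space \<nu>" for t k
      using that ab_bd[of k t] e_bd[of k t] K unfolding f'_def norm_mult
      by (intro mult_mono) (auto simp: space_eq)
    show "f' 0 \<in> borel_measurable \<nu>" unfolding f'_def using a_m h_m by measurable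
    show "integrable \<nu> (f t)" for t
    proof (rule integrableI_bounded_Umat)
      show "f t \<in> borel_measurable \<nu>" unfolding f_def b_def[symmetric] using meas h_m by measurable
      show "norm (f t k) \<le> 2 * K * exp (\<bar>s\<bar> * (4 * K))" if "k \<in> Umat p" for k
        using that a_bd(2)[of k t] e_bd[of k t] K unfolding f_def norm_mult b_def
        by (intro mult_mono) auto
    qed
  qed auto
  moreover have "(\<lambda>t. \<integral>k. f t k \<partial>\<nu>) = (\<lambda>t. X)"
    using const unfolding f_def h_def by (simp add: cos_of_real sin_of_real)
  ultimately have "((\<lambda>t. X) has_vector_derivative (\<integral>k. f' 0 k \<partial>\<nu>)) (at 0)"
    by simp
  then have "(\<integral>k. f' 0 k \<partial>\<nu>) = 0"
    by (rule vector_derivative_unique_at[OF _ has_vector_derivative_const])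
  moreover have "f' 0 = (\<lambda>k. of_real s * ((B k)\<^sup>2 * exp (of_real s * M k)) - A k * exp (of_real s * M k))"
    by (auto simp: f'_def a_def b_def h_def algebra_simps)
  moreover have "integrable \<nu> (\<lambda>k. (B k)\<^sup>2 * exp (of_real s * M k))" "integrable \<nu> (\<lambda>k. A k * exp (of_real s * M k))"
  proof -
    have e: "norm (exp (of_real s * M k)) \<le> exp (\<bar>s\<bar> * (4 * K))" if "k \<in> Umat p" for k
      using e_bd[OF that, of 0] by (simp add: h_def)
    have em: "(\<lambda>k. exp (of_real s * M k)) \<in> borel_measurable \<nu>" using meas by measurable
    have B2: "norm ((B k)\<^sup>2) \<le> K\<^sup>2" if "k \<in> Umat p" for k
      using power_mono[OF bd(2)[OF that] norm_ge_zero, of 2] by (simp add: norm_power)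
    show "integrable \<nu> (\<lambda>k. (B k)\<^sup>2 * exp (of_real s * M k))"
      by (rule integrable_mult_bounded_Umat[OF _ B2 em e]) (use meas in measurable)
    show "integrable \<nu> (\<lambda>k. A k * exp (of_real s * M k))"
      by (rule integrable_mult_bounded_Umat[OF meas(1) bd(1) em e])
  qed
  ultimately show ?thesis by simp
qed

lemma exp_mat_fun:
  shows "(\<lambda>k. exp (of_real s * mat_fun q r c d k)) \<in> borel_measurable \<nu>"
    and "k \<in> Umat p \<Longrightarrow> norm (exp (of_real s * mat_fun q r c d k)) \<le> exp (\<bar>s\<bar> * (entry_sum q r c + entry_sum q r d))"
proof -
  show "(\<lambda>k. exp (of_real s * mat_fun q r c d k)) \<in> borel_measurable \<nu>"
    using mat_fun_measurable by measurable
  assume k: "k \<in> Umat p"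
  have "norm (exp (of_real s * mat_fun q r c d k)) \<le> exp (norm (of_real s * mat_fun q r c d k))"
    by (rule norm_exp)
  also have "\<dots> \<le> exp (\<bar>s\<bar> * (entry_sum q r c + entry_sum q r d))"
    using norm_mat_fun_le[OF k, of q r c d] by (simp add: norm_mult mult_left_mono)
  finally show "norm (exp (of_real s * mat_fun q r c d k)) \<le> exp (\<bar>s\<bar> * (entry_sum q r c + entry_sum q r d))" .
qed

lemma integrable_row_fun:
  assumes "l < q" "norm \<beta> = 1"
  shows "integrable \<nu> (\<lambda>k. (row_fun r c d l (\<lambda>i. \<beta> * k j i))\<^sup>2 * exp (of_real s * mat_fun q r c d k))"
    and "integrable \<nu> (\<lambda>k. row_fun r c d l (k l) * exp (of_real s * mat_fun q r c d k))"
proof -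
  let ?K = "entry_sum q r c + entry_sum q r d"
  have *: "norm ((row_fun r c d l (\<lambda>i. \<beta> * k j i))\<^sup>2) \<le> ?K\<^sup>2" if "k \<in> Umat p" for k
    using power_mono[where n = 2, OF norm_row_fun_le_entry_sum[OF that assms(2,1)] norm_ge_zero]
    unfolding norm_power .
  show "integrable \<nu> (\<lambda>k. (row_fun r c d l (\<lambda>i. \<beta> * k j i))\<^sup>2 * exp (of_real s * mat_fun q r c d k))"
    using row_fun_measurable by (intro integrable_mult_bounded_Umat[OF _ * exp_mat_fun] borel_measurable_power)
  show "integrable \<nu> (\<lambda>k. row_fun r c d l (k l) * exp (of_real s * mat_fun q r c d k))"
    using row_fun_measurable[of r c d l 1 l] norm_row_fun_le_entry_sum[where \<beta> = 1 and p = p and r = r and c = c and d = d and j = l, OF _ _ assms(1)]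
    by (intro integrable_mult_bounded_Umat[OF _ _ exp_mat_fun]) auto
qed

text \<open>Analogue of Gaussian integration by parts. The rotation mixes row \<open>l\<close> with
  row \<open>j\<close>, and \<open>q <= j\<close> keeps row \<open>j\<close> out of
  \<open>mat_fun\<close>, so the functional changes only by multiples of \<open>A\<close> and
  \<open>B\<close>.\<close>

lemma stein:
  assumes l: "l < q" and j: "q \<le> j" "j < p" and b: "norm \<beta> = 1"
  shows "(\<integral>k. row_fun r c d l (k l) * exp (of_real s * mat_fun q r c d k) \<partial>\<nu>)
    = of_real s * (\<integral>k. (row_fun r c d l (\<lambda>i. \<beta> * k j i))\<^sup>2 * exp (of_real s * mat_fun q r c d k) \<partial>\<nu>)"
proof -
  define A where "A = (\<lambda>k :: 'f nmat. row_fun r c d l (k l))"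
  define B where "B = (\<lambda>k :: 'f nmat. row_fun r c d l (\<lambda>i. \<beta> * k j i))"
  define M where "M = mat_fun q r c d"
  have lj: "l < p" "l \<noteq> j" using l j by auto
  have ss: "\<beta> * (star \<beta> * y) = y" for y
    using b by (simp add: mult.assoc[symmetric] mult_star_self)
  have meas: "A \<in> borel_measurable \<nu>" "B \<in> borel_measurable \<nu>" "M \<in> borel_measurable \<nu>"
    using row_fun_measurable[of r c d l 1 l] row_fun_measurable[of r c d l \<beta> j] mat_fun_measurable
    by (simp_all add: A_def B_def M_def)
  have "(\<integral>k. A k * exp (of_real s * M k) \<partial>\<nu>) = of_real s * (\<integral>k. (B k)\<^sup>2 * exp (of_real s * M k) \<partial>\<nu>)"
  proof (rule second_derivative_zero[OF meas, where K = "entry_sum q r c + entry_sum q r d"])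
    fix k :: "'f nmat" assume k: "k \<in> Umat p"
    show "norm (A k) \<le> entry_sum q r c + entry_sum q r d"
      using norm_row_fun_le_entry_sum[OF k, where \<beta> = 1 and l = l and q = q and r = r and c = c and d = d and j = l] l by (simp add: A_def)
    show "norm (B k) \<le> entry_sum q r c + entry_sum q r d"
      using norm_row_fun_le_entry_sum[OF k b l] by (simp add: B_def)
    show "norm (M k) \<le> entry_sum q r c + entry_sum q r d"
      unfolding M_def by (rule norm_mat_fun_le[OF k])
  next
    fix t :: real
    define \<rho> where "\<rho> = rot p l j \<beta> t"
    have rU: "\<rho> \<in> Umat p" unfolding \<rho>_def using lj j b by (intro rot_Umat)
    have B\<rho>: "B (mmul p \<rho> k) = of_real (cos t) * B k - of_real (sin t) * A k" for k
    proof -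
      have "(\<lambda>i. \<beta> * mmul p \<rho> k j i) = (\<lambda>i. cos t *\<^sub>R (\<beta> * k j i) + (- sin t) *\<^sub>R k l i)"
        using lj j by (simp add: \<rho>_def mmul_rot right_diff_distrib ss)
      from this[symmetric] show ?thesis
        unfolding B_def A_def
        using row_fun_lin[of r c d l "cos t" "\<lambda>i. \<beta> * k j i" "- sin t" "k l"] by simp
    qed
    have M\<rho>: "M (mmul p \<rho> k) = M k + (of_real (cos t) - 1) * A k + of_real (sin t) * B k" for k
    proof -
      have "M (mmul p \<rho> k) = (\<Sum>l'<q. row_fun r c d l' (k l') + (if l' = l then (of_real (cos t) - 1) * A k + of_real (sin t) * B k else 0))"
        unfolding M_def mat_fun_eq_row_fun
      proof (rule sum.cong[OF refl])
        fix l' assume l': "l' \<in> {..<q}"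
        show "row_fun r c d l' (mmul p \<rho> k l') = row_fun r c d l' (k l') +
          (if l' = l then (of_real (cos t) - 1) * A k + of_real (sin t) * B k else 0)"
        proof (cases "l' = l")
          case True
          have "mmul p \<rho> k l = (\<lambda>i. cos t *\<^sub>R k l i + sin t *\<^sub>R (\<beta> * k j i))"
            using lj j by (simp add: \<rho>_def mmul_rot fun_eq_iff)
          then show ?thesis using True
            by (simp add: row_fun_lin A_def B_def algebra_simps)
        next
          case False
          have "mmul p \<rho> k l' = k l'"
            using lj j l' False by (auto simp: \<rho>_def mmul_rot fun_eq_iff)
          then show ?thesis using False by simp
        qed
      qed
      then show ?thesis using l by (simp add: sum.distrib M_def mat_fun_eq_row_fun)
    qed
    have "(\<integral>k. (of_real (cos t) * B k - of_real (sin t) * A k) *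
        exp (of_real s * (M k + (of_real (cos t) - 1) * A k + of_real (sin t) * B k)) \<partial>\<nu>)
      = (\<integral>k. B (mmul p \<rho> k) * exp (of_real s * M (mmul p \<rho> k)) \<partial>\<nu>)"
      by (simp add: B\<rho> M\<rho>)
    also have "\<dots> = (\<integral>k. B k * exp (of_real s * M k) \<partial>\<nu>)"
      by (intro integral_invariant[OF rU, of "\<lambda>k. B k * exp (of_real s * M k)"]
          borel_measurable_times meas exp_mat_fun(1)[of s q r c d, folded M_def])
    finally show "(\<integral>k. (of_real (cos t) * B k - of_real (sin t) * A k) *
        exp (of_real s * (M k + (of_real (cos t) - 1) * A k + of_real (sin t) * B k)) \<partial>\<nu>)
      = (\<integral>k. B k * exp (of_real s * M k) \<partial>\<nu>)" .
  qed
  then show ?thesis by (simp add: A_def B_def M_def)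
qed

text \<open>The rows \<open>j < q\<close> of the full sum of squares. Both rows of such a rotation
  would be seen by the functional, so \<open>stein\<close> does not cover them.\<close>

definition remainder :: "nat \<Rightarrow> nat \<Rightarrow> 'f nmat \<Rightarrow> 'f nmat \<Rightarrow> real \<Rightarrow> complex" where
  "remainder q r c d s = (\<Sum>l<q. \<Sum>j<q. \<Sum>\<beta>\<in>Basis.
     \<integral>k. (row_fun r c d l (\<lambda>i. \<beta> * k j i))\<^sup>2 * exp (of_real s * mat_fun q r c d k) \<partial>\<nu>)"

text \<open>
  The left-hand side is a multiple of the derivative in \<open>s\<close> of the integral of
  \<open>exp (s * mat_fun q r c d k)\<close>. Without the remainder this would be the differential equation of
  a Gaussian.
\<close>

lemma integral_mat_fun_exp:
  assumes qp: "q \<le> p" and rp: "r \<le> p"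
  shows "of_real (real DIM('f) * real (p - q)) * (\<integral>k. mat_fun q r c d k * exp (of_real s * mat_fun q r c d k) \<partial>\<nu>)
    = of_real s * (csquare q r c d * (\<integral>k. exp (of_real s * mat_fun q r c d k) \<partial>\<nu>) - remainder q r c d s)"
proof -
  define e where "e = (\<lambda>k. exp (of_real s * mat_fun q r c d k))"
  define T where "T = (\<lambda>l j \<beta>. \<integral>k. (row_fun r c d l (\<lambda>i. \<beta> * k j i))\<^sup>2 * e k \<partial>\<nu>)"
  have int: "integrable \<nu> (\<lambda>k. (row_fun r c d l (\<lambda>i. \<beta> * k j i))\<^sup>2 * e k)" if "l < q" "\<beta> \<in> Basis" for l j \<beta>
    unfolding e_def using that by (intro integrable_row_fun) auto
  have "(\<Sum>l<q. \<Sum>j<p. \<Sum>\<beta>\<in>Basis. T l j \<beta>)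
      = (\<integral>k. (\<Sum>l<q. \<Sum>j<p. \<Sum>\<beta>\<in>Basis. (row_fun r c d l (\<lambda>i. \<beta> * k j i))\<^sup>2 * e k) \<partial>\<nu>)"
    unfolding T_def using int by (simp add: integral_sum)
  also have "\<dots> = (\<integral>k. csquare q r c d * e k \<partial>\<nu>)"
  proof (rule Bochner_Integration.integral_cong[OF refl])
    fix k assume "k \<in> space \<nu>"
    then have "k \<in> Umat p" by (simp add: space_eq)
    from sum_row_fun_square[OF this rp, where q = q and c = c and d = d]
    show "(\<Sum>l<q. \<Sum>j<p. \<Sum>\<beta>\<in>Basis. (row_fun r c d l (\<lambda>i. \<beta> * k j i))\<^sup>2 * e k) = csquare q r c d * e k"
      by (simp add: sum_distrib_right[symmetric])
  qed
  also have "\<dots> = csquare q r c d * (\<integral>k. e k \<partial>\<nu>)" by simp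
  finally have full: "(\<Sum>l<q. \<Sum>j<p. \<Sum>\<beta>\<in>Basis. T l j \<beta>) = csquare q r c d * (\<integral>k. e k \<partial>\<nu>)" .
  have split: "(\<Sum>j<p. f j) = (\<Sum>j<q. f j) + (\<Sum>j\<in>{q..<p}. f j)" for f :: "nat \<Rightarrow> complex"
    using sum.atLeastLessThan_concat[of 0 q p f] qp by (simp add: atLeast0LessThan)
  have "of_real s * (\<Sum>l<q. \<Sum>j\<in>{q..<p}. \<Sum>\<beta>\<in>Basis. T l j \<beta>)
      = (\<Sum>l<q. \<Sum>j\<in>{q..<p}. \<Sum>\<beta>\<in>(Basis :: 'f set). \<integral>k. row_fun r c d l (k l) * e k \<partial>\<nu>)"
    unfolding sum_distrib_left
    by (intro sum.cong refl) (simp add: T_def e_def stein[symmetric])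
  \<comment> \<open>By \<open>stein\<close> the summands depend neither on \<open>j\<close> nor on
    \<open>\<beta>\<close>, so each is counted \<open>DIM('f) * (p - q)\<close> times.\<close>
  also have "\<dots> = of_real (real DIM('f) * real (p - q)) * (\<Sum>l<q. \<integral>k. row_fun r c d l (k l) * e k \<partial>\<nu>)"
    by (simp add: sum_distrib_left mult.left_commute[of "of_nat (p - q)"] mult.assoc)
  also have "(\<Sum>l<q. \<integral>k. row_fun r c d l (k l) * e k \<partial>\<nu>) = (\<integral>k. mat_fun q r c d k * e k \<partial>\<nu>)"
    unfolding mat_fun_eq_row_fun sum_distrib_right
    by (rule Bochner_Integration.integral_sum[symmetric]) (use integrable_row_fun(2)[where q = q and \<beta> = 1] in \<open>simp add: e_def\<close>)
  finally have "of_real (real DIM('f) * real (p - q)) * (\<integral>k. mat_fun q r c d k * e k \<partial>\<nu>)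
      = of_real s * (\<Sum>l<q. \<Sum>j\<in>{q..<p}. \<Sum>\<beta>\<in>Basis. T l j \<beta>)" by simp
  moreover have "(\<Sum>l<q. \<Sum>j\<in>{q..<p}. \<Sum>\<beta>\<in>Basis. T l j \<beta>)
      = csquare q r c d * (\<integral>k. e k \<partial>\<nu>) - remainder q r c d s"
    unfolding full[symmetric] split sum.distrib by (simp add: remainder_def T_def e_def)
  ultimately show ?thesis by (simp add: e_def)
qed

text \<open>A uniform bound on the derivative requires a bounded range of \<open>s\<close>. The open
  interval (-2, 2) contains [0, 1], over which the equation is integrated later.\<close>

lemma has_vector_derivative_exp_mat_fun:
  assumes "\<bar>s\<bar> < 2"
  shows "((\<lambda>s. \<integral>k. exp (of_real s * mat_fun q r c d k) \<partial>\<nu>) has_vector_derivative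
    (\<integral>k. mat_fun q r c d k * exp (of_real s * mat_fun q r c d k) \<partial>\<nu>)) (at s)"
proof -
  let ?K = "entry_sum q r c + entry_sum q r d"
  have "((\<lambda>s. \<integral>k. exp (of_real s * mat_fun q r c d k) \<partial>\<nu>) has_vector_derivative
    (\<integral>k. mat_fun q r c d k * exp (of_real s * mat_fun q r c d k) \<partial>\<nu>)) (at s within {-2<..<2})"
  proof (rule has_vector_derivative_integral[where C = "?K * exp (2 * ?K)"])
    show "finite_measure \<nu>" by (rule finite_measure_axioms)
    show "((\<lambda>s. exp (of_real s * mat_fun q r c d k)) has_vector_derivative
        mat_fun q r c d k * exp (of_real t * mat_fun q r c d k)) (at t within {-2<..<2})" for t k
    proof (rule has_vector_derivative_real_field)
      show "((\<lambda>z. exp (z * mat_fun q r c d k)) has_field_derivative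
          mat_fun q r c d k * exp (of_real t * mat_fun q r c d k)) (at (of_real t))"
        by (auto intro!: derivative_eq_intros)
    qed
    show "norm (mat_fun q r c d k * exp (of_real t * mat_fun q r c d k)) \<le> ?K * exp (2 * ?K)"
      if "t \<in> {-2<..<2}" "k \<in> space \<nu>" for t k
    proof -
      have k: "k \<in> Umat p" using that by (simp add: space_eq)
      have "0 \<le> ?K" using norm_mat_fun_le[OF k] norm_ge_zero order_trans by blast
      then have "\<bar>t\<bar> * ?K \<le> 2 * ?K" using that by (intro mult_right_mono) auto
      then have "exp (\<bar>t\<bar> * ?K) \<le> exp (2 * ?K)" by simp
      then show ?thesis
        unfolding norm_mult using norm_mat_fun_le[OF k] exp_mat_fun(2)[OF k, of t q r c d] \<open>0 \<le> ?K\<close>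
        by (intro mult_mono) (auto intro: order_trans)
    qed
    show "integrable \<nu> (\<lambda>k. exp (of_real t * mat_fun q r c d k))" for t
      by (rule integrableI_bounded_Umat[OF exp_mat_fun])
    show "(\<lambda>k. mat_fun q r c d k * exp (of_real s * mat_fun q r c d k)) \<in> borel_measurable \<nu>"
      using mat_fun_measurable exp_mat_fun by (intro borel_measurable_times)
  qed (use assms in auto)
  moreover have "at s within {-2<..<2} = at s" using assms by (intro at_within_open) auto
  ultimately show ?thesis by simp
qed

end

section \<open>Moment bounds and Gaussian approximation\<close>

lemma mat_fun_mzero: "mat_fun q r c mzero k = of_real (frob q r c k)"
  by (simp add: mat_fun_def frob_def mzero_def complex_eq_iff)

lemma row_fun_mzero: "row_fun r c mzero l y = of_real (\<Sum>i<r. c l i \<bullet> y i)"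
  by (simp add: row_fun_def mzero_def complex_eq_iff)

lemma csquare_mzero: "csquare q r c mzero = of_real (frob q r c c)"
  by (simp add: csquare_def frob_def mzero_def complex_eq_iff)

lemma integral_cong_of_real:
  "(\<And>k. f k = complex_of_real (g k)) \<Longrightarrow> (\<integral>k. f k \<partial>M) = of_real (\<integral>k. g k \<partial>M)"
  by simp

context haar_matrix
begin

lemma exp_frob:
  shows "(\<lambda>k. exp (frob q r c k)) \<in> borel_measurable \<nu>"
    and "k \<in> Umat p \<Longrightarrow> norm (exp (frob q r c k)) \<le> exp (entry_sum q r c)"
    and "integrable \<nu> (\<lambda>k. exp (frob q r c k))"
proof -
  show m: "(\<lambda>k. exp (frob q r c k)) \<in> borel_measurable \<nu>"
    using frob_measurable by measurable
  show b: "k \<in> Umat p \<Longrightarrow> norm (exp (frob q r c k)) \<le> exp (entry_sum q r c)" for k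
    using frob_le_entry_sum[of k p q r c] by auto
  show "integrable \<nu> (\<lambda>k. exp (frob q r c k))"
    by (rule integrableI_bounded_Umat[OF m b])
qed

text \<open>Sub-Gaussian bound: for real functionals the remainder has a favourable sign.\<close>

lemma integral_exp_frob_le:
  assumes qp: "q < p" and rp: "r \<le> p"
  defines "N \<equiv> real DIM('f) * real (p - q)"
  shows "(\<integral>k. exp (frob q r c k) \<partial>\<nu>) \<le> exp (frob q r c c / (2 * N))"
proof -
  define \<Psi> where "\<Psi> = (\<lambda>s. \<integral>k. exp (s * frob q r c k) \<partial>\<nu>)"
  define \<Psi>' where "\<Psi>' = (\<lambda>s. \<integral>k. frob q r c k * exp (s * frob q r c k) \<partial>\<nu>)"
  define \<kappa> where "\<kappa> = frob q r c c / N"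
  have N: "N > 0" using qp by (simp add: N_def)
  have e: "exp (of_real s * mat_fun q r c mzero k) = of_real (exp (s * frob q r c k))" for s k
    by (simp add: mat_fun_mzero exp_of_real[symmetric])
  have \<Psi>: "(\<integral>k. exp (of_real s * mat_fun q r c mzero k) \<partial>\<nu>) = of_real (\<Psi> s)" for s
    unfolding \<Psi>_def by (rule integral_cong_of_real) (rule e)
  have \<Psi>': "(\<integral>k. mat_fun q r c mzero k * exp (of_real s * mat_fun q r c mzero k) \<partial>\<nu>) = of_real (\<Psi>' s)" for s
    unfolding \<Psi>'_def by (rule integral_cong_of_real) (simp only: e, simp only: mat_fun_mzero of_real_mult)
  have rem: "\<exists>R\<ge>0. remainder q r c mzero s = of_real R" for s
  proof (intro exI conjI)
    define R where "R = (\<Sum>l<q. \<Sum>j<q. \<Sum>\<beta>\<in>Basis.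
      \<integral>k. (\<Sum>i<r. c l i \<bullet> (\<beta> * k j i))\<^sup>2 * exp (s * frob q r c k) \<partial>\<nu>)"
    show "0 \<le> R" unfolding R_def by (intro sum_nonneg Bochner_Integration.integral_nonneg) auto
    have "(\<integral>k. (row_fun r c mzero l (\<lambda>i. \<beta> * k j i))\<^sup>2 * exp (of_real s * mat_fun q r c mzero k) \<partial>\<nu>)
      = of_real (\<integral>k. (\<Sum>i<r. c l i \<bullet> (\<beta> * k j i))\<^sup>2 * exp (s * frob q r c k) \<partial>\<nu>)" for l j \<beta>
      by (rule integral_cong_of_real) (simp only: e, simp only: row_fun_mzero of_real_mult of_real_power)
    then show "remainder q r c mzero s = of_real R"
      unfolding remainder_def R_def by simp
  qed
  have ineq: "\<Psi>' s \<le> \<kappa> * s * \<Psi> s" if "0 \<le> s" for s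
  proof -
    obtain R where R: "0 \<le> R" "remainder q r c mzero s = of_real R" using rem by blast
    have "complex_of_real (N * \<Psi>' s) = of_real (s * (frob q r c c * \<Psi> s - R))"
      using integral_mat_fun_exp[OF less_imp_le[OF qp] rp, of c mzero s]
      unfolding \<Psi> \<Psi>' R csquare_mzero N_def by simp
    then have "N * \<Psi>' s = s * (frob q r c c * \<Psi> s - R)" by (simp only: of_real_eq_iff)
    also have "\<dots> \<le> s * (frob q r c c * \<Psi> s)" using R that by (intro mult_left_mono) auto
    finally show ?thesis using N by (simp add: \<kappa>_def pos_le_divide_eq mult.commute mult.left_commute)
  qed
  have deriv: "(\<Psi> has_real_derivative \<Psi>' s) (at s)" if "\<bar>s\<bar> < 2" for s
  proof -
    have "((\<lambda>s. complex_of_real (\<Psi> s)) has_vector_derivative of_real (\<Psi>' s)) (at s)"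
      using has_vector_derivative_exp_mat_fun[OF that, of q r c mzero] unfolding \<Psi> \<Psi>' .
    from bounded_linear.has_vector_derivative[OF bounded_linear_Re this] show ?thesis
      by (simp add: has_real_derivative_iff_has_vector_derivative)
  qed
  \<comment> \<open>Integrating factor: the differential inequality says that \<open>g\<close> is
    nonincreasing on [0, 1].\<close>
  define g where "g = (\<lambda>s. \<Psi> s * exp (- \<kappa> * s\<^sup>2 / 2))"
  have "g 1 \<le> g 0"
  proof (rule DERIV_nonpos_imp_nonincreasing[where f = g and a = 0 and b = 1])
    fix s :: real assume s: "0 \<le> s" "s \<le> 1"
    have "(g has_real_derivative (\<Psi>' s - \<kappa> * s * \<Psi> s) * exp (- \<kappa> * s\<^sup>2 / 2)) (at s)"
      unfolding g_def using s by (auto intro!: derivative_eq_intros deriv simp: algebra_simps)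
    moreover have "(\<Psi>' s - \<kappa> * s * \<Psi> s) * exp (- \<kappa> * s\<^sup>2 / 2) \<le> 0"
      using ineq[OF s(1)] by (simp add: mult_le_0_iff)
    ultimately show "\<exists>y. (g has_real_derivative y) (at s) \<and> y \<le> 0" by blast
  qed simp
  moreover have "g 0 = 1" by (simp add: g_def \<Psi>_def measure_space_1)
  moreover have "g 1 = \<Psi> 1 / exp (\<kappa> / 2)" by (simp add: g_def exp_minus field_simps)
  ultimately have "\<Psi> 1 \<le> exp (\<kappa> / 2)" by (simp add: pos_divide_le_eq)
  then show ?thesis by (simp add: \<Psi>_def \<kappa>_def mult.commute)
qed

text \<open>Parallelogram identity with the square of the difference dropped.\<close>

lemma frob_add_self_le: "frob q r (\<lambda>l i. x l i + y l i) (\<lambda>l i. x l i + y l i) \<le> 2 * frob q r x x + 2 * frob q r y (y :: 'f nmat)"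
proof -
  have "frob q r (\<lambda>l i. x l i + y l i) (\<lambda>l i. x l i + y l i) + frob q r (\<lambda>l i. x l i - y l i) (\<lambda>l i. x l i - y l i)
    = 2 * frob q r x x + 2 * frob q r y y"
    by (simp add: frob_add_left frob_add_right frob_diff_left frob_diff_right)
  then show ?thesis using frob_self_nonneg[of q r "\<lambda>l i. x l i - y l i"] by linarith
qed

text \<open>A squared coordinate is bounded by exponentials,
  \<open>x^2 <= 2 * (exp x + exp (- x))\<close>. These shift the coefficients \<open>c\<close> in
  one entry, so the sub-Gaussian bound applies to the shifted functionals.\<close>

lemma integral_entry_exp_frob_le:
  assumes qp: "q < p" and rp: "r \<le> p" and j: "j < q" and i: "i < r"
  defines "N \<equiv> real DIM('f) * real (p - q)"
  shows "(\<integral>k. (norm (k j i))\<^sup>2 * exp (frob q r c k) \<partial>\<nu>) \<le> 4 * DIM('f) * exp (frob q r c c / N + 1) / N"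
    and "integrable \<nu> (\<lambda>k. (norm (k j i))\<^sup>2 * exp (frob q r c k))"
proof -
  have N: "N > 0" using qp by (simp add: N_def)
  \<comment> \<open>The natural scale: a shift of squared norm \<open>N\<close> costs only a
    constant in the sub-Gaussian exponent, the \<open>+ 1\<close> below, while the squared
    coordinate gains the factor \<open>N\<close>.\<close>
  define T where "T = sqrt N"
  have T: "T * T = N" using N by (simp add: T_def)
  have meas: "(\<lambda>k. b \<bullet> k j i) \<in> borel_measurable \<nu>" for b
    by (intro borel_measurable_inner borel_measurable_const entry_measurable)
  have bnd: "norm ((b \<bullet> k j i)\<^sup>2) \<le> 1" if "k \<in> Umat p" "b \<in> Basis" for b k
  proof -
    have "\<bar>b \<bullet> k j i\<bar> \<le> 1"
      using Cauchy_Schwarz_ineq2[of b "k j i"] Umat_norm_entry[OF that(1), of j i] that(2) by simp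
    then show ?thesis by (simp add: abs_square_le_1)
  qed
  have int: "integrable \<nu> (\<lambda>k. (b \<bullet> k j i)\<^sup>2 * exp (frob q r c k))" if "b \<in> Basis" for b
    by (intro integrable_mult_bounded_Umat[OF _ bnd[OF _ that] exp_frob(1,2)] borel_measurable_power meas)
  have one: "(\<integral>k. (b \<bullet> k j i)\<^sup>2 * exp (frob q r c k) \<partial>\<nu>) \<le> 4 * exp (frob q r c c / N + 1) / N"
    if b: "b \<in> Basis" for b
  proof -
    define E where "E = (\<lambda>\<epsilon> l i'. if l = j \<and> i' = i then (\<epsilon> * T) *\<^sub>R b else 0)"
    define D where "D = (\<lambda>\<epsilon> l i. c l i + E \<epsilon> l i)"
    have fE: "frob q r (E \<epsilon>) k = \<epsilon> * T * (b \<bullet> k j i)" for \<epsilon> k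
    proof -
      have "(\<Sum>i'<r. E \<epsilon> l i' \<bullet> k l i') = (if l = j then \<epsilon> * T * (b \<bullet> k j i) else 0)" for l
        using i by (cases "l = j") (simp_all add: E_def if_distrib[of "\<lambda>z. z \<bullet> _"] cong: if_cong)
      then show ?thesis using j by (simp add: frob_def)
    qed
    have "frob q r (E \<epsilon>) (E \<epsilon>) = \<epsilon>\<^sup>2 * N" for \<epsilon>
      unfolding fE using b T by (simp add: E_def inner_Basis power2_eq_square mult_ac)
    then have DD: "frob q r (D \<epsilon>) (D \<epsilon>) / (2 * N) \<le> frob q r c c / N + 1" if "\<epsilon>\<^sup>2 = 1" for \<epsilon>
      using frob_add_self_le[of q r c "E \<epsilon>"] N that by (simp add: D_def field_simps)
    have D: "(\<integral>k. exp (frob q r (D \<epsilon>) k) \<partial>\<nu>) \<le> exp (frob q r c c / N + 1)" if "\<epsilon>\<^sup>2 = 1" for \<epsilon>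
      using integral_exp_frob_le[OF qp rp, of "D \<epsilon>"] DD[OF that] unfolding N_def
      by (meson exp_le_cancel_iff order_trans)
    have sq: "x\<^sup>2 \<le> 2 * (exp x + exp (- x))" for x :: real
    proof -
      have "x\<^sup>2 \<le> 2 * exp \<bar>x\<bar>"
        using exp_lower_Taylor_quadratic[of "\<bar>x\<bar>"] abs_ge_zero[of x] unfolding power2_abs by linarith
      also have "exp \<bar>x\<bar> \<le> exp x + exp (- x)" by (cases "0 \<le> x") (simp_all add: less_imp_le)
      finally show ?thesis by simp
    qed
    have "N * (\<integral>k. (b \<bullet> k j i)\<^sup>2 * exp (frob q r c k) \<partial>\<nu>) = (\<integral>k. N * ((b \<bullet> k j i)\<^sup>2 * exp (frob q r c k)) \<partial>\<nu>)"
      by simp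
    also have "\<dots> \<le> (\<integral>k. 2 * (exp (frob q r (D 1) k) + exp (frob q r (D (-1)) k)) \<partial>\<nu>)"
    proof (rule integral_mono)
      show "integrable \<nu> (\<lambda>k. N * ((b \<bullet> k j i)\<^sup>2 * exp (frob q r c k)))" using int[OF b] by simp
      show "integrable \<nu> (\<lambda>k. 2 * (exp (frob q r (D 1) k) + exp (frob q r (D (-1)) k)))"
        using exp_frob(3) by simp
      fix k :: "'f nmat"
      have "N * ((b \<bullet> k j i)\<^sup>2 * exp (frob q r c k)) = (T * (b \<bullet> k j i))\<^sup>2 * exp (frob q r c k)"
        by (simp add: T[symmetric] power2_eq_square mult_ac)
      also have "\<dots> \<le> 2 * (exp (T * (b \<bullet> k j i)) + exp (- (T * (b \<bullet> k j i)))) * exp (frob q r c k)"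
        by (intro mult_right_mono sq) simp
      also have "\<dots> = 2 * (exp (frob q r (D 1) k) + exp (frob q r (D (-1)) k))"
        by (simp add: D_def frob_add_left fE exp_add exp_diff exp_minus divide_inverse algebra_simps)
      finally show "N * ((b \<bullet> k j i)\<^sup>2 * exp (frob q r c k)) \<le> 2 * (exp (frob q r (D 1) k) + exp (frob q r (D (-1)) k))" .
    qed
    also have "\<dots> = 2 * ((\<integral>k. exp (frob q r (D 1) k) \<partial>\<nu>) + (\<integral>k. exp (frob q r (D (-1)) k) \<partial>\<nu>))"
      using exp_frob(3) by simp
    also have "\<dots> \<le> 4 * exp (frob q r c c / N + 1)"
      using D[of 1] D[of "-1"] by simp
    finally show ?thesis using N by (simp add: pos_le_divide_eq mult.commute)
  qed
  have eq: "(norm (k j i))\<^sup>2 * exp (frob q r c k) = (\<Sum>b\<in>Basis. (b \<bullet> k j i)\<^sup>2 * exp (frob q r c k))" for k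
  proof -
    have "(norm y)\<^sup>2 = (\<Sum>b\<in>Basis. (b \<bullet> y)\<^sup>2)" for y :: 'f
      unfolding power2_norm_eq_inner by (subst euclidean_inner) (simp add: power2_eq_square inner_commute)
    then show ?thesis by (simp add: sum_distrib_right)
  qed
  show "integrable \<nu> (\<lambda>k. (norm (k j i))\<^sup>2 * exp (frob q r c k))"
    unfolding eq by (intro Bochner_Integration.integrable_sum int)
  have "(\<integral>k. (norm (k j i))\<^sup>2 * exp (frob q r c k) \<partial>\<nu>)
      = (\<Sum>b\<in>Basis. \<integral>k. (b \<bullet> k j i)\<^sup>2 * exp (frob q r c k) \<partial>\<nu>)"
    unfolding eq by (intro Bochner_Integration.integral_sum int)
  also have "\<dots> \<le> (\<Sum>b\<in>(Basis :: 'f set). 4 * exp (frob q r c c / N + 1) / N)"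
    by (intro sum_mono one)
  finally show "(\<integral>k. (norm (k j i))\<^sup>2 * exp (frob q r c k) \<partial>\<nu>) \<le> 4 * DIM('f) * exp (frob q r c c / N + 1) / N"
    by (simp add: mult_ac)
qed

text \<open>The modulus of the exponential depends only on \<open>s * c\<close>, and Cauchy-Schwarz
  reduces the squares to second moments of entries. Thus \<open>d\<close> contributes a factor but
  nothing to the exponent.\<close>

lemma norm_remainder_le:
  assumes qp: "q < p" and rp: "r \<le> p"
  defines "N \<equiv> real DIM('f) * real (p - q)"
  shows "norm (remainder q r c d s) \<le> (frob q r c c + frob q r d d) *
    (real q * real r * DIM('f) * (4 * DIM('f) * exp (s\<^sup>2 * frob q r c c / N + 1) / N))"
proof -
  define X where "X = 4 * DIM('f) * exp (s\<^sup>2 * frob q r c c / N + 1) / N"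
  define sc where "sc = (\<lambda>l i. s *\<^sub>R c l i)"
  define a where "a = (\<lambda>l. (\<Sum>i<r. (norm (c l i))\<^sup>2) + (\<Sum>i<r. (norm (d l i))\<^sup>2))"
  have a: "0 \<le> a l" for l by (auto simp: a_def intro!: add_nonneg_nonneg sum_nonneg)
  have T: "norm (\<integral>k. (row_fun r c d l (\<lambda>i. \<beta> * k j i))\<^sup>2 * exp (of_real s * mat_fun q r c d k) \<partial>\<nu>)
      \<le> a l * (real r * X)" if l: "l < q" and j: "j < q" and b: "\<beta> \<in> Basis" for l j \<beta>
  proof -
    have int: "integrable \<nu> (\<lambda>k. (norm (k j i))\<^sup>2 * exp (frob q r sc k))" if "i < r" for i
      using integral_entry_exp_frob_le(2)[OF qp rp j that] .
    have "norm (\<integral>k. (row_fun r c d l (\<lambda>i. \<beta> * k j i))\<^sup>2 * exp (of_real s * mat_fun q r c d k) \<partial>\<nu>)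
        \<le> (\<integral>k. a l * (\<Sum>i<r. (norm (k j i))\<^sup>2 * exp (frob q r sc k)) \<partial>\<nu>)"
    proof (rule order_trans[OF integral_norm_bound], rule integral_mono)
      show "integrable \<nu> (\<lambda>k. norm ((row_fun r c d l (\<lambda>i. \<beta> * k j i))\<^sup>2 * exp (of_real s * mat_fun q r c d k)))"
        using integrable_row_fun(1)[OF l, of \<beta>] b by simp
      show "integrable \<nu> (\<lambda>k. a l * (\<Sum>i<r. (norm (k j i))\<^sup>2 * exp (frob q r sc k)))"
        by (intro integrable_mult_right Bochner_Integration.integrable_sum int) simp
      fix k :: "'f nmat"
      have "norm (exp (of_real s * mat_fun q r c d k)) = exp (frob q r sc k)"
        by (simp add: norm_exp_eq_Re mat_fun_def sc_def frob_scaleR_left)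
      moreover have "(norm (row_fun r c d l (\<lambda>i. \<beta> * k j i)))\<^sup>2 \<le> a l * (\<Sum>i<r. (norm (k j i))\<^sup>2)"
        unfolding a_def using b by (intro norm_row_fun_le) simp
      ultimately show "norm ((row_fun r c d l (\<lambda>i. \<beta> * k j i))\<^sup>2 * exp (of_real s * mat_fun q r c d k))
          \<le> a l * (\<Sum>i<r. (norm (k j i))\<^sup>2 * exp (frob q r sc k))"
        by (simp add: norm_mult norm_power sum_distrib_right[symmetric] mult.assoc[symmetric] mult_right_mono)
    qed
    also have "\<dots> = a l * (\<Sum>i<r. \<integral>k. (norm (k j i))\<^sup>2 * exp (frob q r sc k) \<partial>\<nu>)"
      by (simp add: Bochner_Integration.integral_sum int)
    also have "\<dots> \<le> a l * (\<Sum>i<r. X)"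
    proof (intro mult_left_mono sum_mono a)
      fix i assume "i \<in> {..<r}"
      then have "(\<integral>k. (norm (k j i))\<^sup>2 * exp (frob q r sc k) \<partial>\<nu>) \<le> 4 * DIM('f) * exp (frob q r sc sc / N + 1) / N"
        unfolding N_def by (intro integral_entry_exp_frob_le(1)[OF qp rp j]) simp
      also have "frob q r sc sc = s\<^sup>2 * frob q r c c"
        by (simp add: sc_def frob_scaleR_left frob_scaleR_right power2_eq_square)
      finally show "(\<integral>k. (norm (k j i))\<^sup>2 * exp (frob q r sc k) \<partial>\<nu>) \<le> X" by (simp add: X_def)
    qed
    finally show ?thesis by simp
  qed
  have "norm (remainder q r c d s) \<le> (\<Sum>l<q. \<Sum>j<q. \<Sum>\<beta>\<in>(Basis :: 'f set). a l * (real r * X))"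
    unfolding remainder_def by (intro order_trans[OF norm_sum] sum_mono T) auto
  also have "\<dots> = (\<Sum>l<q. a l) * (real q * real r * DIM('f) * X)"
    by (simp add: sum_distrib_left sum_distrib_right mult_ac)
  also have "(\<Sum>l<q. a l) = frob q r c c + frob q r d d"
    by (simp add: a_def frob_self sum.distrib)
  finally show ?thesis by (simp add: X_def)
qed

text \<open>Variation of constants for the perturbed Gaussian equation. The right-hand side does not
  contain \<open>d\<close>: for \<open>c = 0\<close> the error is of order \<open>1 / N\<close> for
  every \<open>d\<close>, which is the source of uniform convergence.\<close>

theorem integral_exp_mat_fun_approx:
  assumes qp: "q < p" and rp: "r \<le> p"
  defines "N \<equiv> real DIM('f) * real (p - q)"
  shows "norm ((\<integral>k. exp (mat_fun q r c d k) \<partial>\<nu>) - exp (csquare q r c d / of_real (2 * N)))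
    \<le> 4 * (real DIM('f))\<^sup>2 * real q * real r * exp 1 / N * exp (2 * frob q r c c / N)"
proof -
  have N: "N > 0" using qp by (simp add: N_def)
  define K where "K = 4 * (real DIM('f))\<^sup>2 * real q * real r * exp 1 / N"
  define C D where "C = frob q r c c / N" and "D = frob q r d d / N"
  define \<sigma> where "\<sigma> = csquare q r c d / of_real N"
  have CD: "0 \<le> C" "0 \<le> D" using N by (auto simp: C_def D_def frob_self_nonneg)
  have K: "0 \<le> K" using N by (simp add: K_def)
  have Re\<sigma>: "Re \<sigma> = C - D" by (simp add: \<sigma>_def csquare_def C_def D_def diff_divide_distrib)
  define \<Phi> where "\<Phi> = (\<lambda>s. \<integral>k. exp (of_real s * mat_fun q r c d k) \<partial>\<nu>)"
  define \<Phi>' where "\<Phi>' = (\<lambda>s. \<integral>k. mat_fun q r c d k * exp (of_real s * mat_fun q r c d k) \<partial>\<nu>)"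
  define R where "R = (\<lambda>s. remainder q r c d s / of_real N)"
  have ode: "\<Phi>' s = of_real s * (\<sigma> * \<Phi> s - R s)" for s
  proof -
    have "of_real N * \<Phi>' s = of_real s * (csquare q r c d * \<Phi> s - remainder q r c d s)"
      unfolding \<Phi>'_def \<Phi>_def N_def by (rule integral_mat_fun_exp[OF less_imp_le[OF qp] rp])
    then show ?thesis using N by (simp add: \<sigma>_def R_def field_simps)
  qed
  have R: "norm (R s) \<le> (C + D) * (K * exp (s\<^sup>2 * C))" for s
  proof -
    have "norm (R s) = norm (remainder q r c d s) / N"
      using N by (simp add: R_def norm_divide)
    also have "\<dots> \<le> (frob q r c c + frob q r d d) *
      (real q * real r * DIM('f) * (4 * DIM('f) * exp (s\<^sup>2 * frob q r c c / N + 1) / N)) / N"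
      using divide_right_mono[OF norm_remainder_le[OF qp rp, of c d s, folded N_def] less_imp_le[OF N]] .
    also have "\<dots> = (C + D) * (K * exp (s\<^sup>2 * C))"
      by (simp add: C_def D_def K_def exp_add power2_eq_square add_divide_distrib[symmetric] mult_ac)
    finally show ?thesis .
  qed
  \<comment> \<open>The solution divided by its Gaussian model; only the remainder survives in
    \<open>h'\<close>.\<close>
  define h where "h = (\<lambda>s. \<Phi> s * exp (- (\<sigma> * of_real s ^ 2 / 2)))"
  define h' where "h' = (\<lambda>s. - (of_real s * R s * exp (- (\<sigma> * of_real s ^ 2 / 2))))"
  \<comment> \<open>A majorant with explicit primitive. The factor \<open>C + D\<close> of the
    remainder bound is the derivative of the exponent up to \<open>s\<close>, so it disappears on
    integration.\<close>
  define g where "g = (\<lambda>s. K * exp C * exp ((C + D) * s\<^sup>2 / 2))"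
  define g' where "g' = (\<lambda>s. K * exp C * ((C + D) * s * exp ((C + D) * s\<^sup>2 / 2)))"
  have h: "(h has_vector_derivative h' s) (at s)" if s: "\<bar>s\<bar> < 2" for s
  proof -
    have e: "((\<lambda>s. exp (- (\<sigma> * of_real s ^ 2 / 2))) has_vector_derivative
        - (\<sigma> * of_real s * exp (- (\<sigma> * of_real s ^ 2 / 2)))) (at s)"
    proof (rule has_vector_derivative_real_field)
      show "((\<lambda>z. exp (- (\<sigma> * z ^ 2 / 2))) has_field_derivative
          - (\<sigma> * of_real s * exp (- (\<sigma> * of_real s ^ 2 / 2)))) (at (of_real s))"
        by (auto intro!: derivative_eq_intros)
    qed
    have "(\<Phi> has_vector_derivative \<Phi>' s) (at s)"
      unfolding \<Phi>_def \<Phi>'_def by (rule has_vector_derivative_exp_mat_fun[OF s])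
    from has_vector_derivative_mult[OF this e] show ?thesis
      unfolding h_def h'_def by (simp add: ode algebra_simps)
  qed
  have g: "(g has_vector_derivative g' s) (at s)" for s
    unfolding g_def g'_def has_real_derivative_iff_has_vector_derivative[symmetric]
    by (auto intro!: derivative_eq_intros)
  have "norm (h 1 - h 0) \<le> g 1 - g 0"
  proof (rule differentiable_bound_general)
    show "continuous_on {0..1} h"
      by (intro continuous_at_imp_continuous_on ballI has_vector_derivative_continuous[OF h]) auto
    show "continuous_on {0..1} g"
      by (intro continuous_at_imp_continuous_on ballI has_vector_derivative_continuous[OF g])
    fix s :: real assume s: "0 < s" "s < 1"
    show "(h has_vector_derivative h' s) (at s)" using s by (intro h) auto
    show "(g has_vector_derivative g' s) (at s)" by (rule g)
    have "norm (h' s) = s * norm (R s) * exp (- ((C - D) * s\<^sup>2 / 2))"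
      using s by (simp add: h'_def norm_mult norm_exp_eq_Re Re\<sigma>)
    also have "\<dots> \<le> s * ((C + D) * (K * exp C)) * exp ((C + D) * s\<^sup>2 / 2)"
    proof (intro mult_mono)
      have "s\<^sup>2 * C \<le> 1 * C" using s CD by (intro mult_right_mono) (auto simp: power_le_one)
      then have "(C + D) * (K * exp (s\<^sup>2 * C)) \<le> (C + D) * (K * exp C)"
        using CD K by (intro mult_left_mono) auto
      then show "norm (R s) \<le> (C + D) * (K * exp C)" using R[of s] by linarith
      have "0 \<le> C * s\<^sup>2" using CD by simp
      then show "exp (- ((C - D) * s\<^sup>2 / 2)) \<le> exp ((C + D) * s\<^sup>2 / 2)"
        by (simp only: exp_le_cancel_iff) (simp add: field_simps)
    qed (use s CD K in auto)
    also have "\<dots> = g' s" by (simp add: g'_def mult_ac)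
    finally show "norm (h' s) \<le> g' s" .
  qed simp
  moreover have "h 0 = 1" by (simp add: h_def \<Phi>_def measure_space_1)
  moreover have "g 1 - g 0 \<le> K * exp C * exp ((C + D) / 2)" using K by (simp add: g_def)
  ultimately have h1: "norm (h 1 - 1) \<le> K * exp C * exp ((C + D) / 2)" by simp
  have "\<Phi> 1 = h 1 * exp (\<sigma> / 2)" by (simp add: h_def exp_minus)
  then have "norm (\<Phi> 1 - exp (\<sigma> / 2)) = norm ((h 1 - 1) * exp (\<sigma> / 2))" by (simp add: algebra_simps)
  also have "\<dots> = norm (h 1 - 1) * exp ((C - D) / 2)"
    by (simp add: norm_mult norm_exp_eq_Re Re\<sigma>)
  also have "\<dots> \<le> (K * exp C * exp ((C + D) / 2)) * exp ((C - D) / 2)"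
    using h1 by (intro mult_right_mono) auto
  also have "\<dots> = K * exp (C + (C + D) / 2 + (C - D) / 2)"
    by (simp add: exp_add mult.assoc)
  \<comment> \<open>Here \<open>D\<close> cancels: the growth of the majorant is compensated by the
    decay of the Gaussian.\<close>
  also have "C + (C + D) / 2 + (C - D) / 2 = 2 * C" by (simp add: field_simps)
  finally show ?thesis
    by (simp add: \<Phi>_def \<sigma>_def K_def C_def mult.commute)
qed

end

section \<open>Spherical functions\<close>

lemma borel_measurable_complex_exp:
  "f \<in> borel_measurable M \<Longrightarrow> (\<lambda>x. exp (f x) :: complex) \<in> borel_measurable M"
  by (rule measurable_compose[OF _ borel_measurable_continuous_onI[OF continuous_on_exp[OF continuous_on_id]]])

lemma mat_fun_add: "mat_fun n m (\<lambda>i j. c i j + c' i j) (\<lambda>i j. d i j + d' i j) k = mat_fun n m c d k + mat_fun n m c' d' k"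
  by (simp add: mat_fun_def frob_add_left complex_eq_iff)

lemma mat_fun_mmul: "mat_fun n m (mmul n u c) (mmul n u d) k = mat_fun n m c d (mmul n (adj u) k)"
  by (simp add: mat_fun_def frob_mmul_left)

section \<open>Spherical functions as averaged exponentials\<close>

context haar_matrix
begin

lemma pair_measurable:
  "(\<lambda>z. frob n m c (mmul p (adj (snd z)) (mmul p v (fst z)))) \<in> borel_measurable (\<nu> \<Otimes>\<^sub>M \<nu>)"
proof -
  have "(\<lambda>z. fst z i j) \<in> borel_measurable (\<nu> \<Otimes>\<^sub>M \<nu>)" "(\<lambda>z. snd z i j) \<in> borel_measurable (\<nu> \<Otimes>\<^sub>M \<nu>)" for i j
    by (rule measurable_compose[OF measurable_fst entry_measurable] measurable_compose[OF measurable_snd entry_measurable])+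
  then show ?thesis
    unfolding frob_def mmul_def adj_def
    by (intro borel_measurable_sum borel_measurable_inner borel_measurable_times borel_measurable_star borel_measurable_const)
qed

lemma pair_fubini:
  assumes v: "v \<in> Umat p"
  shows "(\<integral>l. \<integral>k. exp (mat_fun n m a b k) * exp (mat_fun n m c d (mmul p (adj l) (mmul p v k))) \<partial>\<nu> \<partial>\<nu>)
    = (\<integral>k. \<integral>l. exp (mat_fun n m a b k) * exp (mat_fun n m c d (mmul p (adj l) (mmul p v k))) \<partial>\<nu> \<partial>\<nu>)"
proof -
  interpret P: pair_sigma_finite \<nu> \<nu> ..
  interpret PP: finite_measure "\<nu> \<Otimes>\<^sub>M \<nu>"
    by (rule finite_measure_pair_measure[OF finite_measure_axioms finite_measure_axioms])
  define f where "f = (\<lambda>z. exp (mat_fun n m a b (fst z)) * exp (mat_fun n m c d (mmul p (adj (snd z)) (mmul p v (fst z)))))"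
  have m1: "(\<lambda>z. exp (mat_fun n m a b (fst z))) \<in> borel_measurable (\<nu> \<Otimes>\<^sub>M \<nu>)"
    using measurable_compose[OF measurable_fst exp_mat_fun(1)[of 1 n m a b]] by simp
  have m2: "(\<lambda>z. exp (mat_fun n m c d (mmul p (adj (snd z)) (mmul p v (fst z))))) \<in> borel_measurable (\<nu> \<Otimes>\<^sub>M \<nu>)"
  proof -
    have "(\<lambda>z. mat_fun n m c d (mmul p (adj (snd z)) (mmul p v (fst z)))) \<in> borel_measurable (\<nu> \<Otimes>\<^sub>M \<nu>)"
      unfolding mat_fun_def Complex_eq
      using pair_measurable[of n m c v] pair_measurable[of n m d v] by measurable
    then show ?thesis by (rule borel_measurable_complex_exp)
  qed
  have "integrable (\<nu> \<Otimes>\<^sub>M \<nu>) f"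
  proof (rule PP.integrable_const_bound)
    show "f \<in> borel_measurable (\<nu> \<Otimes>\<^sub>M \<nu>)" unfolding f_def by (intro borel_measurable_times m1 m2)
    have "norm (f z) \<le> exp (entry_sum n m a + entry_sum n m b) * exp (entry_sum n m c + entry_sum n m d)"
      if "z \<in> space (\<nu> \<Otimes>\<^sub>M \<nu>)" for z
    proof -
      have z: "fst z \<in> Umat p" "snd z \<in> Umat p" using that by (auto simp: space_pair_measure space_eq)
      then have "mmul p (adj (snd z)) (mmul p v (fst z)) \<in> Umat p" by (intro mmul_U adj_U v)
      then show ?thesis
        using exp_mat_fun(2)[OF z(1), of 1 n m a b] exp_mat_fun(2)[of _ 1 n m c d]
        unfolding f_def norm_mult by (intro mult_mono) auto
    qed
    then show "AE z in \<nu> \<Otimes>\<^sub>M \<nu>. norm (f z) \<le> exp (entry_sum n m a + entry_sum n m b) * exp (entry_sum n m c + entry_sum n m d)"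
      by auto
  qed
  then have "integrable (\<nu> \<Otimes>\<^sub>M \<nu>) (case_prod (\<lambda>k l. f (k, l)))" by simp
  from P.Fubini_integral[OF this] show ?thesis by (simp add: f_def)
qed

lemma integral_exp_mmul_left:
  assumes "u \<in> Umat p"
  shows "(\<integral>k. exp (mat_fun n m c d (mmul p u k)) \<partial>\<nu>) = (\<integral>k. exp (mat_fun n m c d k) \<partial>\<nu>)"
  using integral_invariant[OF assms, of "\<lambda>k. exp (mat_fun n m c d k)"] exp_mat_fun(1)[of 1 n m c d] by simp

lemma adj_measurable: "(\<lambda>k. exp (mat_fun n m c d (adj k))) \<in> borel_measurable \<nu>"
proof -
  have "(\<lambda>k. frob n m c (adj k)) \<in> borel_measurable \<nu>" for c
    unfolding frob_def adj_def
    by (intro borel_measurable_sum borel_measurable_inner borel_measurable_star borel_measurable_const entry_measurable)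
  then have "(\<lambda>k. mat_fun n m c d (adj k)) \<in> borel_measurable \<nu>"
    unfolding mat_fun_def Complex_eq by measurable
  then show ?thesis by (rule borel_measurable_complex_exp)
qed

lemma integral_exp_adj_mmul:
  assumes w: "w \<in> Umat p"
  shows "(\<integral>l. exp (mat_fun n m c d (mmul p (adj l) w)) \<partial>\<nu>) = (\<integral>l. exp (mat_fun n m c d (adj l)) \<partial>\<nu>)"
proof -
  have "(\<integral>l. exp (mat_fun n m c d (mmul p (adj l) w)) \<partial>\<nu>) = (\<integral>l. exp (mat_fun n m c d (adj (mmul p (adj w) l))) \<partial>\<nu>)"
    by (simp add: adj_mmul)
  then show ?thesis using integral_invariant[OF adj_U[OF w] adj_measurable] by simp
qed

text \<open>Invariance under inversion. In the double integral of the function at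
  \<open>l^* k\<close>, integrating over \<open>k\<close> removes \<open>l\<close>, and integrating
  over \<open>l\<close> removes \<open>k\<close> and leaves the value at \<open>l^*\<close>.\<close>

lemma integral_exp_adj: "(\<integral>l. exp (mat_fun n m c d (adj l)) \<partial>\<nu>) = (\<integral>k. exp (mat_fun n m c d k) \<partial>\<nu>)"
proof -
  \<comment> \<open>With zero coefficients the first exponential in \<open>pair_fubini\<close> is
    1.\<close>
  have 0: "mat_fun n m mzero mzero k = 0" for k :: "'f nmat"
    by (simp add: mat_fun_def frob_def mzero_def complex_eq_iff)
  have U: "k \<in> Umat p \<Longrightarrow> mmul p (mone p) k = k" for k :: "'f nmat"
    by (simp add: Umat_def mmul_mone_left[of k p p])
  have "(\<integral>k. exp (mat_fun n m c d k) \<partial>\<nu>)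
    = (\<integral>l. (\<integral>k. exp (mat_fun n m c d (mmul p (adj l) (mmul p (mone p) k))) \<partial>\<nu>) \<partial>\<nu>)"
  proof -
    have inner: "(\<integral>k. exp (mat_fun n m c d (mmul p (adj l) (mmul p (mone p) k))) \<partial>\<nu>) = (\<integral>k. exp (mat_fun n m c d k) \<partial>\<nu>)"
      if "l \<in> Umat p" for l
      using integral_exp_mmul_left[OF mmul_U[OF adj_U[OF that] mone_U], of n m c d] by (simp add: mmul_assoc)
    have "(\<integral>l. (\<integral>k. exp (mat_fun n m c d (mmul p (adj l) (mmul p (mone p) k))) \<partial>\<nu>) \<partial>\<nu>)
        = (\<integral>l. (\<integral>k. exp (mat_fun n m c d k) \<partial>\<nu>) \<partial>\<nu>)"
      by (rule Bochner_Integration.integral_cong[OF refl]) (simp add: inner space_eq)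
    then show ?thesis by (simp add: measure_space_1)
  qed
  also have "\<dots> = (\<integral>k. (\<integral>l. exp (mat_fun n m c d (mmul p (adj l) (mmul p (mone p) k))) \<partial>\<nu>) \<partial>\<nu>)"
    using pair_fubini[OF mone_U, of n m mzero mzero c d] by (simp add: 0)
  also have "\<dots> = (\<integral>k. (\<integral>l. exp (mat_fun n m c d (adj l)) \<partial>\<nu>) \<partial>\<nu>)"
    by (rule Bochner_Integration.integral_cong[OF refl]) (simp add: space_eq U integral_exp_adj_mmul)
  finally show ?thesis by (simp add: measure_space_1)
qed

text \<open>Pairing \<open>x C^*\<close> with \<open>k\<close> is pairing \<open>C\<close> with
  \<open>k^* x\<close>, so the exponent is \<Lambda>(k^* x) for the functional \<Lambda> with real
  part given by \<open>C\<close> and imaginary part given by \<open>D\<close>.\<close>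

definition sph :: "nat \<Rightarrow> 'f nmat \<Rightarrow> 'f nmat \<Rightarrow> 'f nmat \<Rightarrow> complex" where
  "sph q C D x = (\<integral>k. exp (mat_fun p p (mmul q x (adj C)) (mmul q x (adj D)) k) \<partial>\<nu>)"

lemma sph_mmul:
  assumes "u \<in> Umat p" shows "sph q C D (mmul p u x) = sph q C D x"
  unfolding sph_def mmul_assoc mat_fun_mmul by (rule integral_exp_mmul_left[OF adj_U[OF assms]])

text \<open>The exponent is additive in the matrix argument, so the integrand factors. After
  exchanging the integrals, the inner one over \<open>l\<close> no longer depends on
  \<open>u^* k\<close>, by left invariance and invariance under inversion.\<close>

lemma sph_mult:
  assumes u: "u \<in> Umat p"
  shows "sph q C D x * sph q C D y = (\<integral>l. sph q C D (madd x (mmul p (mmul p u l) y)) \<partial>\<nu>)"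
proof -
  let ?e = "\<lambda>x k. exp (mat_fun p p (mmul q x (adj C)) (mmul q x (adj D)) k)"
  have "sph q C D (madd x (mmul p (mmul p u l) y)) = (\<integral>k. ?e x k * ?e y (mmul p (adj l) (mmul p (adj u) k)) \<partial>\<nu>)" for l
    unfolding sph_def madd_def mmul_add_left mat_fun_add exp_add mmul_assoc mat_fun_mmul adj_mmul ..
  then have "(\<integral>l. sph q C D (madd x (mmul p (mmul p u l) y)) \<partial>\<nu>)
      = (\<integral>k. \<integral>l. ?e x k * ?e y (mmul p (adj l) (mmul p (adj u) k)) \<partial>\<nu> \<partial>\<nu>)"
    using pair_fubini[OF adj_U[OF u]] by simp
  also have "\<dots> = (\<integral>k. ?e x k * sph q C D y \<partial>\<nu>)"
  proof (rule Bochner_Integration.integral_cong[OF refl])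
    fix k assume "k \<in> space \<nu>"
    then have "mmul p (adj u) k \<in> Umat p" using u by (simp add: space_eq mmul_U adj_U)
    then show "(\<integral>l. ?e x k * ?e y (mmul p (adj l) (mmul p (adj u) k)) \<partial>\<nu>) = ?e x k * sph q C D y"
      by (simp add: integral_exp_adj_mmul integral_exp_adj sph_def)
  qed
  also have "\<dots> = sph q C D x * sph q C D y" by (simp add: sph_def)
  finally show ?thesis by simp
qed

lemma continuous_sph: "continuous_on UNIV (sph q C D)"
proof (rule continuous_at_imp_continuous_on, intro ballI, rule continuous_at_sequentiallyI)
  fix x and X :: "nat \<Rightarrow> 'f nmat" assume X: "X \<longlonglongrightarrow> x"
  have ent: "(\<lambda>n. X n i j) \<longlonglongrightarrow> x i j" for i j
    using continuous_on_tendsto_compose[OF continuous_on_entry[of UNIV i j] X] by simp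
  have mm: "(\<lambda>n. mmul q (X n) (adj E) i j) \<longlonglongrightarrow> mmul q x (adj E) i j" for E i j
    unfolding mmul_def by (intro tendsto_intros ent)
  have "(\<lambda>n. frob p p (mmul q (X n) (adj E)) k) \<longlonglongrightarrow> frob p p (mmul q x (adj E)) k" for E k
    unfolding frob_def by (intro tendsto_intros mm)
  then have lim: "(\<lambda>n. exp (mat_fun p p (mmul q (X n) (adj C)) (mmul q (X n) (adj D)) k))
      \<longlonglongrightarrow> exp (mat_fun p p (mmul q x (adj C)) (mmul q x (adj D)) k)" for k
    unfolding mat_fun_def Complex_eq by (intro tendsto_intros)
  \<comment> \<open>A convergent sequence of bounds is bounded, which supplies the constant
    dominating function.\<close>
  have "(\<lambda>n. entry_sum p p (mmul q (X n) (adj C)) + entry_sum p p (mmul q (X n) (adj D)))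
      \<longlonglongrightarrow> entry_sum p p (mmul q x (adj C)) + entry_sum p p (mmul q x (adj D))"
    unfolding entry_sum_def by (intro tendsto_intros mm)
  from convergent_imp_Bseq[OF convergentI[OF this]]
  obtain B where "\<forall>n. norm (entry_sum p p (mmul q (X n) (adj C)) + entry_sum p p (mmul q (X n) (adj D))) \<le> B"
    by (rule BseqE)
  then have B: "norm (entry_sum p p (mmul q (X n) (adj C)) + entry_sum p p (mmul q (X n) (adj D))) \<le> B" for n ..
  show "(\<lambda>n. sph q C D (X n)) \<longlonglongrightarrow> sph q C D x"
    unfolding sph_def
  proof (rule integral_dominated_convergence[where w = "\<lambda>_. exp B"])
    show "(\<lambda>k. exp (mat_fun p p c d k)) \<in> borel_measurable \<nu>" for c d
      using exp_mat_fun(1)[of 1 p p c d] by simp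
    then show "(\<lambda>k. exp (mat_fun p p c d k)) \<in> borel_measurable \<nu>" for c d .
    show "AE k in \<nu>. norm (exp (mat_fun p p (mmul q (X n) (adj C)) (mmul q (X n) (adj D)) k)) \<le> exp B" for n
    proof (rule AE_I2)
      fix k assume "k \<in> space \<nu>"
      then have "norm (exp (mat_fun p p (mmul q (X n) (adj C)) (mmul q (X n) (adj D)) k))
          \<le> exp (entry_sum p p (mmul q (X n) (adj C)) + entry_sum p p (mmul q (X n) (adj D)))"
        using exp_mat_fun(2)[of k 1] by (simp add: space_eq)
      also have "\<dots> \<le> exp B" using B[of n] by simp
      finally show "norm (exp (mat_fun p p (mmul q (X n) (adj C)) (mmul q (X n) (adj D)) k)) \<le> exp B" .
    qed
  qed (use lim in auto)
qed

lemma sph_zero: "sph q C D mzero = 1"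
proof -
  have "mat_fun p p (mmul q mzero (adj C)) (mmul q mzero (adj D)) k = 0" for k
    by (simp add: mat_fun_def mmul_def mzero_def frob_def complex_eq_iff)
  then show ?thesis by (simp add: sph_def measure_space_1)
qed

text \<open>By polar decomposition the square root is \<open>v x\<close> with \<open>v\<close>
  unitary, and \<open>sph\<close> does not see \<open>v\<close>.\<close>

lemma lift_sph:
  assumes "q \<le> p" "x \<in> Mat p q"
  shows "lift_PSD p q (sph q C D) (x, u) = sph q C D x"
proof -
  obtain v where "v \<in> Umat p" "psd_sqrt q (mmul p (adj x) x) = mmul p v x"
    using psd_sqrt_polar[OF assms(2,1)] .
  then show ?thesis by (simp add: lift_PSD_def sph_mmul)
qed

section \<open>Transfer to the pair of groups\<close>

definition haar_Kp :: "('f nmat \<times> 'f nmat) measure" where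
  "haar_Kp = distr \<nu> (restrict_space borel (Kp p)) (\<lambda>k. (mzero, k))"

lemma embed_measurable: "(\<lambda>k. (mzero :: 'f nmat, k)) \<in> measurable \<nu> (restrict_space borel (Kp p))"
proof (rule measurable_restrict_space2)
  show "(\<lambda>k. (mzero, k)) \<in> space \<nu> \<rightarrow> Kp p" by (auto simp: space_eq Kp_def)
  have "(\<lambda>k :: 'f nmat. k) \<in> borel_measurable \<nu>" by (rule borel_measurable_nmatI) (rule entry_measurable)
  from borel_measurable_Pair[OF borel_measurable_const[of "mzero :: 'f nmat"] this]
  show "(\<lambda>k. (mzero :: 'f nmat, k)) \<in> borel_measurable \<nu>" .
qed

lemma snd_measurable: "snd \<in> measurable (restrict_space borel (Kp p :: ('f nmat \<times> 'f nmat) set)) borel"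
  by (intro measurable_restrict_space1 borel_measurable_continuous_onI continuous_on_snd continuous_on_id)

lemma normalized_haar_Kp: "normalized_haar (Gp p q) (Kp p) haar_Kp"
  unfolding normalized_haar_def
proof (intro conjI ballI)
  let ?R = "restrict_space borel (Kp p :: ('f nmat \<times> 'f nmat) set)"
  have sp: "space ?R = Kp p" by (simp add: space_restrict_space)
  show "sets haar_Kp = sets (restrict_space borel (Kp p))" by (simp add: haar_Kp_def)
  have top: "Kp p \<in> sets ?R" by (metis sets.top sp)
  have em: "emeasure haar_Kp A = emeasure \<nu> ((\<lambda>k. (mzero, k)) -` A \<inter> space \<nu>)" if "A \<in> sets ?R" for A
    unfolding haar_Kp_def using that by (rule emeasure_distr[OF embed_measurable])
  have "(\<lambda>k. (mzero, k)) -` Kp p \<inter> space \<nu> = Umat p" by (auto simp: space_eq Kp_def)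
  then show "emeasure haar_Kp (Kp p) = 1" using em[OF top] haar by (simp add: haar_Umat_def)
  fix k :: "'f nmat \<times> 'f nmat" and A assume k: "k \<in> Kp p" and "A \<in> sets haar_Kp"
  then have A: "A \<in> sets ?R" by (simp add: haar_Kp_def)
  obtain u where [simp]: "k = (mzero, u)" and u: "u \<in> Umat p" using k by (auto simp: Kp_def)
  have AK: "A \<subseteq> Kp p" using sets.sets_into_space[OF A] by (simp add: sp)
  have mult: "k \<otimes>\<^bsub>Gp p q\<^esub> (mzero, v) = (mzero, mmul p u v)" for v
    by (simp add: Gp_def madd_def mmul_def mzero_def)
  have inv: "mmul p u (mmul p (adj u) v) = v" "mmul p (adj u) (mmul p u v) = v" if "v \<in> Umat p" for v
    using u that by (simp_all add: mmul_assoc[symmetric] Umat_def mmul_mone_left[of v p p])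
  \<comment> \<open>Left translation by the inverse of \<open>k\<close>. It turns the image in the
    definition of invariance into a preimage, which is measurable and fits image measures.\<close>
  define g where "g = (\<lambda>z :: 'f nmat \<times> 'f nmat. (mzero :: 'f nmat, mmul p (adj u) (snd z)))"
  have g: "g \<in> measurable ?R ?R"
  proof (rule measurable_restrict_space2)
    show "g \<in> space ?R \<rightarrow> Kp p" unfolding sp using u by (auto simp: g_def Kp_def mmul_U adj_U)
    show "g \<in> borel_measurable ?R" unfolding g_def
      by (intro borel_measurable_Pair borel_measurable_const measurable_compose[OF snd_measurable borel_measurable_mmul])
  qed
  have image: "(\<lambda>x. k \<otimes>\<^bsub>Gp p q\<^esub> x) ` A = g -` A \<inter> space ?R"
    unfolding sp
  proof (intro equalityI subsetI)
    fix z assume "z \<in> (\<lambda>x. k \<otimes>\<^bsub>Gp p q\<^esub> x) ` A"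
    then obtain v where v: "(mzero, v) \<in> A" "v \<in> Umat p" "z = (mzero, mmul p u v)"
      using AK mult by (fastforce simp: Kp_def)
    then show "z \<in> g -` A \<inter> Kp p" using u by (simp add: g_def inv Kp_def mmul_U)
  next
    fix z assume "z \<in> g -` A \<inter> Kp p"
    then obtain w where w: "z = (mzero, w)" "w \<in> Umat p" "(mzero, mmul p (adj u) w) \<in> A"
      by (auto simp: g_def Kp_def)
    have "z = k \<otimes>\<^bsub>Gp p q\<^esub> (mzero, mmul p (adj u) w)" unfolding mult using w inv by simp
    then show "z \<in> (\<lambda>x. k \<otimes>\<^bsub>Gp p q\<^esub> x) ` A" using w(3) by (rule image_eqI)
  qed
  have "emeasure haar_Kp ((\<lambda>x. k \<otimes>\<^bsub>Gp p q\<^esub> x) ` A)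
      = emeasure \<nu> ((\<lambda>k. (mzero, k)) -` (g -` A \<inter> space ?R) \<inter> space \<nu>)"
    unfolding image by (rule em[OF measurable_sets[OF g A]])
  also have "(\<lambda>k. (mzero, k)) -` (g -` A \<inter> space ?R) \<inter> space \<nu>
      = mmul p (adj u) -` ((\<lambda>k. (mzero, k)) -` A \<inter> space \<nu>) \<inter> space \<nu>"
    unfolding sp using u by (auto simp: g_def space_eq Kp_def mmul_U adj_U)
  also have "emeasure \<nu> \<dots> = emeasure (distr \<nu> \<nu> (mmul p (adj u))) ((\<lambda>k. (mzero, k)) -` A \<inter> space \<nu>)"
    by (rule emeasure_distr[symmetric, OF mmul_measurable[OF adj_U[OF u]] measurable_sets[OF embed_measurable A]])
  also have "distr \<nu> \<nu> (mmul p (adj u)) = \<nu>" using haar adj_U[OF u] by (simp add: haar_Umat_def)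
  also have "emeasure \<nu> ((\<lambda>k. (mzero, k)) -` A \<inter> space \<nu>) = emeasure haar_Kp A" by (rule em[OF A, symmetric])
  finally show "emeasure haar_Kp ((\<lambda>x. k \<otimes>\<^bsub>Gp p q\<^esub> x) ` A) = emeasure haar_Kp A" .
qed

theorem spherical_sph:
  assumes qp: "q \<le> p" shows "spherical_fun p q (sph q C D)"
  unfolding spherical_fun_def spherical_def
proof (intro conjI ballI exI)
  let ?f = "lift_PSD p q (sph q C D)"
  have lift: "?f g = sph q C D (fst g)" if "fst g \<in> Mat p q" for g
    using lift_sph[OF qp that] by (metis prod.collapse)
  have Mat_add: "madd x (mmul p u y) \<in> Mat p q" if "x \<in> Mat p q" "y \<in> Mat p q" "u \<in> Umat p" for x y u :: "'f nmat"
    using that mmul_Mat[of u p p y q] by (auto simp: Umat_def Mat_def madd_def)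
  have "continuous_on (carrier (Gp p q)) (\<lambda>g :: 'f nmat \<times> 'f nmat. sph q C D (fst g))"
    by (rule continuous_on_compose2[OF continuous_sph]) (auto intro: continuous_on_fst continuous_on_id)
  then show "continuous_on (carrier (Gp p q)) ?f"
    by (rule continuous_on_cong[THEN iffD1, rotated 2]) (auto simp: lift Gp_def)
  have zero: "mmul p u mzero = (mzero :: 'f nmat)" "madd x mzero = x" "madd mzero x = x" for u x :: "'f nmat"
    by (simp_all add: mmul_def mzero_def madd_def)
  \<comment> \<open>Multiplication by \<open>l\<close> on the right changes only the unitary
    component, and \<open>k\<close> on the left acts on the matrix component by a unitary
    matrix.\<close>
  show "?f (k \<otimes>\<^bsub>Gp p q\<^esub> g \<otimes>\<^bsub>Gp p q\<^esub> l) = ?f g"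
    if k: "k \<in> Kp p" and l: "l \<in> Kp p" and g: "g \<in> carrier (Gp p q)" for k l g
  proof -
    obtain u v x w where [simp]: "k = (mzero, u)" "l = (mzero, v)" "g = (x, w)"
      and u: "u \<in> Umat p" and x: "x \<in> Mat p q"
      using k l g by (auto simp: Kp_def Gp_def)
    have "mmul p u x \<in> Mat p q" using u x by (auto simp: Umat_def intro: mmul_Mat)
    then show ?thesis using x sph_mmul[OF u] by (simp add: Gp_def zero lift)
  qed
  show "\<exists>g\<in>carrier (Gp p q). ?f g \<noteq> 0"
  proof
    have m: "(mzero :: 'f nmat) \<in> Mat p q" by (simp add: Mat_def mzero_def)
    then show "(mzero :: 'f nmat, mone p) \<in> carrier (Gp p q)" by (simp add: Gp_def mone_U)
    show "?f (mzero :: 'f nmat, mone p) \<noteq> 0" using m by (simp add: lift sph_zero)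
  qed
  show "normalized_haar (Gp p q) (Kp p) haar_Kp" by (rule normalized_haar_Kp)
  fix g h :: "'f nmat \<times> 'f nmat" assume gh: "g \<in> carrier (Gp p q)" "h \<in> carrier (Gp p q)"
  obtain x u y v where [simp]: "g = (x, u)" "h = (y, v)"
    and xy: "x \<in> Mat p q" "u \<in> Umat p" "y \<in> Mat p q" using gh by (auto simp: Gp_def)
  define F where "F = (\<lambda>z. ?f (g \<otimes>\<^bsub>Gp p q\<^esub> z \<otimes>\<^bsub>Gp p q\<^esub> h))"
  have F: "F z = sph q C D (madd x (mmul p (mmul p u (snd z)) y))" if z: "z \<in> Kp p" for z
  proof -
    obtain k where [simp]: "z = (mzero, k)" and k: "k \<in> Umat p" using z by (auto simp: Kp_def)
    show ?thesis using Mat_add[OF xy(1,3) mmul_U[OF xy(2) k]]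
      by (simp add: F_def Gp_def zero lift)
  qed
  have "(\<lambda>z. sph q C D (madd x (mmul p (mmul p u (snd z)) y))) \<in> borel_measurable (restrict_space borel (Kp p))"
  proof (rule measurable_compose[OF _ borel_measurable_continuous_onI[OF continuous_sph]])
    have "(\<lambda>k. madd x (mmul p (mmul p u k) y)) \<in> borel_measurable borel"
    proof (rule borel_measurable_nmatI)
      fix i j
      show "(\<lambda>k. madd x (mmul p (mmul p u k) y) i j) \<in> borel_measurable borel"
        unfolding madd_def mmul_def
        by (intro borel_measurable_add borel_measurable_sum borel_measurable_times borel_measurable_const borel_measurable_entry)
    qed
    from measurable_compose[OF snd_measurable this]
    show "(\<lambda>z. madd x (mmul p (mmul p u (snd z)) y)) \<in> measurable (restrict_space borel (Kp p)) borel" .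
  qed
  then have Fm: "F \<in> borel_measurable (restrict_space borel (Kp p))"
    by (rule measurable_cong[THEN iffD1, rotated]) (simp add: F space_restrict_space)
  have "?f g * ?f h = (\<integral>k. sph q C D (madd x (mmul p (mmul p u k) y)) \<partial>\<nu>)"
    using xy sph_mult[OF xy(2), of q C D x y] by (simp add: lift)
  also have "\<dots> = (\<integral>k. F (mzero, k) \<partial>\<nu>)"
    by (rule Bochner_Integration.integral_cong[OF refl]) (simp add: F space_eq Kp_def)
  also have "\<dots> = (\<integral>z. F z \<partial>haar_Kp)"
    unfolding haar_Kp_def by (rule integral_distr[symmetric, OF embed_measurable Fm])
  finally show "?f g * ?f h = (\<integral>z. ?f (g \<otimes>\<^bsub>Gp p q\<^esub> z \<otimes>\<^bsub>Gp p q\<^esub> h) \<partial>haar_Kp)"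
    by (simp add: F_def)
qed

text \<open>For real part zero the integrand is a unimodular function turning differences into
  quotients, and the first component of \<open>g_j^{-1} g_i\<close> is a unitary multiple of the
  difference of those of \<open>g_i\<close> and \<open>g_j\<close>. The double sum is therefore the
  integral of a squared modulus.\<close>

theorem positive_definite_sph:
  assumes qp: "q \<le> p" shows "pos_def_fun p q (sph q mzero D)"
  unfolding pos_def_fun_def positive_definite_def
proof (intro allI impI)
  fix n :: nat and g :: "nat \<Rightarrow> 'f nmat \<times> 'f nmat" and c :: "nat \<Rightarrow> complex"
  assume g: "\<forall>i<n. g i \<in> carrier (Gp p q)"
  define \<theta> where "\<theta> = (\<lambda>i k. frob p p (mmul q (fst (g i)) (adj D)) k)"
  have 0: "mmul q x (adj mzero) = (mzero :: 'f nmat)" for x :: "'f nmat"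
    by (simp add: mmul_def adj_def mzero_def)
  have lift: "lift_PSD p q (sph q mzero D) (inv\<^bsub>Gp p q\<^esub> (g j) \<otimes>\<^bsub>Gp p q\<^esub> g i)
      = (\<integral>k. cis (\<theta> i k) * cnj (cis (\<theta> j k)) \<partial>\<nu>)" if ij: "i < n" "j < n" for i j
  proof -
    obtain x u where gi [simp]: "g i = (x, u)" by (rule prod.exhaust)
    obtain y v where gj [simp]: "g j = (y, v)" by (rule prod.exhaust)
    have "g i \<in> carrier (Gp p q)" "g j \<in> carrier (Gp p q)" using g ij by blast+
    then have xu: "x \<in> Mat p q" "u \<in> Umat p" "y \<in> Mat p q" "v \<in> Umat p"
      by (simp_all add: Gp_def)
    define h where "h = (\<lambda>i j. - mmul p (adj v) y i j, adj v)"
    have vy: "mmul p (adj v) y \<in> Mat p q" "mmul p (adj v) x \<in> Mat p q"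
      using xu by (auto simp: Umat_def intro!: mmul_Mat adj_Mat)
    have "inv\<^bsub>Gp p q\<^esub> (g j) = h"
    proof (rule group.inv_equality[OF group_Gp])
      show "h \<otimes>\<^bsub>Gp p q\<^esub> g j = \<one>\<^bsub>Gp p q\<^esub>"
        using xu by (simp add: h_def Gp_def Umat_def madd_def mzero_def)
      show "g j \<in> carrier (Gp p q)" using g ij by blast
      show "h \<in> carrier (Gp p q)" using vy adj_U[OF xu(4)] by (simp add: h_def Gp_def) (simp add: Mat_def)
    qed
    then have "inv\<^bsub>Gp p q\<^esub> (g j) \<otimes>\<^bsub>Gp p q\<^esub> g i = (mmul p (adj v) (\<lambda>i j. x i j - y i j), mmul p (adj v) u)"
      by (simp add: h_def Gp_def madd_def mmul_diff_right)
    moreover have "mmul p (adj v) (\<lambda>i j. x i j - y i j) \<in> Mat p q"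
      unfolding mmul_diff_right using vy by (simp add: Mat_def)
    ultimately have "lift_PSD p q (sph q mzero D) (inv\<^bsub>Gp p q\<^esub> (g j) \<otimes>\<^bsub>Gp p q\<^esub> g i) = sph q mzero D (\<lambda>i j. x i j - y i j)"
      using lift_sph[OF qp] sph_mmul[OF adj_U[OF xu(4)]] by simp
    also have "\<dots> = (\<integral>k. cis (\<theta> i k) * cnj (cis (\<theta> j k)) \<partial>\<nu>)"
    proof -
      have "exp (Complex 0 t) = cis t" for t by (simp add: cis_conv_exp Complex_eq)
      then show ?thesis
        unfolding sph_def mmul_diff_left 0 mat_fun_def \<theta>_def frob_diff_left
        by (simp add: frob_def[of p p mzero] mzero_def cis_cnj cis_mult)
    qed
    finally show ?thesis .
  qed
  have \<theta>_meas: "(\<lambda>k. cis (\<theta> i k)) \<in> borel_measurable \<nu>" for i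
  proof -
    have "(\<lambda>k. exp (\<i> * of_real (\<theta> i k))) \<in> borel_measurable \<nu>"
      unfolding \<theta>_def using frob_measurable by measurable
    then show ?thesis by (simp add: cis_conv_exp)
  qed
  have int: "integrable \<nu> (\<lambda>k. c i * cnj (c j) * (cis (\<theta> i k) * cnj (cis (\<theta> j k))))" for i j
  proof (rule integrableI_bounded_Umat)
    show "(\<lambda>k. c i * cnj (c j) * (cis (\<theta> i k) * cnj (cis (\<theta> j k)))) \<in> borel_measurable \<nu>"
      using \<theta>_meas[of i] measurable_compose[OF \<theta>_meas[of j] borel_measurable_continuous_onI[OF continuous_on_cnj[OF continuous_on_id]]]
      by (intro borel_measurable_times borel_measurable_const)
    show "norm (c i * cnj (c j) * (cis (\<theta> i k) * cnj (cis (\<theta> j k)))) \<le> norm (c i) * norm (c j)" for k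
      by (simp add: norm_mult)
  qed
  have "(\<Sum>i<n. \<Sum>j<n. c i * cnj (c j) * lift_PSD p q (sph q mzero D) (inv\<^bsub>Gp p q\<^esub> (g j) \<otimes>\<^bsub>Gp p q\<^esub> g i))
      = (\<Sum>i<n. \<Sum>j<n. (\<integral>k. c i * cnj (c j) * (cis (\<theta> i k) * cnj (cis (\<theta> j k))) \<partial>\<nu>))"
    by (intro sum.cong refl) (simp add: lift)
  also have "\<dots> = (\<integral>k. (\<Sum>i<n. \<Sum>j<n. c i * cnj (c j) * (cis (\<theta> i k) * cnj (cis (\<theta> j k)))) \<partial>\<nu>)"
    using int by (simp add: Bochner_Integration.integral_sum)
  also have "\<dots> = (\<integral>k. of_real ((norm (\<Sum>i<n. c i * cis (\<theta> i k)))\<^sup>2) \<partial>\<nu>)"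
  proof (rule Bochner_Integration.integral_cong[OF refl])
    fix k
    have "(\<Sum>i<n. \<Sum>j<n. c i * cnj (c j) * (cis (\<theta> i k) * cnj (cis (\<theta> j k))))
        = (\<Sum>i<n. c i * cis (\<theta> i k)) * cnj (\<Sum>i<n. c i * cis (\<theta> i k))"
      by (simp only: cnj_sum complex_cnj_mult sum_product) (intro sum.cong refl, simp only: mult_ac)
    then show "(\<Sum>i<n. \<Sum>j<n. c i * cnj (c j) * (cis (\<theta> i k) * cnj (cis (\<theta> j k))))
        = of_real ((norm (\<Sum>i<n. c i * cis (\<theta> i k)))\<^sup>2)"
      unfolding complex_norm_square .
  qed
  also have "\<dots> = of_real (\<integral>k. (norm (\<Sum>i<n. c i * cis (\<theta> i k)))\<^sup>2 \<partial>\<nu>)"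
    by (rule integral_complex_of_real)
  also have "\<dots> \<in> \<real>\<^sub>\<ge>\<^sub>0"
    unfolding nonneg_Reals_of_real_iff by (intro Bochner_Integration.integral_nonneg) simp
  finally show "(\<Sum>i<n. \<Sum>j<n. c i * cnj (c j) * lift_PSD p q (sph q mzero D) (inv\<^bsub>Gp p q\<^esub> (g j) \<otimes>\<^bsub>Gp p q\<^esub> g i)) \<in> \<real>\<^sub>\<ge>\<^sub>0" .
qed

end

section \<open>Choice of the coefficients\<close>

lemma form_unit_left: "n < q \<Longrightarrow> form q b (\<lambda>i. if i = n then y else 0) v = y \<bullet> (\<Sum>j<q. b n j * v j)"
  by (simp add: form_eq_inner if_distrib[of "\<lambda>z. z \<bullet> _"] cong: if_cong)

text \<open>One step of the Cholesky decomposition subtracts from \<open>b\<close> the rank one matrix formed from its row \<open>n\<close>.\<close>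

lemma PSD_factorization_aux:
  fixes b :: "'f::star_scalar nmat"
  assumes "n \<le> q" "b \<in> PSD q" "\<And>i j. n \<le> i \<or> n \<le> j \<Longrightarrow> b i j = 0"
  shows "\<exists>d\<in>Mat n q. mmul n (adj d) d = b"
  using assms
proof (induction n arbitrary: b)
  case 0
  then have "mmul 0 (adj mzero) mzero = b" by (intro ext) (simp add: mmul_def)
  moreover have "(mzero :: 'f nmat) \<in> Mat 0 q" by (simp add: Mat_def mzero_def)
  ultimately show ?case by blast
next
  case (Suc n)
  have n: "n < q" and b: "b \<in> Herm q" "\<And>v. 0 \<le> form q b v v"
    using Suc.prems by (auto simp: PSD_iff_form)
  have adj: "star (b i j) = b j i" for i j using b(1) by (simp add: Herm_iff)
  have Mat: "b \<in> Mat q q" using b(1) by (simp add: Herm_iff)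
  define t where "t = re_part (b n n)"
  define e where "e = (\<lambda>y :: 'f. \<lambda>i. if i = n then y else 0)"
  have bnn: "b n n = of_real t"
    using adj[of n n] unfolding self_star_iff t_def .
  have row: "(\<Sum>j<q. b i j * e y j) = b i n * y" for i y
    using n by (simp add: e_def if_distrib[of "\<lambda>z. _ * z"] cong: if_cong)
  have fe: "form q b (e y) v = y \<bullet> (\<Sum>j<q. b n j * v j)" for y v
    unfolding e_def by (rule form_unit_left[OF n])
  have fee: "form q b (e y) (e y) = t * (norm y)\<^sup>2" for y
    unfolding fe row bnn by (simp add: scaleR_conv_of_real[symmetric] dot_square_norm)
  have "0 \<le> t" using b(2)[of "e 1"] unfolding fee by simp
  show ?case
  proof (cases "t = 0")
    \<comment> \<open>A zero pivot: semidefiniteness forces row and column \<open>n\<close> to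
      vanish, so the support of \<open>b\<close> already shrinks.\<close>
    case True
    then have "form q b (e 1) (e 1) = 0" by (simp add: fee)
    from PSD_null[OF Suc.prems(2) this] have col: "b i n = 0" if "i < q" for i
      using that by (simp add: row)
    then have col: "b i n = 0" for i using Mat by (cases "i < q") (auto simp: Mat_def)
    then have row0: "b n i = 0" for i using adj[of i n] by simp
    have "b i j = 0" if "n \<le> i \<or> n \<le> j" for i j
      using that Suc.prems(3)[of i j] col row0 by (cases "i = n \<or> j = n") auto
    then obtain d where d: "d \<in> Mat n q" "mmul n (adj d) d = b"
      using Suc.IH[of b] Suc.prems by auto
    then have "mmul (Suc n) (adj d) d = b"
      using mmul_mono_inner[of "adj d" q n d q "Suc n"] by auto
    moreover have "d \<in> Mat (Suc n) q" using Mat_mono[OF d(1)] by simp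
    ultimately show ?thesis by blast
  next
    case False
    then have t: "0 < t" using \<open>0 \<le> t\<close> by simp
    define b' where "b' = (\<lambda>i j. b i j - (1 / t) *\<^sub>R (b i n * b n j))"
    have Herm': "b' \<in> Herm q"
      unfolding Herm_iff using Mat by (auto simp: b'_def Mat_def star_diff star_scaleR star_mult adj)
    have "0 \<le> form q b' v v" for v
    proof -
      define x where "x = (\<Sum>j<q. b n j * v j)"
      have "form q b' v v = form q b v v - (1 / t) * (norm x)\<^sup>2"
      proof -
        have "(\<Sum>j<q. b' i j * v j) = (\<Sum>j<q. b i j * v j) - (1 / t) *\<^sub>R (b i n * x)" for i
          by (simp add: b'_def x_def left_diff_distrib sum_subtractf sum_distrib_left scaleR_sum_right mult.assoc)
        then have "form q b' v v = form q b v v - (1 / t) * (\<Sum>i<q. v i \<bullet> (b i n * x))"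
          by (simp add: form_eq_inner inner_diff_right sum_subtractf sum_distrib_left)
        also have "(\<Sum>i<q. v i \<bullet> (b i n * x)) = form q b v (e x)"
          by (simp add: form_eq_inner row)
        also have "\<dots> = (norm x)\<^sup>2"
          unfolding form_commute[OF b(1), of v] fe x_def[symmetric] by (simp add: dot_square_norm)
        finally show ?thesis .
      qed
      \<comment> \<open>Completing the square: the Schur complement at \<open>v\<close> is the form
        of \<open>b\<close> at \<open>v\<close> corrected in coordinate \<open>n\<close>, hence
        nonnegative.\<close>
      also have "\<dots> = form q b (\<lambda>i. v i + (- 1 / t) *\<^sub>R e x i) (\<lambda>i. v i + (- 1 / t) *\<^sub>R e x i)"
      proof -
        have "form q b (e x) v = (norm x)\<^sup>2" unfolding fe x_def[symmetric] by (simp add: dot_square_norm)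
        then show ?thesis
          unfolding form_add_left form_add_right form_scaleR_left form_scaleR_right fee form_commute[OF b(1), of v "e x"]
          using t by (simp add: field_simps power2_eq_square)
      qed
      finally show ?thesis using b(2) by simp
    qed
    then have PSD': "b' \<in> PSD q" using Herm' by (simp add: PSD_iff_form)
    have tt: "(1 / t) *\<^sub>R (of_real t * y) = y" "(1 / t) *\<^sub>R (y * of_real t) = y" for y :: 'f
      using t by (simp_all add: scaleR_conv_of_real[symmetric] of_real_def)
    have "b' i j = 0" if "n \<le> i \<or> n \<le> j" for i j
      using that Suc.prems(3)[of i j] Suc.prems(3)[of i n] Suc.prems(3)[of n j]
      by (cases "i = n \<or> j = n") (auto simp: b'_def bnn tt)
    then obtain d' where d': "d' \<in> Mat n q" "mmul n (adj d') d' = b'"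
      using Suc.IH[of b'] PSD' Suc.prems(1) by auto
    define d where "d = (\<lambda>i j. if i = n then (1 / sqrt t) *\<^sub>R b n j else d' i j)"
    have "mmul (Suc n) (adj d) d i j = b i j" for i j
    proof -
      have "mmul (Suc n) (adj d) d i j = mmul n (adj d') d' i j + star (d n i) * d n j"
        by (simp add: mmul_def adj_def d_def)
      also have "star (d n i) * d n j = (1 / t) *\<^sub>R (b i n * b n j)"
        using t by (simp add: d_def star_scaleR adj)
      finally show ?thesis by (simp add: d' b'_def)
    qed
    then have "mmul (Suc n) (adj d) d = b" by (intro ext)
    moreover have "d \<in> Mat (Suc n) q" using d'(1) Mat n by (auto simp: d_def Mat_def)
    ultimately show ?thesis by blast
  qed
qed

lemma PSD_factorization:
  assumes "b \<in> PSD q" obtains d where "d \<in> Mat q q" "mmul q (adj d) d = b"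
proof -
  have "b i j = 0" if "q \<le> i \<or> q \<le> j" for i j
    using assms that unfolding PSD_def Herm_def Mat_def by auto
  then show ?thesis using PSD_factorization_aux[OF order_refl assms] that by blast
qed

text \<open>Collects \<open>a\<close> into its square, so that the limit depends on \<open>a\<close>
  in the same way as \<open>\<psi>\<close> does.\<close>

lemma frob_mmul_Herm:
  assumes "a \<in> Herm q"
  shows "frob q r (mmul q a (adj x)) (mmul q a (adj y)) = frob q q (mmul q a a) (mmul r (adj x) y)"
proof -
  have a: "adj a = a" using assms by (simp add: Herm_def)
  have "frob q r (mmul q a (adj x)) (mmul q a (adj y)) = frob q r (adj x) (mmul q (mmul q a a) (adj y))"
    by (simp add: frob_mmul_left a mmul_assoc)
  also have "\<dots> = frob q r (mmul q (mmul q a a) (adj y)) (adj x)" by (rule frob_commute)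
  also have "\<dots> = frob q q (mmul q a a) (mmul r (adj x) y)" by (simp add: frob_mmul_right)
  finally show ?thesis .
qed

text \<open>The minus sign in front and conjugate-linearity in the second argument together give
  \<open>w\<close> a positive sign.\<close>

lemma hermC_inner_square:
  assumes "a \<in> Herm q"
  shows "- hermC_inner q (to_HermC (mmul q a a)) (z, w)
    = Complex (- frob q q (mmul q a a) z) (frob q q (mmul q a a) w)"
proof -
  have "adj (mmul q a a) = mmul q a a" using assms by (simp add: adj_mmul Herm_def)
  moreover have "frob q q (adj mzero) x = 0" for x :: "'a nmat"
    by (simp add: frob_def adj_def mzero_def)
  ultimately show ?thesis
    by (simp add: to_HermC_def herm_inner_eq_frob complex_eq_iff)
qed

lemma sum_three_blocks:
  fixes f :: "nat \<Rightarrow> 'a::comm_monoid_add"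
  shows "(\<Sum>i<3 * q. f i) = (\<Sum>i<q. f i) + (\<Sum>i<q. f (q + i)) + (\<Sum>i<q. f (2 * q + i))"
proof -
  have "(\<Sum>i<m + q. f i) = (\<Sum>i<m. f i) + (\<Sum>i<q. f (m + i))" for m
    by (induction q) (simp_all add: add.assoc)
  from this[of "2 * q"] this[of q] show ?thesis by (simp add: mult_2 numeral_3_eq_3 add.assoc)
qed

text \<open>
  Three blocks of rows: the pair \<open>(1, w)\<close> produces the imaginary part \<open>w\<close>, and the error
  \<open>1 - w\<^sup>2\<close> it makes in the real part is corrected by the blocks \<open>((h + 1) / 2, 0)\<close> and
  \<open>(0, (h - 1) / 2)\<close>, whose squares differ by \<open>h\<close>.
\<close>

lemma HermC_coefficients:
  fixes z w :: "'f::star_scalar nmat"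
  assumes z: "z \<in> Herm q" and w: "w \<in> Herm q"
  obtains c d where "c \<in> Mat (3 * q) q" "d \<in> Mat (3 * q) q"
    "\<And>a. a \<in> Herm q \<Longrightarrow> csquare q (3 * q) (mmul q a (adj c)) (mmul q a (adj d)) / 2
      = - hermC_inner q (to_HermC (mmul q a a)) (z, w)"
proof -
  define I where "I = (mone q :: 'f nmat)"
  \<comment> \<open>\<open>csquare\<close> is halved, so the target is
    \<open>c^* c - d^* d = - 2 z\<close> and \<open>c^* d = w\<close>. The blocks give the
    difference \<open>1 - w^2 + h\<close>, which fixes \<open>h\<close>.\<close>
  define h where "h = (\<lambda>i j. mmul q w w i j - I i j - 2 *\<^sub>R z i j)"
  define P Q where "P = (\<lambda>i j. (1 / 2) *\<^sub>R (h i j + I i j))" and "Q = (\<lambda>i j. (1 / 2) *\<^sub>R (h i j - I i j))"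
  define c where "c = (\<lambda>i j. if i < q then I i j else if i < 2 * q then P (i - q) j else 0)"
  define d where "d = (\<lambda>i j. if i < q then w i j else if i < 2 * q then 0 else if i < 3 * q then Q (i - 2 * q) j else 0)"
  have I: "I \<in> Mat q q" "adj I = I" by (auto simp: I_def Mat_def mone_def adj_def fun_eq_iff)
  have zw: "z \<in> Mat q q" "w \<in> Mat q q" "adj w = w" "adj z = z" using z w by (auto simp: Herm_def)
  have ww: "mmul q w w \<in> Mat q q" "adj (mmul q w w) = mmul q w w" using zw by (auto intro: mmul_Mat simp: adj_mmul)
  have h: "h \<in> Mat q q" "adj h = h"
    using zw ww I by (auto simp: h_def Mat_def adj_def star_diff star_scaleR fun_eq_iff)
  have P: "P \<in> Mat q q" "adj P = P" and Q: "Q \<in> Mat q q" "adj Q = Q"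
    using h I by (auto simp: P_def Q_def Mat_def adj_def star_diff star_add star_scaleR fun_eq_iff)
  have blocks: "mmul (3 * q) (adj x) y i j = mmul q (adj x) y i j
      + (\<Sum>k<q. star (x (q + k) i) * y (q + k) j) + (\<Sum>k<q. star (x (2 * q + k) i) * y (2 * q + k) j)" for x y :: "'f nmat" and i j
    by (simp add: mmul_def adj_def sum_three_blocks)
  have cc: "mmul (3 * q) (adj c) c i j = I i j + mmul q P P i j" for i j
  proof -
    have "mmul q (adj c) c i j = mmul q (adj I) I i j"
      by (simp add: mmul_def adj_def c_def)
    also have "mmul q (adj I) I = I" unfolding I(2) using mmul_mone_left[OF I(1)] by (simp add: I_def)
    finally have "mmul (3 * q) (adj c) c i j = I i j + mmul q (adj P) P i j"
      unfolding blocks by (simp add: c_def mmul_def adj_def)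
    then show ?thesis by (simp add: P)
  qed
  have dd: "mmul (3 * q) (adj d) d i j = mmul q w w i j + mmul q Q Q i j" for i j
  proof -
    have "mmul q (adj d) d i j = mmul q (adj w) w i j"
      by (simp add: mmul_def adj_def d_def)
    then have "mmul (3 * q) (adj d) d i j = mmul q (adj w) w i j + mmul q (adj Q) Q i j"
      unfolding blocks by (simp add: d_def mmul_def adj_def)
    then show ?thesis by (simp add: Q zw)
  qed
  have cd: "mmul (3 * q) (adj c) d = w"
  proof (intro ext)
    fix i j
    have "mmul q (adj c) d i j = mmul q (adj I) w i j"
      by (simp add: mmul_def adj_def c_def d_def)
    also have "mmul q (adj I) w = w" unfolding I(2) using mmul_mone_left[OF zw(2)] by (simp add: I_def)
    finally show "mmul (3 * q) (adj c) d i j = w i j"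
      unfolding blocks by (simp add: c_def d_def)
  qed
  have PQ: "mmul q P P i j - mmul q Q Q i j = h i j" for i j
  proof -
    have half: "mmul q (\<lambda>i j. (1 / 2) *\<^sub>R x i j) (\<lambda>i j. (1 / 2) *\<^sub>R x i j) i j = (1 / 4) *\<^sub>R mmul q x x i j" for x :: "'f nmat"
      by (simp add: mmul_def scaleR_sum_right)
    have hI: "mmul q h I = h" "mmul q I h = h" "mmul q I I = I"
      using mmul_mone_left[OF h(1)] mmul_mone_right[OF h(1)] mmul_mone_left[OF I(1)] by (simp_all add: I_def)
    have "mmul q P P i j - mmul q Q Q i j = (1 / 4) *\<^sub>R (4 *\<^sub>R h i j)"
      unfolding P_def Q_def half scaleR_diff_right[symmetric] mmul_add_left mmul_add_right mmul_diff_left mmul_diff_right hI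
      by (simp add: scaleR_2[symmetric] algebra_simps)
    then show ?thesis by simp
  qed
  show ?thesis
  proof
    show "c \<in> Mat (3 * q) q" "d \<in> Mat (3 * q) q"
      using I P Q zw by (auto simp: c_def d_def Mat_def)
    fix a :: "'f nmat" assume a: "a \<in> Herm q"
    let ?A = "mmul q a a"
    have "mmul (3 * q) (adj c) c i j - mmul (3 * q) (adj d) d i j = (-2) *\<^sub>R z i j" for i j
      using PQ[of i j] unfolding cc dd h_def by (simp add: algebra_simps)
    then have "frob q q ?A (mmul (3 * q) (adj c) c) - frob q q ?A (mmul (3 * q) (adj d) d) = - 2 * frob q q ?A z"
      by (simp only: frob_diff_right[symmetric] frob_scaleR_right)
    then show "csquare q (3 * q) (mmul q a (adj c)) (mmul q a (adj d)) / 2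
        = - hermC_inner q (to_HermC (mmul q a a)) (z, w)"
      unfolding hermC_inner_square[OF a] csquare_def frob_mmul_Herm[OF a] cd by (simp add: complex_eq_iff)
  qed
qed

text \<open>For positive semidefinite \<open>b\<close> the exponent is minus a sum of squares, so an
  imaginary functional suffices, as positive definiteness requires.\<close>

lemma PSD_coefficients:
  fixes b :: "'f::star_scalar nmat"
  assumes b: "b \<in> PSD q"
  obtains d where "d \<in> Mat q q"
    "\<And>a. a \<in> Herm q \<Longrightarrow> csquare q q mzero (mmul q a (adj d)) / 2 = - hermC_inner q (to_HermC (mmul q a a)) (to_HermC b)"
proof -
  obtain e where e: "e \<in> Mat q q" "mmul q (adj e) e = b" using PSD_factorization[OF b] .
  \<comment> \<open>The factor \<open>sqrt 2\<close> compensates the one half in the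
    variance.\<close>
  define d where "d = (\<lambda>i j. sqrt 2 *\<^sub>R e i j)"
  have dd: "mmul q (adj d) d = (\<lambda>i j. 2 *\<^sub>R b i j)"
    unfolding e(2)[symmetric] by (simp add: d_def mmul_def adj_def star_scaleR scaleR_sum_right)
  show ?thesis
  proof
    show "d \<in> Mat q q" using e(1) by (auto simp: d_def Mat_def)
    fix a :: "'f nmat" assume a: "a \<in> Herm q"
    have zero: "frob q q mzero x = 0" "frob q q x mzero = 0" for x :: "'f nmat"
      by (simp_all add: frob_def mzero_def)
    show "csquare q q mzero (mmul q a (adj d)) / 2 = - hermC_inner q (to_HermC (mmul q a a)) (to_HermC b)"
      unfolding to_HermC_def[of b] hermC_inner_square[OF a] csquare_def zero frob_mmul_Herm[OF a] dd frob_scaleR_right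
      by (simp add: complex_eq_iff)
  qed
qed

section \<open>Convergence\<close>

lemma frob_Mat_mono:
  assumes "c \<in> Mat q r" "q \<le> p" "r \<le> p"
  shows "frob p p c k = frob q r c k"
proof -
  have "frob p p c k = (\<Sum>l<p. \<Sum>i<r. c l i \<bullet> k l i)"
    unfolding frob_def using assms by (intro sum.cong refl sum.mono_neutral_right) (auto simp: Mat_def)
  also have "\<dots> = frob q r c k"
    unfolding frob_def using assms by (intro sum.mono_neutral_right) (auto simp: Mat_def)
  finally show ?thesis .
qed

text \<open>The factor cancels the \<open>1 / N\<close> in the Gaussian approximation, with
  \<open>N = DIM('f) * (p - q)\<close>. At \<open>p = q\<close> it is 0 and the spherical function
  is the constant 1.\<close>

definition scaled :: "nat \<Rightarrow> nat \<Rightarrow> 'f::star_scalar nmat \<Rightarrow> 'f nmat" where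
  "scaled p q c = (\<lambda>i j. sqrt (real DIM('f) * real (p - q)) *\<^sub>R c i j)"

lemma (in haar_matrix) sph_scaled_approx:
  assumes qp: "q < p" and rp: "r \<le> p" and c: "c \<in> Mat r q" and d: "d \<in> Mat r q" and a: "a \<in> Mat q q"
  shows "norm (sph q (scaled p q c) (scaled p q d) a - exp (csquare q r (mmul q a (adj c)) (mmul q a (adj d)) / 2))
    \<le> 4 * real DIM('f) * real q * real r * exp 1 / real (p - q) * exp (2 * frob q r (mmul q a (adj c)) (mmul q a (adj c)))"
proof -
  define N where "N = real DIM('f) * real (p - q)"
  have N: "N > 0" using qp by (simp add: N_def)
  have ac: "mmul q a (adj (scaled p q x)) = (\<lambda>i j. sqrt N *\<^sub>R mmul q a (adj x) i j)" for x
    by (simp add: scaled_def mmul_def adj_def star_scaleR scaleR_sum_right N_def)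
  have M: "mmul q a (adj x) \<in> Mat q r" if "x \<in> Mat r q" for x
    using a that by (intro mmul_Mat adj_Mat)
  then have M': "mmul q a (adj (scaled p q x)) \<in> Mat q r" if "x \<in> Mat r q" for x
    unfolding ac using that by (auto simp: Mat_def)
  have fr: "frob q r (mmul q a (adj (scaled p q x))) (mmul q a (adj (scaled p q y))) = N * frob q r (mmul q a (adj x)) (mmul q a (adj y))" for x y
    unfolding ac frob_scaleR_left frob_scaleR_right using N by (simp add: mult.assoc[symmetric])
  \<comment> \<open>Because \<open>a\<close> is a \<open>q\<close> by \<open>q\<close> matrix and
    the coefficients have \<open>r\<close> rows, only the upper left \<open>q\<close> by
    \<open>r\<close> corner of \<open>k\<close> is seen, although \<open>sph\<close> pairs
    \<open>p\<close> by \<open>p\<close> matrices.\<close>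
  have e1: "sph q (scaled p q c) (scaled p q d) a
      = (\<integral>k. exp (mat_fun q r (mmul q a (adj (scaled p q c))) (mmul q a (adj (scaled p q d))) k) \<partial>\<nu>)"
    using frob_Mat_mono[OF M'[OF c] less_imp_le[OF qp] rp] frob_Mat_mono[OF M'[OF d] less_imp_le[OF qp] rp]
    by (simp add: sph_def mat_fun_def)
  have e2: "csquare q r (mmul q a (adj (scaled p q c))) (mmul q a (adj (scaled p q d))) / of_real (2 * N)
      = csquare q r (mmul q a (adj c)) (mmul q a (adj d)) / 2"
    using N by (simp add: csquare_def fr complex_eq_iff right_diff_distrib[symmetric])
  have e3: "4 * (real DIM('f))\<^sup>2 * real q * real r * exp 1 / N = 4 * real DIM('f) * real q * real r * exp 1 / real (p - q)"
    by (simp add: N_def power2_eq_square)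
  show ?thesis
    using integral_exp_mat_fun_approx[OF qp rp, of "mmul q a (adj (scaled p q c))" "mmul q a (adj (scaled p q d))",
        folded N_def, unfolded e2 e3 fr, folded e1] N
    by simp
qed

definition haar_of :: "nat \<Rightarrow> 'f::star_scalar nmat measure" where
  "haar_of p = (SOME \<nu>. haar_Umat p \<nu>)"

lemma haar_matrix_haar_of: "haar_matrix p (haar_of p)"
  unfolding haar_matrix_def haar_of_def by (rule someI_ex[OF haar_Umat_exists])

text \<open>The error bound depends on \<open>a\<close> only through the real coefficients, so
  bounding their squared norm on \<open>S\<close> gives a uniform rate
  \<open>X / (p - q)\<close>.\<close>

lemma uniform_limit_sph:
  fixes c d :: "'f::star_scalar nmat"
  assumes c: "c \<in> Mat r q" and d: "d \<in> Mat r q" and S: "S \<subseteq> Mat q q"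
    and B: "\<And>a. a \<in> S \<Longrightarrow> frob q r (mmul q a (adj c)) (mmul q a (adj c)) \<le> B"
    and l: "\<And>a. a \<in> S \<Longrightarrow> l a = exp (csquare q r (mmul q a (adj c)) (mmul q a (adj d)) / 2)"
  shows "uniform_limit S (\<lambda>p. haar_matrix.sph p (haar_of p) q (scaled p q c) (scaled p q d)) l sequentially"
proof (rule uniform_limitI)
  fix e :: real assume e: "0 < e"
  define X where "X = 4 * real DIM('f) * real q * real r * exp 1 * exp (2 * B)"
  \<comment> \<open>Shifting the index by \<open>q\<close> removes the truncated
    subtraction.\<close>
  have "(\<lambda>p. X / real (p + q - q)) \<longlonglongrightarrow> 0" using lim_const_over_n[of X] by simp
  then have "(\<lambda>p. X / real (p - q)) \<longlonglongrightarrow> 0" by (rule LIMSEQ_offset)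
  then have "\<forall>\<^sub>F p in sequentially. X / real (p - q) < e" using e by (rule order_tendstoD)
  moreover have "\<forall>\<^sub>F p in sequentially. q < p \<and> r \<le> p"
    by (intro eventually_conj eventually_gt_at_top eventually_ge_at_top)
  ultimately show "\<forall>\<^sub>F p in sequentially. \<forall>a\<in>S.
      dist (haar_matrix.sph p (haar_of p) q (scaled p q c) (scaled p q d) a) (l a) < e"
  proof eventually_elim
    case (elim p)
    interpret haar_matrix p "haar_of p :: 'f nmat measure" by (rule haar_matrix_haar_of)
    show ?case
    proof
      fix a assume a: "a \<in> S"
      have "dist (sph q (scaled p q c) (scaled p q d) a) (l a)
          \<le> 4 * real DIM('f) * real q * real r * exp 1 / real (p - q) * exp (2 * frob q r (mmul q a (adj c)) (mmul q a (adj c)))"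
        unfolding dist_norm l[OF a] using elim a S by (intro sph_scaled_approx c d) auto
      also have "\<dots> \<le> 4 * real DIM('f) * real q * real r * exp 1 / real (p - q) * exp (2 * B)"
        using B[OF a] by (intro mult_left_mono) auto
      also have "\<dots> = X / real (p - q)" by (simp add: X_def)
      finally show "dist (sph q (scaled p q c) (scaled p q d) a) (l a) < e" using elim by linarith
    qed
  qed
qed

theorem spherical_limit:
  fixes b :: "'f::star_scalar nmat \<times> 'f nmat"
  assumes "b \<in> HermC q"
  shows "\<exists>\<phi>. (\<forall>p\<ge>q. spherical_fun p q (\<phi> p)) \<and> locally_uniform_limit (PSD q) \<phi> (\<psi> q b) sequentially"
proof -
  obtain z w where b: "b = (z, w)" "z \<in> Herm q" "w \<in> Herm q" using assms by (auto simp: HermC_def)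
  obtain c d where c: "c \<in> Mat (3 * q) q" and d: "d \<in> Mat (3 * q) q"
    and cd: "\<And>a. a \<in> Herm q \<Longrightarrow> csquare q (3 * q) (mmul q a (adj c)) (mmul q a (adj d)) / 2
      = - hermC_inner q (to_HermC (mmul q a a)) (z, w)"
    using HermC_coefficients[OF b(2,3)] by blast
  define \<phi> where "\<phi> = (\<lambda>p. haar_matrix.sph p (haar_of p) q (scaled p q c) (scaled p q d))"
  have "spherical_fun p q (\<phi> p)" if "q \<le> p" for p
    unfolding \<phi>_def by (rule haar_matrix.spherical_sph[OF haar_matrix_haar_of that])
  moreover have "locally_uniform_limit (PSD q) \<phi> (\<psi> q b) sequentially"
    unfolding locally_uniform_limit_def
  proof
    fix a0 :: "'f nmat" assume "a0 \<in> PSD q"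
    \<comment> \<open>The squared norm of the real coefficients is continuous in \<open>a\<close>,
      so a sublevel set around \<open>a0\<close> is a neighbourhood with a uniform error
      bound.\<close>
    define f where "f = (\<lambda>a. frob q (3 * q) (mmul q a (adj c)) (mmul q a (adj c)))"
    have "continuous_on UNIV f"
      unfolding f_def frob_def mmul_def by (intro continuous_intros)
    then have "open {a. f a < f a0 + 1}"
      by (intro open_Collect_less continuous_on_const)
    moreover have "uniform_limit (PSD q \<inter> {a. f a < f a0 + 1}) \<phi> (\<psi> q b) sequentially"
      unfolding \<phi>_def
    proof (rule uniform_limit_sph[OF c d, where B = "f a0 + 1"])
      show "PSD q \<inter> {a. f a < f a0 + 1} \<subseteq> Mat q q" by (auto simp: PSD_def Herm_def)
      fix a assume a: "a \<in> PSD q \<inter> {a. f a < f a0 + 1}"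
      then show "frob q (3 * q) (mmul q a (adj c)) (mmul q a (adj c)) \<le> f a0 + 1" by (simp add: f_def)
      have "a \<in> Herm q" using a by (simp add: PSD_def)
      then show "\<psi> q b a = exp (csquare q (3 * q) (mmul q a (adj c)) (mmul q a (adj d)) / 2)"
        unfolding \<psi>_def b(1) by (simp only: cd)
    qed
    ultimately show "\<exists>V. open V \<and> a0 \<in> V \<and> uniform_limit (PSD q \<inter> V) \<phi> (\<psi> q b) sequentially"
      by (intro exI[of _ "{a. f a < f a0 + 1}"]) simp
  qed
  ultimately show ?thesis by blast
qed

theorem positive_definite_spherical_limit:
  fixes b :: "'f::star_scalar nmat"
  assumes "b \<in> PSD q"
  shows "\<exists>\<phi>. (\<forall>p\<ge>q. spherical_fun p q (\<phi> p) \<and> pos_def_fun p q (\<phi> p)) \<and>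
    uniform_limit (PSD q) \<phi> (\<psi> q (to_HermC b)) sequentially"
proof -
  obtain d where d: "d \<in> Mat q q" and dd: "\<And>a. a \<in> Herm q \<Longrightarrow>
      csquare q q mzero (mmul q a (adj d)) / 2 = - hermC_inner q (to_HermC (mmul q a a)) (to_HermC b)"
    using PSD_coefficients[OF assms] by blast
  define \<phi> where "\<phi> = (\<lambda>p. haar_matrix.sph p (haar_of p) q (scaled p q mzero) (scaled p q d))"
  have m: "mzero \<in> (Mat q q :: 'f nmat set)" "scaled p q mzero = (mzero :: 'f nmat)" for p
    by (auto simp: Mat_def mzero_def scaled_def)
  have am: "mmul q a (adj mzero) = (mzero :: 'f nmat)" for a
    by (simp add: mmul_def adj_def mzero_def)
  have "spherical_fun p q (\<phi> p) \<and> pos_def_fun p q (\<phi> p)" if "q \<le> p" for p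
    unfolding \<phi>_def m
    using haar_matrix.spherical_sph[OF haar_matrix_haar_of that] haar_matrix.positive_definite_sph[OF haar_matrix_haar_of that]
    by blast
  moreover have "uniform_limit (PSD q) \<phi> (\<psi> q (to_HermC b)) sequentially"
    unfolding \<phi>_def
  \<comment> \<open>The real coefficients vanish, so the bound 0 holds on all of
    \<open>PSD q\<close> and the convergence is global.\<close>
  proof (rule uniform_limit_sph[OF m(1) d, where B = 0])
    show "PSD q \<subseteq> (Mat q q :: 'f nmat set)" by (auto simp: PSD_def Herm_def)
    fix a :: "'f nmat" assume "a \<in> PSD q"
    then have a: "a \<in> Herm q" by (simp add: PSD_def)
    show "frob q q (mmul q a (adj mzero)) (mmul q a (adj mzero)) \<le> 0"
      unfolding am by (simp add: frob_def mzero_def)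
    show "\<psi> q (to_HermC b) a = exp (csquare q q (mmul q a (adj mzero)) (mmul q a (adj d)) / 2)"
      unfolding \<psi>_def am dd[OF a] ..
  qed
  ultimately show ?thesis by blast
qed

theorem corollary4p7:
  fixes q :: nat
  assumes "q \<ge> 1"
  shows
    "(\<forall>b \<in> (HermC q :: (real nmat \<times> real nmat) set).
        \<exists>\<phi> :: nat \<Rightarrow> real nmat \<Rightarrow> complex.
          (\<forall>p\<ge>q. spherical_fun p q (\<phi> p)) \<and>
          locally_uniform_limit (PSD q) \<phi> (\<psi> q b) sequentially) \<and>
     (\<forall>b \<in> (PSD q :: real nmat set).
        \<exists>\<phi> :: nat \<Rightarrow> real nmat \<Rightarrow> complex.
          (\<forall>p\<ge>q. spherical_fun p q (\<phi> p) \<and> pos_def_fun p q (\<phi> p)) \<and>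
          uniform_limit (PSD q) \<phi> (\<psi> q (to_HermC b)) sequentially) \<and>
     (\<forall>b \<in> (HermC q :: (complex nmat \<times> complex nmat) set).
        \<exists>\<phi> :: nat \<Rightarrow> complex nmat \<Rightarrow> complex.
          (\<forall>p\<ge>q. spherical_fun p q (\<phi> p)) \<and>
          locally_uniform_limit (PSD q) \<phi> (\<psi> q b) sequentially) \<and>
     (\<forall>b \<in> (PSD q :: complex nmat set).
        \<exists>\<phi> :: nat \<Rightarrow> complex nmat \<Rightarrow> complex.
          (\<forall>p\<ge>q. spherical_fun p q (\<phi> p) \<and> pos_def_fun p q (\<phi> p)) \<and>
          uniform_limit (PSD q) \<phi> (\<psi> q (to_HermC b)) sequentially) \<and>
     (\<forall>b \<in> (HermC q :: (quat nmat \<times> quat nmat) set).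
        \<exists>\<phi> :: nat \<Rightarrow> quat nmat \<Rightarrow> complex.
          (\<forall>p\<ge>q. spherical_fun p q (\<phi> p)) \<and>
          locally_uniform_limit (PSD q) \<phi> (\<psi> q b) sequentially) \<and>
     (\<forall>b \<in> (PSD q :: quat nmat set).
        \<exists>\<phi> :: nat \<Rightarrow> quat nmat \<Rightarrow> complex.
          (\<forall>p\<ge>q. spherical_fun p q (\<phi> p) \<and> pos_def_fun p q (\<phi> p)) \<and>
          uniform_limit (PSD q) \<phi> (\<psi> q (to_HermC b)) sequentially)"
  by (intro conjI ballI spherical_limit positive_definite_spherical_limit)

end
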